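(* Let $n\ge1$. The even center of the algebra $\widehat{\mathcal{H}}_n^-$ (the set of even elements commuting with every element of $\widehat{\mathcal{H}}_n^-$) is the algebra $\mathbb{C}(q)[p_1, p_2, \ldots, p_n]^{S_n}$ of symmetric polynomials in $p_1,\dots,p_n$.
   Context: Let $q$ be a formal parameter and $\varepsilon=q-q^{-1}$ (the parameter $q$ is not to be confused with the generators $q_i$). The spin affine Hecke algebra $\widehat{\mathcal{H}}_n^-$ is the unital associative $\mathbb{C}(q)$-algebra generated by $R_i$ $(1\le i\le n-1)$ and $p_i,q_i$ $(1\le i\le n)$ subject to: $R_i^2=-\varepsilon^2-2$; $R_iR_j=-R_jR_i$ for $|i-j|>1$; $R_iR_{i+1}R_i-R_{i+1}R_iR_{i+1}=\varepsilon^2(R_{i+1}-R_i)$; $p_ip_j=p_jp_i$ and $q_iq_j=-q_jq_i$ for $i\ne j$; $p_i^2+q_i^2=1$; $p_iq_j=q_jp_i$ for all $i,j$; $R_ip_j=p_jR_i$ and $R_iq_j=-q_jR_i$ for $j\ne i,i+1$; $R_ip_i=p_{i+1}R_i+\varepsilon(q_i-q_{i+1})$; $R_iq_i=-q_{i+1}R_i-\varepsilon(p_i+p_{i+1})$. It is a superalgebra ($\mathbb{Z}_2$-graded algebra) with $p_i$ even and $q_i,R_i$ odd. *)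

theory Defs
  imports
    Complex_Main
    "HOL-Library.Poly_Mapping"
    "HOL-Combinatorics.Permutations"
    "HOL-Computational_Algebra.Polynomial"
    "HOL-Computational_Algebra.Fraction_Field"
    "HOL-Algebra.QuotRing"
begin

section \<open>The ground field \<open>\<complex>(q)\<close>\<close>

type_synonym Cq = "complex poly fract"

definition qpar :: Cq
  where "qpar = Fract [:0, 1:] 1"

definition eps :: Cq
  where "eps = qpar - inverse qpar"


section \<open>The free algebra on the generators\<close>

datatype gen = GR nat | GP nat | GQ nat

text \<open>
  The free monoid is written additively, because the convolution product of
  \<^type>\<open>poly_mapping\<close> is the monoid algebra of an additive monoid.  Thus
  \<open>gen word \<Rightarrow>\<^sub>0 Cq\<close>, with its library ring structure, is the free unital
  associative algebra over \<open>Cq\<close> on \<^type>\<open>gen\<close>.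
\<close>

datatype 'a word = Word (letters: "'a list")

instantiation word :: (type) monoid_add
begin

definition zero_word :: "'a word"
  where "0 = Word []"

definition plus_word :: "'a word \<Rightarrow> 'a word \<Rightarrow> 'a word"
  where "u + v = Word (letters u @ letters v)"

instance
  by standard (simp_all add: zero_word_def plus_word_def)

end

type_synonym falg = "gen word \<Rightarrow>\<^sub>0 Cq"

definition scalar :: "Cq \<Rightarrow> falg"
  where "scalar c = Poly_Mapping.single 0 c"

definition gen :: "gen \<Rightarrow> falg"
  where "gen x = Poly_Mapping.single (Word [x]) 1"

abbreviation R :: "nat \<Rightarrow> falg" where "R i \<equiv> gen (GR i)"
abbreviation p :: "nat \<Rightarrow> falg" where "p i \<equiv> gen (GP i)"
abbreviation q :: "nat \<Rightarrow> falg" where "q i \<equiv> gen (GQ i)"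

definition gens :: "nat \<Rightarrow> gen set"
  where "gens n = GR ` {1..<n} \<union> GP ` {1..n} \<union> GQ ` {1..n}"

definition free_alg :: "nat \<Rightarrow> falg ring"
  where "free_alg n =
    \<lparr>carrier = {f. \<forall>w \<in> Poly_Mapping.keys f. set (letters w) \<subseteq> gens n},
     mult = (*), one = 1, zero = 0, add = (+)\<rparr>"


section \<open>The spin affine Hecke algebra\<close>

text \<open>A relation \<open>a = b\<close> is recorded as the element \<open>a - b\<close>.\<close>

definition relators :: "nat \<Rightarrow> falg set"
  where "relators n =
      {R i * R i - scalar (- eps\<^sup>2 - 2) | i. i \<in> {1..<n}}
    \<union> {R i * R j - (- (R j * R i)) | i j. i \<in> {1..<n} \<and> j \<in> {1..<n} \<and> \<bar>int i - int j\<bar> > 1}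
    \<union> {(R i * R (i+1) * R i - R (i+1) * R i * R (i+1)) - scalar (eps\<^sup>2) * (R (i+1) - R i)
        | i. i \<in> {1..<n} \<and> i + 1 \<in> {1..<n}}
    \<union> {p i * p j - p j * p i | i j. i \<in> {1..n} \<and> j \<in> {1..n} \<and> i \<noteq> j}
    \<union> {q i * q j - (- (q j * q i)) | i j. i \<in> {1..n} \<and> j \<in> {1..n} \<and> i \<noteq> j}
    \<union> {(p i * p i + q i * q i) - 1 | i. i \<in> {1..n}}
    \<union> {p i * q j - q j * p i | i j. i \<in> {1..n} \<and> j \<in> {1..n}}
    \<union> {R i * p j - p j * R i | i j. i \<in> {1..<n} \<and> j \<in> {1..n} \<and> j \<noteq> i \<and> j \<noteq> i + 1}
    \<union> {R i * q j - (- (q j * R i)) | i j. i \<in> {1..<n} \<and> j \<in> {1..n} \<and> j \<noteq> i \<and> j \<noteq> i + 1}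
    \<union> {R i * p i - (p (i+1) * R i + scalar eps * (q i - q (i+1))) | i. i \<in> {1..<n}}
    \<union> {R i * q i - (- (q (i+1) * R i) - scalar eps * (p i + p (i+1))) | i. i \<in> {1..<n}}"

definition rel_ideal :: "nat \<Rightarrow> falg set"
  where "rel_ideal n = Idl\<^bsub>free_alg n\<^esub> (relators n)"

definition spin_hecke :: "nat \<Rightarrow> falg set ring"
  where "spin_hecke n = free_alg n Quot rel_ideal n"

definition cls :: "nat \<Rightarrow> falg \<Rightarrow> falg set"
  where "cls n f = rel_ideal n +>\<^bsub>free_alg n\<^esub> f"

text \<open>
  The \<open>\<complex>(q)\<close>-algebra structure of the quotient is given by the scalars
  \<open>cls n (scalar c)\<close>, which are central.
\<close>


section \<open>The even center\<close>

fun odd_gen :: "gen \<Rightarrow> bool" where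
  "odd_gen (GR i) = True"
| "odd_gen (GP i) = False"
| "odd_gen (GQ i) = True"

definition even_word :: "gen word \<Rightarrow> bool"
  where "even_word w \<longleftrightarrow> even (length (filter odd_gen (letters w)))"

text \<open>
  The relators are homogeneous for the parity of words, so the grading of the
  free algebra descends; the even part of the quotient is the image of the even part.
\<close>

definition even_part :: "nat \<Rightarrow> falg set set"
  where "even_part n =
    cls n ` {f \<in> carrier (free_alg n). \<forall>w \<in> Poly_Mapping.keys f. even_word w}"

definition even_center :: "nat \<Rightarrow> falg set set"
  where "even_center n =
    {z \<in> even_part n. \<forall>a \<in> carrier (spin_hecke n).
       z \<otimes>\<^bsub>spin_hecke n\<^esub> a = a \<otimes>\<^bsub>spin_hecke n\<^esub> z}"


section \<open>Symmetric polynomials and their evaluation at \<open>p\<^sub>1, \<dots>, p\<^sub>n\<close>\<close>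

text \<open>
  A polynomial maps exponent vectors, finitely supported functions on the indices
  of the variables, to coefficients.
\<close>

type_synonym mpol = "(nat \<Rightarrow>\<^sub>0 nat) \<Rightarrow>\<^sub>0 Cq"

definition mpols :: "nat \<Rightarrow> mpol set"
  where "mpols n = {f. \<forall>m \<in> Poly_Mapping.keys f. Poly_Mapping.keys m \<subseteq> {1..n}}"

text \<open>
  For a permutation \<open>\<pi>\<close>, \<open>map_key \<pi> m\<close> is the exponent vector \<open>m \<circ> \<pi>\<close>, so
  \<open>map_key (map_key \<pi>) f\<close> has at \<open>m\<close> the coefficient of \<open>f\<close> at \<open>m \<circ> \<pi>\<close>: it is \<open>f\<close>
  with each variable \<open>x\<^sub>i\<close> replaced by \<open>x\<^bsub>\<pi> i\<^esub>\<close>.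
\<close>

definition permute_vars :: "(nat \<Rightarrow> nat) \<Rightarrow> mpol \<Rightarrow> mpol"
  where "permute_vars \<pi> f = Poly_Mapping.map_key (Poly_Mapping.map_key \<pi>) f"

definition sym_pols :: "nat \<Rightarrow> mpol ring"
  where "sym_pols n =
    \<lparr>carrier = {f \<in> mpols n. \<forall>\<pi>. \<pi> permutes {1..n} \<longrightarrow> permute_vars \<pi> f = f},
     mult = (*), one = 1, zero = 0, add = (+)\<rparr>"

text \<open>
  The order of the factors is fixed only to lift the substitution to the free
  algebra; the \<open>p\<^sub>i\<close> commute in the quotient.
\<close>

definition eval_p :: "nat \<Rightarrow> mpol \<Rightarrow> falg set"
  where "eval_p n f = cls n
    (\<Sum>m \<in> Poly_Mapping.keys f. scalar (Poly_Mapping.lookup f m)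
        * (\<Prod>i\<leftarrow>[1..<Suc n]. p i ^ Poly_Mapping.lookup m i))"


section \<open>Well-definedness\<close>

lemma permute_vars_single:
  assumes "bij \<pi>"
  shows "permute_vars \<pi> (Poly_Mapping.single (Poly_Mapping.single i k) c)
    = Poly_Mapping.single (Poly_Mapping.single (\<pi> i) k) c"
proof -
  have inj: "inj \<pi>" and surj: "surj \<pi>"
    using assms by (auto simp: bij_def)
  have inj': "inj (Poly_Mapping.map_key \<pi> :: (nat \<Rightarrow>\<^sub>0 nat) \<Rightarrow> _)"
  proof (rule injI)
    fix a b :: "nat \<Rightarrow>\<^sub>0 nat"
    assume *: "Poly_Mapping.map_key \<pi> a = Poly_Mapping.map_key \<pi> b"
    show "a = b"
    proof (rule poly_mapping_eqI)
      fix j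
      obtain l where "j = \<pi> l" using surj by blast
      then show "Poly_Mapping.lookup a j = Poly_Mapping.lookup b j"
        using arg_cong[OF *, of "\<lambda>g. Poly_Mapping.lookup g l"] inj
        by (simp add: map_key.rep_eq)
    qed
  qed
  have "Poly_Mapping.map_key \<pi> (Poly_Mapping.single (\<pi> i) k) = Poly_Mapping.single i k"
    by (rule map_key_single[OF inj])
  then show ?thesis
    unfolding permute_vars_def
    using map_key_single[OF inj', of "Poly_Mapping.single (\<pi> i) k" c] by simp
qed

lemma free_alg_subset_add:
  assumes "f \<in> carrier (free_alg n)" "g \<in> carrier (free_alg n)"
  shows "f + g \<in> carrier (free_alg n)"
  using assms Poly_Mapping.keys_add[of f g] unfolding free_alg_def by auto

lemma free_alg_subset_uminus:
  assumes "f \<in> carrier (free_alg n)"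
  shows "- f \<in> carrier (free_alg n)"
  using assms unfolding free_alg_def by simp

lemma free_alg_subset_diff:
  assumes "f \<in> carrier (free_alg n)" "g \<in> carrier (free_alg n)"
  shows "f - g \<in> carrier (free_alg n)"
  using free_alg_subset_add[OF assms(1) free_alg_subset_uminus[OF assms(2)]] by simp

lemma free_alg_subset_mult:
  assumes "f \<in> carrier (free_alg n)" "g \<in> carrier (free_alg n)"
  shows "f * g \<in> carrier (free_alg n)"
proof -
  have "set (letters w) \<subseteq> gens n" if w: "w \<in> Poly_Mapping.keys (f * g)" for w
  proof -
    obtain u v where "w = u + v" "u \<in> Poly_Mapping.keys f" "v \<in> Poly_Mapping.keys g"
      using Poly_Mapping.keys_mult[of f g] w by blast
    then show ?thesis
      using assms by (simp add: free_alg_def plus_word_def)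
  qed
  then show ?thesis
    by (simp add: free_alg_def)
qed

lemma free_alg_subset_one: "1 \<in> carrier (free_alg n)"
  by (simp add: free_alg_def zero_word_def)

lemma free_alg_subset_scalar: "scalar c \<in> carrier (free_alg n)"
  by (simp add: free_alg_def scalar_def zero_word_def)

lemma free_alg_subset_gen: "x \<in> gens n \<Longrightarrow> gen x \<in> carrier (free_alg n)"
  by (simp add: free_alg_def gen_def)

lemma free_alg_ops:
  "f \<otimes>\<^bsub>free_alg n\<^esub> g = f * g" "\<one>\<^bsub>free_alg n\<^esub> = 1"
  "\<zero>\<^bsub>free_alg n\<^esub> = 0" "f \<oplus>\<^bsub>free_alg n\<^esub> g = f + g"
  by (simp_all add: free_alg_def)

lemma ring_free_alg: "ring (free_alg n)"
proof (rule ringI)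
  show "abelian_group (free_alg n)"
  proof (rule abelian_groupI)
    fix f assume "f \<in> carrier (free_alg n)"
    then show "\<exists>g \<in> carrier (free_alg n). g \<oplus>\<^bsub>free_alg n\<^esub> f = \<zero>\<^bsub>free_alg n\<^esub>"
      by (intro bexI[of _ "- f"] free_alg_subset_uminus) (simp_all only: free_alg_ops left_minus)
  next
    show "\<zero>\<^bsub>free_alg n\<^esub> \<in> carrier (free_alg n)"
      by (simp add: free_alg_def)
  qed (simp_all only: free_alg_ops free_alg_subset_add add.assoc add.left_commute add.commute
      add_0_left add_0_right)
  show "monoid (free_alg n)"
    by (rule monoidI)
      (simp_all only: free_alg_ops free_alg_subset_mult free_alg_subset_one
        mult.assoc mult_1_left mult_1_right)
qed (simp_all only: free_alg_ops distrib_left distrib_right)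

lemma relators_subset: "relators n \<subseteq> carrier (free_alg n)"
proof
  fix x assume x: "x \<in> relators n"
  have R: "R i \<in> carrier (free_alg n)" if "i \<in> {1..<n}" for i
    using that by (auto intro!: free_alg_subset_gen simp: gens_def)
  have P: "p i \<in> carrier (free_alg n)" if "i \<in> {1..n}" for i
    using that by (auto intro!: free_alg_subset_gen simp: gens_def)
  have Q: "q i \<in> carrier (free_alg n)" if "i \<in> {1..n}" for i
    using that by (auto intro!: free_alg_subset_gen simp: gens_def)
  have ivl: "i \<in> {1..n}" "i + 1 \<in> {1..n}" if "i \<in> {1..<n}" for i
    using that by auto
  from x show "x \<in> carrier (free_alg n)"
    unfolding relators_def
    by (elim UnE CollectE exE conjE; hypsubst)
      (simp_all only: free_alg_subset_add free_alg_subset_uminus free_alg_subset_diff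
        free_alg_subset_mult free_alg_subset_one free_alg_subset_scalar R P Q ivl)
qed

lemma ideal_rel_ideal: "ideal (rel_ideal n) (free_alg n)"
  unfolding rel_ideal_def by (rule ring.genideal_ideal[OF ring_free_alg relators_subset])

lemma ring_spin_hecke: "ring (spin_hecke n)"
  unfolding spin_hecke_def by (rule ideal.quotient_is_ring[OF ideal_rel_ideal])

end

theory Submission
  imports Defs "HOL-Computational_Algebra.Primes"
begin

text \<open>
  The relations allow every element to be rewritten as a combination of words
  \<open>p\<^sup>m q\<^sub>S D\<^sub>t\<close>: a monomial in the \<open>p\<close>, a product of distinct \<open>q\<close>, and one of \<open>n!\<close> products
  \<open>D\<^sub>t\<close> of the \<open>R\<close>, one for each permutation (\<open>normal_form\<close>). The theorem rests on the fact
  that these words are linearly independent, and that is seen on representations.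

  The representations come from intertwiners. The element
  \<open>\<phi>\<^sub>i = R\<^sub>i + \<epsilon> (q\<^sub>i - q\<^sub>i\<^sub>+\<^sub>1) / (p\<^sub>i\<^sub>+\<^sub>1 - p\<^sub>i)\<close> of a localization satisfies
  \<open>\<phi>\<^sub>i p\<^sub>i = p\<^sub>i\<^sub>+\<^sub>1 \<phi>\<^sub>i\<close> and \<open>\<phi>\<^sub>i q\<^sub>i = - q\<^sub>i\<^sub>+\<^sub>1 \<phi>\<^sub>i\<close>, and \<open>\<phi>\<^sub>i\<^sup>2\<close> is a function of \<open>p\<^sub>i\<close> and \<open>p\<^sub>i\<^sub>+\<^sub>1\<close>.
  So wherever the \<open>p\<close> have distinct eigenvalues, \<open>R\<^sub>i\<close> is a swap of two eigenvalues, times a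
  Clifford element, minus a pole. Read backwards this defines a module: for any injective
  family of weights \<open>v\<close>, let the algebra act on functions of a pair \<open>(x, T)\<close>, where \<open>x\<close> attaches
  distinct labels to the positions \<open>i\<close> and \<open>T\<close> indexes a basis of a Fock space. Then \<open>p\<^sub>i\<close>
  multiplies by the weight of the label at \<open>i\<close>, \<open>q\<^sub>i\<close> is a Clifford generator belonging to that
  label, and \<open>R\<^sub>i\<close> swaps the labels at \<open>i\<close> and \<open>i + 1\<close> and subtracts the pole. The relations hold
  (\<open>rho_relator\<close>) by the exchange rules and one partial fraction identity (\<open>pole_triangle\<close>).

  Independence is read off at the labelling \<open>x = id\<close>. The factors of \<open>D\<^sub>t\<close> carry one label \<open>k\<close> after
  the other from the position \<open>k\<close> to \<open>t k\<close> and no further, which separates the \<open>D\<^sub>t\<close> (\<open>coset_word_independent\<close>);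
  products of the \<open>q\<close> send the vacuum to different basis vectors; and a polynomial is determined by its values
  at weights that are powers of distinct primes (\<open>poly_value_eq_0\<close>). Hence an element that
  acts as zero for all weights is zero (\<open>rho_faithful\<close>).

  With that, evaluating polynomials at the \<open>p\<close> is multiplicative and symmetric polynomials are
  central because both hold for multiplication operators. Conversely, let an even element be
  central. Commuting with the \<open>p\<close>, whose eigenvalues tell the labellings apart, it cannot move
  the labelling \<open>id\<close>, so only \<open>D\<^sub>t = 1\<close> occurs; being even and commuting with the \<open>q\<close>, only
  \<open>q\<^sub>S = 1\<close> occurs; commuting with the \<open>R\<close>, the remaining polynomial in the \<open>p\<close> is symmetric.
\<close>

section \<open>The ground field\<close>

instance fract :: ("{idom, ring_char_0}") ring_char_0
  by standard (simp add: inj_def of_nat_fract eq_fract)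

lemma eps_nonzero: "eps \<noteq> 0"
proof
  assume "eps = 0"
  then have "qpar = inverse qpar" by (simp add: eps_def)
  then show False
    by (simp add: qpar_def eq_fract one_pCons)
qed

section \<open>Linear operators on function spaces\<close>

text \<open>
  The operators form a type so that they are an instance of \<^class>\<open>ring_1\<close>: relations between
  them can then be verified by ring rewriting instead of by applying both sides to a function.
\<close>

typedef 'a linop = "{F :: ('a \<Rightarrow> Cq) \<Rightarrow> ('a \<Rightarrow> Cq).
    (\<forall>f g. F (\<lambda>x. f x + g x) = (\<lambda>x. F f x + F g x)) \<and> (\<forall>c f. F (\<lambda>x. c * f x) = (\<lambda>x. c * F f x))}"
  morphisms app Linop
  by (rule exI[of _ "\<lambda>f. f"]) simp

setup_lifting type_definition_linop

lemma linop_eqI: "(\<And>f z. app A f z = app B f z) \<Longrightarrow> A = B"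
  by (simp add: app_inject[symmetric] fun_eq_iff)

lemma app_plus: "app A (\<lambda>x. f x + g x) = (\<lambda>x. app A f x + app A g x)"
  and app_scale: "app A (\<lambda>x. c * f x) = (\<lambda>x. c * app A f x)"
  using app[of A] by simp_all

lemma app_uminus: "app A (\<lambda>x. - f x) = (\<lambda>x. - app A f x)"
  using app_scale[of A "-1" f] by simp

lemma app_minus: "app A (\<lambda>x. f x - g x) = (\<lambda>x. app A f x - app A g x)"
  using app_plus[of A f "\<lambda>x. - g x"] by (simp add: app_uminus)

lemma app_zero: "app A (\<lambda>x. 0) = (\<lambda>x. 0)"
  using app_scale[of A 0 "\<lambda>x. 0"] by simp

instantiation linop :: (type) ring_1
begin

lift_definition zero_linop :: "'a linop" is "\<lambda>f x. 0" by simp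
lift_definition one_linop :: "'a linop" is "\<lambda>f. f" by simp
lift_definition plus_linop :: "'a linop \<Rightarrow> 'a linop \<Rightarrow> 'a linop" is "\<lambda>A B f x. A f x + B f x"
  by (simp add: algebra_simps)
lift_definition uminus_linop :: "'a linop \<Rightarrow> 'a linop" is "\<lambda>A f x. - A f x"
  by simp
lift_definition minus_linop :: "'a linop \<Rightarrow> 'a linop \<Rightarrow> 'a linop" is "\<lambda>A B f x. A f x - B f x"
  by (simp add: algebra_simps)
lift_definition times_linop :: "'a linop \<Rightarrow> 'a linop \<Rightarrow> 'a linop" is "\<lambda>A B f. A (B f)"
  by simp

instance
proof
  fix A B C :: "'a linop"
  show "A * B * C = A * (B * C)" by transfer simp
  show "1 * A = A" by transfer simp
  show "A * 1 = A" by transfer simp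
  show "A + B + C = A + (B + C)" by transfer (simp add: add.assoc)
  show "A + B = B + A" by transfer (simp add: add.commute)
  show "0 + A = A" by transfer simp
  show "- A + A = 0" by transfer simp
  show "A - B = A + - B" by transfer simp
  show "(A + B) * C = A * C + B * C" by transfer simp
  show "A * (B + C) = A * B + A * C" by transfer simp
  have "app (0 :: 'a linop) (\<lambda>_. 1) \<noteq> app 1 (\<lambda>_. 1)"
    by transfer (simp add: fun_eq_iff)
  then show "(0 :: 'a linop) \<noteq> 1" by auto
qed

end

lemma app_ring [simp]:
  "app (A * B) f = app A (app B f)" "app (A + B) f = (\<lambda>x. app A f x + app B f x)"
  "app (A - B) f = (\<lambda>x. app A f x - app B f x)" "app (- A) f = (\<lambda>x. - app A f x)"
  "app 0 f = (\<lambda>x. 0)" "app 1 f = f"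
  by (transfer; simp)+

lemma app_sum_linop: "app (\<Sum>i\<in>I. A i) f = (\<lambda>x. \<Sum>i\<in>I. app (A i) f x)"
  by (induction I rule: infinite_finite_induct) simp_all

definition lconst :: "Cq \<Rightarrow> 'a linop"
  where "lconst c = Linop (\<lambda>f x. c * f x)"

lemma app_lconst [simp]: "app (lconst c) f = (\<lambda>x. c * f x)"
  unfolding lconst_def by (subst Linop_inverse) (simp_all add: algebra_simps)

lemma lconst_central: "A * lconst c = lconst c * A"
  by (rule linop_eqI) (simp add: app_scale)

lemma lconst_add: "lconst (a + b) = lconst a + lconst b"
  and lconst_mult: "lconst (a * b) = lconst a * lconst b"
  and lconst_0: "lconst 0 = 0" and lconst_1: "lconst 1 = 1"
  and lconst_uminus: "lconst (- a) = - lconst a"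
  by (rule linop_eqI; simp add: algebra_simps)+


section \<open>Algebra maps out of the free algebra\<close>

lemma poly_mapping_sum_single:
  "f = (\<Sum>w\<in>Poly_Mapping.keys f. Poly_Mapping.single w (Poly_Mapping.lookup f w))"
  by (rule poly_mapping_eqI)
    (simp add: lookup_sum lookup_single when_def sum.delta' in_keys_iff)

lemma poly_mapping_additive_induct [case_names zero single add]:
  fixes f :: "'a \<Rightarrow>\<^sub>0 'b :: comm_monoid_add"
  assumes "Q 0" "\<And>w c. Q (Poly_Mapping.single w c)" "\<And>f g. Q f \<Longrightarrow> Q g \<Longrightarrow> Q (f + g)"
  shows "Q f"
proof -
  have *: "Q (\<Sum>w\<in>F. Poly_Mapping.single w (Poly_Mapping.lookup f w))" if "finite F" for F
    using that by (induction F) (simp_all add: assms)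
  then show ?thesis
    by (subst poly_mapping_sum_single) (rule *, simp)
qed

definition alg_map :: "(gen \<Rightarrow> 'a linop) \<Rightarrow> falg \<Rightarrow> 'a linop"
  where "alg_map h f = (\<Sum>w\<in>Poly_Mapping.keys f.
    lconst (Poly_Mapping.lookup f w) * prod_list (map h (letters w)))"

lemma sum_keys_superset:
  assumes "finite F" "Poly_Mapping.keys f \<subseteq> F" "\<And>w. g w 0 = (0 :: 'b :: comm_monoid_add)"
  shows "(\<Sum>w\<in>Poly_Mapping.keys f. g w (Poly_Mapping.lookup f w)) = (\<Sum>w\<in>F. g w (Poly_Mapping.lookup f w))"
  by (rule sum.mono_neutral_left) (use assms in \<open>auto simp: in_keys_iff\<close>)

lemma sum_keys_add:
  assumes "\<And>w. g w 0 = (0 :: 'b :: comm_monoid_add)" "\<And>w a b. g w (a + b) = g w a + g w b"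
  shows "(\<Sum>w\<in>Poly_Mapping.keys (f + f'). g w (Poly_Mapping.lookup (f + f') w)) =
    (\<Sum>w\<in>Poly_Mapping.keys f. g w (Poly_Mapping.lookup f w)) +
    (\<Sum>w\<in>Poly_Mapping.keys f'. g w (Poly_Mapping.lookup f' w))"
proof -
  let ?F = "Poly_Mapping.keys f \<union> Poly_Mapping.keys f'"
  have *: "Poly_Mapping.keys (f + f') \<subseteq> ?F"
    by (rule Poly_Mapping.keys_add)
  show ?thesis
    by (subst (1 2 3) sum_keys_superset[where F = ?F and g = g])
      (use * assms in \<open>auto simp: lookup_add sum.distrib\<close>)
qed

lemma sum_keys_single:
  assumes "\<And>w. g w 0 = (0 :: 'b :: comm_monoid_add)"
  shows "(\<Sum>v\<in>Poly_Mapping.keys (Poly_Mapping.single w c).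
    g v (Poly_Mapping.lookup (Poly_Mapping.single w c) v)) = g w c"
  using sum_keys_superset[of "{w}" "Poly_Mapping.single w c" g] assms by simp

lemma alg_map_add: "alg_map h (f + g) = alg_map h f + alg_map h g"
  unfolding alg_map_def
  by (rule sum_keys_add[where g = "\<lambda>w c. lconst c * prod_list (map h (letters w))"])
    (simp_all add: lconst_0 lconst_add distrib_right)

lemma alg_map_single: "alg_map h (Poly_Mapping.single w c) = lconst c * prod_list (map h (letters w))"
  unfolding alg_map_def
  by (rule sum_keys_single[where g = "\<lambda>w c. lconst c * prod_list (map h (letters w))"])
    (simp add: lconst_0)

lemma alg_map_0: "alg_map h 0 = 0"
  by (simp add: alg_map_def)

lemma alg_map_mult: "alg_map h (f * g) = alg_map h f * alg_map h g"
proof (induction f rule: poly_mapping_additive_induct)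
  case (single w c)
  show ?case
  proof (induction g rule: poly_mapping_additive_induct)
    case (single v d)
    have "lconst c * (lconst d * (prod_list (map h (letters w)) * prod_list (map h (letters v))))
      = lconst c * (prod_list (map h (letters w)) * (lconst d * prod_list (map h (letters v))))"
      by (metis lconst_central mult.assoc)
    then show ?case
      by (simp add: mult_single alg_map_single plus_word_def lconst_mult mult.assoc)
  qed (simp_all add: alg_map_0 alg_map_add distrib_left)
qed (simp_all add: alg_map_0 alg_map_add distrib_right)

lemma alg_map_1: "alg_map h 1 = 1"
  using alg_map_single[of h 0 1] by (simp add: zero_word_def lconst_1 del: single_one flip: single_one)

lemma alg_map_uminus: "alg_map h (- f) = - alg_map h f"
  using alg_map_add[of h f "- f"] by (simp add: alg_map_0 add_eq_0_iff)

lemma alg_map_diff: "alg_map h (f - g) = alg_map h f - alg_map h g"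
  using alg_map_add[of h f "- g"] by (simp add: alg_map_uminus)

lemma alg_map_scalar: "alg_map h (scalar c) = lconst c"
  by (simp add: scalar_def alg_map_single zero_word_def)

lemma alg_map_gen: "alg_map h (gen x) = h x"
  by (simp add: gen_def alg_map_single lconst_1)

lemma alg_map_sum: "alg_map h (\<Sum>i\<in>I. f i) = (\<Sum>i\<in>I. alg_map h (f i))"
  by (induction I rule: infinite_finite_induct) (simp_all add: alg_map_0 alg_map_add)

lemma alg_map_prod_list: "alg_map h (prod_list xs) = prod_list (map (alg_map h) xs)"
  by (induction xs) (simp_all add: alg_map_1 alg_map_mult)

lemma alg_map_power: "alg_map h (f ^ k) = alg_map h f ^ k"
  by (induction k) (simp_all add: alg_map_1 alg_map_mult)

lemmas alg_map_simps = alg_map_0 alg_map_1 alg_map_add alg_map_uminus alg_map_diff alg_map_mult alg_map_scalar alg_map_gen alg_map_sum alg_map_prod_list alg_map_power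


section \<open>Clifford operators over labellings\<close>

text \<open>
  Labellings are injective on all positions, and not only on \<open>{1..n}\<close>: the differences of
  weights that occur as denominators never vanish, and one action serves all \<open>n\<close>.
\<close>

typedef labelling = "{x :: nat \<Rightarrow> nat. inj x}"
  morphisms lab Labelling
  by (rule exI[of _ id]) simp

setup_lifting type_definition_labelling

lemma labelling_eqI: "(\<And>i. lab x i = lab y i) \<Longrightarrow> x = y"
  by (simp add: lab_inject[symmetric] fun_eq_iff)

lemma lab_eq_iff [simp]: "lab x i = lab x j \<longleftrightarrow> i = j"
  using lab[of x] by (auto dest: injD)

lift_definition swap_lab :: "nat \<Rightarrow> labelling \<Rightarrow> labelling" is "\<lambda>i x. x \<circ> transpose i (Suc i)"
  by (simp add: inj_compose)

lift_definition id_lab :: labelling is id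
  by simp

declare swap_lab.rep_eq [simp] id_lab.rep_eq [simp]

text \<open>
  The second coordinate \<open>T\<close> indexes the basis \<open>e\<^sub>T\<close> of a Fock space on which Clifford generators
  act by adding or removing one element, with the sign of the number of smaller elements.
\<close>

type_synonym op = "(labelling \<times> nat set) linop"

definition toggle :: "nat \<Rightarrow> nat set \<Rightarrow> nat set"
  where "toggle k T = (if k \<in> T then T - {k} else insert k T)"

definition sgn_below :: "nat \<Rightarrow> nat set \<Rightarrow> Cq"
  where "sgn_below k T = (-1) ^ card {j\<in>T. j < k}"

lemma mem_toggle [simp]: "j \<in> toggle k T \<longleftrightarrow> (if j = k then k \<notin> T else j \<in> T)"
  by (auto simp: toggle_def)

lemma toggle_toggle [simp]: "toggle k (toggle k T) = T"
  by (auto simp: toggle_def)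

lemma toggle_commute: "toggle k (toggle l T) = toggle l (toggle k T)"
  by (auto simp: toggle_def)

lemma sgn_below_toggle: "sgn_below l (toggle k T) = (if k < l then - sgn_below l T else sgn_below l T)"
proof (cases "k < l")
  case True
  have fin: "finite {j\<in>T. j < l}" for T :: "nat set"
    by (rule finite_subset[of _ "{..<l}"]) auto
  show ?thesis
  proof (cases "k \<in> T")
    case k: True
    have "{j\<in>T. j < l} = insert k {j\<in>T - {k}. j < l}"
      using k True by auto
    then have "card {j\<in>T. j < l} = Suc (card {j\<in>T - {k}. j < l})"
      using fin[of "T - {k}"] by simp
    then show ?thesis using True k by (simp add: sgn_below_def toggle_def)
  next
    case k: False
    have "{j\<in>insert k T. j < l} = insert k {j\<in>T. j < l}"
      using True by auto
    then have "card {j\<in>insert k T. j < l} = Suc (card {j\<in>T. j < l})"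
      using fin[of T] k by simp
    then show ?thesis using True k by (simp add: sgn_below_def toggle_def)
  qed
next
  case False
  then have "{j\<in>toggle k T. j < l} = {j\<in>T. j < l}"
    by (auto simp: toggle_def)
  then show ?thesis using False by (simp add: sgn_below_def)
qed

lemma sgn_below_sq [simp]: "sgn_below k T * sgn_below k T = 1"
  by (simp add: sgn_below_def flip: power_add)

definition mulx :: "(labelling \<Rightarrow> Cq) \<Rightarrow> op"
  where "mulx F = Linop (\<lambda>f (x, T). F x * f (x, T))"

text \<open>
  The Clifford generator whose mode \<open>k\<close> and whose square \<open>t\<close> may depend on the labelling. The
  square is distributed asymmetrically over the two directions of the toggle, which makes
  every \<open>t\<close> possible without extracting a square root.
\<close>

definition cliff :: "(labelling \<Rightarrow> nat) \<Rightarrow> (labelling \<Rightarrow> Cq) \<Rightarrow> op"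
  where "cliff k t = Linop (\<lambda>f (x, T).
    sgn_below (k x) T * (if k x \<in> T then 1 else t x) * f (x, toggle (k x) T))"

definition act :: "(labelling \<Rightarrow> labelling) \<Rightarrow> op"
  where "act s = Linop (\<lambda>f (x, T). f (s x, T))"

lemma app_mulx [simp]: "app (mulx F) f (x, T) = F x * f (x, T)"
  unfolding mulx_def by (subst Linop_inverse) (auto simp: algebra_simps fun_eq_iff)

lemma app_cliff [simp]:
  "app (cliff k t) f (x, T) = sgn_below (k x) T * (if k x \<in> T then 1 else t x) * f (x, toggle (k x) T)"
  unfolding cliff_def by (subst Linop_inverse) (auto simp: algebra_simps fun_eq_iff)

lemma app_act [simp]: "app (act s) f (x, T) = f (s x, T)"
  unfolding act_def by (subst Linop_inverse) (auto simp: fun_eq_iff)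

lemma op_eqI: "(\<And>f x T. app A f (x, T) = app B f (x, T)) \<Longrightarrow> A = (B :: op)"
  by (rule linop_eqI) auto

lemma cliff_anti:
  assumes "\<And>x. k x \<noteq> l x"
  shows "cliff k t * cliff l u = - (cliff l u * cliff k t)"
proof (rule op_eqI)
  fix f x T
  show "app (cliff k t * cliff l u) f (x, T) = app (- (cliff l u * cliff k t)) f (x, T)"
    using assms[of x] by (cases "k x < l x") (auto simp: sgn_below_toggle toggle_commute)
qed

lemma cliff_sq: "cliff k t * cliff k t = mulx t"
  by (rule op_eqI) (auto simp: sgn_below_toggle)

lemma cliff_mulx: "cliff k t * mulx F = mulx F * cliff k t"
  by (rule op_eqI) auto

lemma mulx_mulx: "mulx F * mulx G = mulx (\<lambda>x. F x * G x)"
  and mulx_add: "mulx F + mulx G = mulx (\<lambda>x. F x + G x)"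
  and mulx_diff: "mulx F - mulx G = mulx (\<lambda>x. F x - G x)"
  and mulx_uminus: "- mulx F = mulx (\<lambda>x. - F x)"
  and lconst_mulx: "lconst c = mulx (\<lambda>x. c)"
  and mulx_1: "mulx (\<lambda>x. 1) = 1" and mulx_0: "mulx (\<lambda>x. 0) = 0"
  by (rule op_eqI; simp add: algebra_simps)+

lemma act_mulx: "act s * mulx F = mulx (\<lambda>x. F (s x)) * act s"
  by (rule op_eqI) auto

lemma act_cliff: "act s * cliff k t = cliff (\<lambda>x. k (s x)) (\<lambda>x. t (s x)) * act s"
  by (rule op_eqI) auto

lemma act_act: "act s * act s' = act (\<lambda>x. s' (s x))"
  by (rule op_eqI) auto

lemma act_id: "act (\<lambda>x. x) = 1"
  by (rule op_eqI) auto

lemma swap_lab_swap_lab [simp]: "swap_lab i (swap_lab i x) = x"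
  by (rule labelling_eqI) simp

lemma swap_lab_far: "\<not> (i = j \<or> i = Suc j \<or> j = Suc i) \<Longrightarrow> swap_lab i (swap_lab j x) = swap_lab j (swap_lab i x)"
  by (rule labelling_eqI) (auto simp: transpose_def)

lemma swap_lab_braid: "swap_lab i (swap_lab (Suc i) (swap_lab i x)) = swap_lab (Suc i) (swap_lab i (swap_lab (Suc i) x))"
  by (rule labelling_eqI) (auto simp: transpose_def)

section \<open>The representation attached to a family of weights\<close>

text \<open>
  The odd modes \<open>2 i + 1\<close> carry Clifford generators that belong to the positions; the even modes
  \<open>2 l\<close> are reserved for the labels. The differences \<open>theta i\<close> play the role of simple roots: they
  satisfy the relations of the spin symmetric group and anticommute with the generators of
  the labels, so that multiplying a swap of labels by \<open>theta i\<close> turns commutation into anticommutation.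
\<close>

definition c_op :: "nat \<Rightarrow> op"
  where "c_op i = cliff (\<lambda>x. 2 * i + 1) (\<lambda>x. 1)"

definition theta :: "nat \<Rightarrow> op"
  where "theta i = c_op i - c_op (Suc i)"

lemma c_op_sq: "c_op i * c_op i = 1"
  by (simp add: c_op_def cliff_sq mulx_1)

lemma c_op_anti: "i \<noteq> j \<Longrightarrow> c_op i * c_op j = - (c_op j * c_op i)"
  unfolding c_op_def by (rule cliff_anti) auto

text \<open>
  Conjugation by \<open>a - b\<close> is, up to sign, the reflection that exchanges \<open>a\<close> and \<open>b\<close>, so both
  sides are \<open>-2 (a - c)\<close>.
\<close>

lemma anticommuting_roots_braid:
  fixes a b c :: "'r :: ring_1"
  assumes "a * a = 1" "b * b = 1" "c * c = 1"
    and "b * a = - (a * b)" "c * a = - (a * c)" "c * b = - (b * c)"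
  shows "(a - b) * (b - c) * (a - b) = (b - c) * (a - b) * (b - c)"
proof -
  have *: "a * (a * x) = x" "b * (b * x) = x" "c * (c * x) = x"
    "b * (a * x) = - (a * (b * x))" "c * (a * x) = - (a * (c * x))" "c * (b * x) = - (b * (c * x))" for x
    using assms by (simp_all flip: mult.assoc)
  show ?thesis
    by (simp add: left_diff_distrib right_diff_distrib distrib_left distrib_right mult.assoc assms *)
qed

lemma theta_sq: "theta i * theta i = 2"
proof -
  have "c_op (Suc i) * c_op i = - (c_op i * c_op (Suc i))"
    by (rule c_op_anti) simp
  then show ?thesis
    by (simp add: theta_def left_diff_distrib right_diff_distrib c_op_sq)
qed

lemma theta_braid: "theta i * theta (Suc i) * theta i = theta (Suc i) * theta i * theta (Suc i)"
  unfolding theta_def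
  by (rule anticommuting_roots_braid) (rule c_op_sq c_op_anti; simp)+

lemma theta_far:
  assumes "\<not> (i = j \<or> i = Suc j \<or> j = Suc i)"
  shows "theta i * theta j = - (theta j * theta i)"
proof -
  have "c_op i * c_op j = - (c_op j * c_op i)" "c_op i * c_op (Suc j) = - (c_op (Suc j) * c_op i)"
    "c_op (Suc i) * c_op j = - (c_op j * c_op (Suc i))" "c_op (Suc i) * c_op (Suc j) = - (c_op (Suc j) * c_op (Suc i))"
    using assms by (auto intro!: c_op_anti)
  then show ?thesis
    by (simp add: theta_def left_diff_distrib right_diff_distrib)
qed

lemma c_op_mulx: "c_op i * mulx F = mulx F * c_op i"
  by (simp add: c_op_def cliff_mulx)

lemma theta_mulx: "theta i * mulx F = mulx F * theta i"
  by (simp add: theta_def left_diff_distrib right_diff_distrib c_op_mulx)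

lemma act_theta: "act s * theta i = theta i * act s"
  by (simp add: theta_def left_diff_distrib right_diff_distrib c_op_def act_cliff)

text \<open>
  The value that \<open>R\<^sub>i\<^sup>2 = - \<epsilon>\<^sup>2 - 2\<close> forces on the square of the intertwiner when
  \<open>p\<^sub>i\<close>, \<open>p\<^sub>i\<^sub>+\<^sub>1\<close> have the eigenvalues \<open>a\<close>, \<open>b\<close>: it is \<open>R\<^sub>i\<^sup>2\<close> minus the square of the pole.
\<close>

definition intertwiner_sq :: "Cq \<Rightarrow> Cq \<Rightarrow> Cq"
  where "intertwiner_sq a b = - eps\<^sup>2 - 2 - eps\<^sup>2 * (2 - a\<^sup>2 - b\<^sup>2) / (b - a)\<^sup>2"

lemma intertwiner_sq_commute: "intertwiner_sq a b = intertwiner_sq b a"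
  by (simp add: intertwiner_sq_def power2_commute[of a b] algebra_simps)

text \<open>
  Distinct weights keep the poles finite, and weights different from \<open>\<plusminus>1\<close> make the \<open>q\<close> act
  invertibly.
\<close>

locale weights =
  fixes v :: "nat \<Rightarrow> Cq"
  assumes v_inj: "inj v" and v_sq: "v l * v l \<noteq> 1"
begin

lemma v_eq_iff [simp]: "v a = v b \<longleftrightarrow> a = b"
  using v_inj by (auto dest: injD)

definition p_op :: "nat \<Rightarrow> op"
  where "p_op i = mulx (\<lambda>x. v (lab x i))"

text \<open>
  The Clifford generator follows the label \<open>lab x i\<close> and not the position \<open>i\<close>, and its square
  is what \<open>p\<^sub>i\<^sup>2 + q\<^sub>i\<^sup>2 = 1\<close> demands.
\<close>

definition q_op :: "nat \<Rightarrow> op"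
  where "q_op i = cliff (\<lambda>x. 2 * lab x i) (\<lambda>x. 1 - (v (lab x i))\<^sup>2)"

definition pole :: "nat \<Rightarrow> nat \<Rightarrow> op"
  where "pole i j = (q_op i - q_op j) * mulx (\<lambda>x. eps / (v (lab x j) - v (lab x i)))"

text \<open>
  The operator \<open>phi i\<close> below exchanges two labels, so its square is \<open>theta i * theta i = 2\<close> times
  the product of the factors of both orders of the labels. Only that product is prescribed.
  Putting all of it on the descending order avoids a factorization, and leaves the factor \<open>1\<close> on
  ascending labels, where leading terms will be read off.
\<close>

definition phi_factor :: "nat \<Rightarrow> op"
  where "phi_factor i = mulx (\<lambda>x. if lab x i < lab x (Suc i) then 1
    else intertwiner_sq (v (lab x i)) (v (lab x (Suc i))) / 2)"

definition phi :: "nat \<Rightarrow> op"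
  where "phi i = phi_factor i * theta i * act (swap_lab i)"

definition R_op :: "nat \<Rightarrow> op"
  where "R_op i = phi i - pole i (Suc i)"

lemma p_op_commute: "p_op i * p_op j = p_op j * p_op i"
  by (simp add: p_op_def mulx_mulx mult.commute)

lemma q_op_anti: "i \<noteq> j \<Longrightarrow> q_op i * q_op j = - (q_op j * q_op i)"
  unfolding q_op_def by (rule cliff_anti) auto

lemma p_op_sq_q_op_sq: "p_op i * p_op i + q_op i * q_op i = 1"
  by (simp add: p_op_def q_op_def mulx_mulx cliff_sq mulx_add mulx_1 power2_eq_square)

lemma q_op_mulx: "q_op i * mulx F = mulx F * q_op i"
  by (simp add: q_op_def cliff_mulx)

lemma p_op_q_op: "p_op i * q_op j = q_op j * p_op i"
  by (simp add: p_op_def q_op_mulx)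

lemma c_op_q_op: "c_op i * q_op j = - (q_op j * c_op i)"
  unfolding c_op_def q_op_def by (rule cliff_anti) presburger

lemma theta_q_op: "theta i * q_op j = - (q_op j * theta i)"
  by (simp add: theta_def left_diff_distrib right_diff_distrib c_op_q_op)

lemma act_q_op: "act (swap_lab i) * q_op j = q_op (transpose i (Suc i) j) * act (swap_lab i)"
  by (simp add: q_op_def act_cliff)

lemma pole_commute: "pole i j = pole j i"
proof -
  have *: "mulx (\<lambda>x. eps / (v (lab x j) - v (lab x i))) = - mulx (\<lambda>x. eps / (v (lab x i) - v (lab x j)))"
    unfolding mulx_uminus by (rule arg_cong[of _ _ mulx]) (metis minus_diff_eq minus_divide_right)
  show ?thesis
    unfolding pole_def * by (simp add: left_diff_distrib right_diff_distrib)
qed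

lemma phi_q_op: "phi i * q_op j = - (q_op (transpose i (Suc i) j) * phi i)"
proof -
  have "phi i * q_op j = phi_factor i * theta i * (q_op (transpose i (Suc i) j) * act (swap_lab i))"
    by (simp add: phi_def mult.assoc act_q_op)
  also have "\<dots> = - (phi_factor i * q_op (transpose i (Suc i) j) * theta i * act (swap_lab i))"
    using theta_q_op[of i "transpose i (Suc i) j"] by (simp add: mult.assoc) (simp flip: mult.assoc)
  also have "\<dots> = - (q_op (transpose i (Suc i) j) * phi i)"
    by (simp add: phi_def phi_factor_def q_op_mulx mult.assoc[symmetric])
  finally show ?thesis .
qed

lemma phi_mulx: "phi i * mulx F = mulx (\<lambda>x. F (swap_lab i x)) * phi i"
proof -
  have "phi i * mulx F = phi_factor i * (theta i * mulx (\<lambda>x. F (swap_lab i x))) * act (swap_lab i)"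
    by (simp add: phi_def mult.assoc act_mulx)
  also have "\<dots> = mulx (\<lambda>x. F (swap_lab i x)) * phi i"
    by (simp add: theta_mulx phi_def phi_factor_def mulx_mulx mult.assoc[symmetric] mult.commute)
  finally show ?thesis .
qed

lemma phi_p_op: "phi i * p_op j = p_op (transpose i (Suc i) j) * phi i"
  by (simp add: p_op_def phi_mulx)

lemma phi_pole: "phi i * pole j k = - (pole (transpose i (Suc i) j) (transpose i (Suc i) k) * phi i)"
proof -
  have "phi i * pole j k = - ((q_op (transpose i (Suc i) j) - q_op (transpose i (Suc i) k)) * (phi i * mulx (\<lambda>x. eps / (v (lab x k) - v (lab x j)))))"
    by (simp add: pole_def mult.assoc[symmetric] right_diff_distrib phi_q_op left_diff_distrib)
  then show ?thesis
    by (simp add: phi_mulx pole_def mult.assoc)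
qed

lemma q_op_diff_mulx: "(q_op i - q_op j) * mulx F = mulx F * (q_op i - q_op j)"
  by (simp add: left_diff_distrib right_diff_distrib q_op_mulx)

lemma pole_mult: "pole i j * pole k l = mulx (\<lambda>x. eps / (v (lab x j) - v (lab x i)) * (eps / (v (lab x l) - v (lab x k))))
    * ((q_op i - q_op j) * (q_op k - q_op l))"
  by (simp only: pole_def q_op_diff_mulx mult.assoc mulx_mulx[symmetric]) (simp only: q_op_diff_mulx flip: mult.assoc)

lemma pole_sq:
  "pole i j * pole i j = mulx (\<lambda>x. eps\<^sup>2 * (2 - (v (lab x i))\<^sup>2 - (v (lab x j))\<^sup>2) / (v (lab x j) - v (lab x i))\<^sup>2)"
proof (cases "i = j")
  case True
  then show ?thesis by (simp add: pole_def mulx_0)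
next
  case False
  have "pole i j * pole i j = mulx (\<lambda>x. eps / (v (lab x j) - v (lab x i)) * (eps / (v (lab x j) - v (lab x i))))
    * ((q_op i - q_op j) * (q_op i - q_op j))"
    by (rule pole_mult)
  also have "(q_op i - q_op j) * (q_op i - q_op j) = q_op i * q_op i + q_op j * q_op j"
    using q_op_anti[OF False] by (simp add: left_diff_distrib right_diff_distrib)
  also have "\<dots> = mulx (\<lambda>x. 2 - (v (lab x i))\<^sup>2 - (v (lab x j))\<^sup>2)"
    by (simp add: q_op_def cliff_sq mulx_add algebra_simps)
  finally show ?thesis
    by (simp add: mulx_mulx power2_eq_square mult_ac)
qed

lemma phi_sq: "phi i * phi i = lconst (- eps\<^sup>2 - 2) - pole i (Suc i) * pole i (Suc i)"
proof -
  let ?E = "\<lambda>x. if lab x i < lab x (Suc i) then 1 else intertwiner_sq (v (lab x i)) (v (lab x (Suc i))) / 2"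
  have "phi i * phi i = phi_factor i * theta i * (act (swap_lab i) * phi_factor i) * (theta i * act (swap_lab i))"
    by (simp add: phi_def mult.assoc)
  also have "act (swap_lab i) * phi_factor i = mulx (\<lambda>x. ?E (swap_lab i x)) * act (swap_lab i)"
    unfolding phi_factor_def by (rule act_mulx)
  also have "phi_factor i * theta i * (mulx (\<lambda>x. ?E (swap_lab i x)) * act (swap_lab i)) * (theta i * act (swap_lab i))
    = phi_factor i * (theta i * mulx (\<lambda>x. ?E (swap_lab i x))) * (act (swap_lab i) * theta i) * act (swap_lab i)"
    by (simp add: mult.assoc)
  also have "\<dots> = phi_factor i * mulx (\<lambda>x. ?E (swap_lab i x)) * (theta i * theta i) * (act (swap_lab i) * act (swap_lab i))"
    by (simp only: theta_mulx act_theta mult.assoc)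
  also have "\<dots> = mulx (\<lambda>x. 2 * (?E x * ?E (swap_lab i x)))"
  proof -
    have two: "mulx F * 2 = mulx (\<lambda>x. 2 * F x)" for F
      by (simp only: mult_2_right mult_2 mulx_add)
    show ?thesis
      unfolding theta_sq act_act swap_lab_swap_lab act_id phi_factor_def mulx_mulx mult_1_right two ..
  qed
  also have "(\<lambda>x. 2 * (?E x * ?E (swap_lab i x))) = (\<lambda>x. intertwiner_sq (v (lab x i)) (v (lab x (Suc i))))"
  proof
    fix x
    have "lab x i \<noteq> lab x (Suc i)" by simp
    then consider "lab x i < lab x (Suc i)" | "lab x (Suc i) < lab x i" by linarith
    then show "2 * (?E x * ?E (swap_lab i x)) = intertwiner_sq (v (lab x i)) (v (lab x (Suc i)))"
      by cases (auto simp: intertwiner_sq_commute)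
  qed
  finally show ?thesis
    by (simp add: pole_sq lconst_mulx mulx_diff intertwiner_sq_def)
qed

lemma phi_far:
  assumes "\<not> (i = j \<or> i = Suc j \<or> j = Suc i)"
  shows "phi i * phi j = - (phi j * phi i)"
proof -
  let ?E = "\<lambda>i x. if lab x i < lab x (Suc i) then 1 else intertwiner_sq (v (lab x i)) (v (lab x (Suc i))) / 2"
  have *: "phi i * phi j = phi_factor i * phi_factor j * (theta i * theta j) * (act (swap_lab i) * act (swap_lab j))"
    if "\<not> (i = j \<or> i = Suc j \<or> j = Suc i)" for i j
  proof -
    have "phi i * phi j = phi_factor i * theta i * (act (swap_lab i) * phi_factor j) * (theta j * act (swap_lab j))"
      by (simp add: phi_def mult.assoc)
    also have "act (swap_lab i) * phi_factor j = phi_factor j * act (swap_lab i)"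
    proof -
      have "lab (swap_lab i x) j = lab x j" "lab (swap_lab i x) (Suc j) = lab x (Suc j)" for x
        using that by (auto simp: transpose_def)
      then show ?thesis
        by (simp only: phi_factor_def act_mulx)
    qed
    also have "phi_factor i * theta i * (phi_factor j * act (swap_lab i)) * (theta j * act (swap_lab j))
      = phi_factor i * (theta i * phi_factor j) * (act (swap_lab i) * theta j) * act (swap_lab j)"
      by (simp add: mult.assoc)
    also have "theta i * phi_factor j = phi_factor j * theta i"
      by (simp add: phi_factor_def theta_mulx)
    finally show ?thesis
      by (simp add: act_theta mult.assoc)
  qed
  have "phi_factor i * phi_factor j = phi_factor j * phi_factor i"
    by (simp add: phi_factor_def mulx_mulx mult.commute)
  moreover have "act (swap_lab i) * act (swap_lab j) = act (swap_lab j) * act (swap_lab i)"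
    using assms by (simp add: act_act swap_lab_far)
  moreover have "\<not> (j = i \<or> j = Suc i \<or> i = Suc j)"
    using assms by blast
  ultimately show ?thesis
    using *[OF assms] *[of j i] theta_far[OF assms] by simp
qed

text \<open>
  Both sides carry the same three factors, one for each pair of the three labels involved.
\<close>

lemma phi_braid: "phi i * phi (Suc i) * phi i = phi (Suc i) * phi i * phi (Suc i)"
proof -
  define E where "E i j x = (if lab x i < lab x j then 1 else intertwiner_sq (v (lab x i)) (v (lab x j)) / 2)"
    for i j x
  have phi: "phi i = mulx (E i (Suc i)) * theta i * act (swap_lab i)" for i
    by (simp add: phi_def phi_factor_def E_def[abs_def])
  have *: "phi i * phi j * phi i
    = mulx (\<lambda>x. E i (Suc i) x * E j (Suc j) (swap_lab i x) * E i (Suc i) (swap_lab j (swap_lab i x)))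
      * (theta i * theta j * theta i) * act (\<lambda>x. swap_lab i (swap_lab j (swap_lab i x)))" for i j
  proof -
    have pull: "theta i * (mulx F * A) = mulx F * (theta i * A)" "act s * (theta i * A) = theta i * (act s * A)"
      "act s * (mulx F * A) = mulx (\<lambda>x. F (s x)) * (act s * A)" for i F A s
      by (simp_all only: theta_mulx act_theta act_mulx flip: mult.assoc)
    show ?thesis
      by (simp add: phi pull mult.assoc flip: mulx_mulx) (simp add: act_act)
  qed
  have "E i (Suc i) x * E (Suc i) (Suc (Suc i)) (swap_lab i x) * E i (Suc i) (swap_lab (Suc i) (swap_lab i x))
    = E (Suc i) (Suc (Suc i)) x * E i (Suc i) (swap_lab (Suc i) x) * E (Suc i) (Suc (Suc i)) (swap_lab i (swap_lab (Suc i) x))" for x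
  proof -
    have "E (Suc i) (Suc (Suc i)) (swap_lab i x) = E i (Suc (Suc i)) x"
      "E i (Suc i) (swap_lab (Suc i) (swap_lab i x)) = E (Suc i) (Suc (Suc i)) x"
      "E i (Suc i) (swap_lab (Suc i) x) = E i (Suc (Suc i)) x"
      "E (Suc i) (Suc (Suc i)) (swap_lab i (swap_lab (Suc i) x)) = E i (Suc i) x"
      by (simp_all add: E_def transpose_def)
    then show ?thesis by (simp add: mult_ac)
  qed
  then show ?thesis
    unfolding * by (simp add: theta_braid swap_lab_braid)
qed

lemma pole_far:
  assumes "i \<noteq> k" "i \<noteq> l" "j \<noteq> k" "j \<noteq> l"
  shows "pole i j * pole k l = - (pole k l * pole i j)"
proof -
  have "(q_op i - q_op j) * (q_op k - q_op l) = - ((q_op k - q_op l) * (q_op i - q_op j))"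
    using q_op_anti[OF assms(1)] q_op_anti[OF assms(2)] q_op_anti[OF assms(3)] q_op_anti[OF assms(4)]
    by (simp add: left_diff_distrib right_diff_distrib)
  then show ?thesis unfolding pole_mult by (simp add: mult.commute)
qed

text \<open>
  The partial fraction identity behind the braid relation. The coefficients of the products
  of two different \<open>q\<close> cancel as
  \<open>1/((z-x)(y-x)) - 1/((y-x)(z-y)) + 1/((z-y)(z-x)) = 0\<close>, and the squares \<open>q\<^sup>2 = 1 - p\<^sup>2\<close> leave the
  divided difference of \<open>1 - p\<^sup>2\<close> over three points, which is constant.
\<close>

lemma pole_triangle:
  assumes "i \<noteq> j" "i \<noteq> k" "j \<noteq> k"
  shows "pole i k * pole i j + pole i j * pole j k + pole j k * pole i k = - lconst (eps\<^sup>2)"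
proof -
  let ?D = "\<lambda>i j x. eps / (v (lab x j) - v (lab x i))"
  have q: "q_op j * q_op i = - (q_op i * q_op j)" "q_op k * q_op i = - (q_op i * q_op k)" "q_op k * q_op j = - (q_op j * q_op k)"
    using assms by (auto intro: q_op_anti)
  let ?a = "\<lambda>x. ?D i k x * ?D i j x" and ?b = "\<lambda>x. ?D i j x * ?D j k x" and ?c = "\<lambda>x. ?D j k x * ?D i k x"
  have s: "q_op i * q_op i = mulx (\<lambda>x. 1 - (v (lab x i))\<^sup>2)" for i
    by (simp add: q_op_def cliff_sq)
  have "pole i k * pole i j + pole i j * pole j k + pole j k * pole i k
    = (mulx ?a * (q_op i * q_op i) - mulx ?b * (q_op j * q_op j) + mulx ?c * (q_op k * q_op k))
     + (mulx ?b - mulx ?a - mulx ?c) * (q_op i * q_op j)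
     + (mulx ?a - mulx ?b + mulx ?c) * (q_op i * q_op k)
     - (mulx ?a - mulx ?b + mulx ?c) * (q_op j * q_op k)"
    unfolding pole_mult by (simp add: left_diff_distrib right_diff_distrib distrib_left distrib_right q)
  moreover have "mulx ?a - mulx ?b + mulx ?c = 0"
  proof -
    have id: "e / (z - x) * (e / (y - x)) - e / (y - x) * (e / (z - y)) + e / (z - y) * (e / (z - x)) = 0"
      if "x \<noteq> y" "x \<noteq> z" "y \<noteq> z" for x y z e :: Cq
      using that by (simp add: divide_simps) (simp add: algebra_simps)
    show ?thesis
      unfolding mulx_diff mulx_add mulx_0[symmetric]
      by (rule arg_cong[of _ _ mulx], rule ext, rule id) (use assms in simp_all)
  qed
  moreover have "mulx ?a * (q_op i * q_op i) - mulx ?b * (q_op j * q_op j) + mulx ?c * (q_op k * q_op k) = - lconst (eps\<^sup>2)"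
  proof -
    have id: "e / (z - x) * (e / (y - x)) * (1 - x\<^sup>2) - e / (y - x) * (e / (z - y)) * (1 - y\<^sup>2)
      + e / (z - y) * (e / (z - x)) * (1 - z\<^sup>2) = - e\<^sup>2" if "x \<noteq> y" "x \<noteq> z" "y \<noteq> z" for x y z e :: Cq
      using that by (simp add: divide_simps power2_eq_square) (simp add: algebra_simps)
    show ?thesis
      unfolding s mulx_mulx mulx_diff mulx_add mulx_uminus lconst_mulx
      by (rule arg_cong[of _ _ mulx], rule ext, rule id) (use assms in simp_all)
  qed
  moreover have "mulx ?b - mulx ?a - mulx ?c = - (mulx ?a - mulx ?b + mulx ?c)"
    by simp
  ultimately show ?thesis by simp
qed


lemma pole_q_op_diff:
  assumes "i \<noteq> j"
  shows "pole i j * (p_op j - p_op i) = lconst eps * (q_op i - q_op j)"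
proof -
  have "pole i j * (p_op j - p_op i) = (q_op i - q_op j) * mulx (\<lambda>x. eps / (v (lab x j) - v (lab x i)) * (v (lab x j) - v (lab x i)))"
    by (simp add: pole_def p_op_def mulx_diff mulx_mulx mult.assoc)
  also have "\<dots> = lconst eps * (q_op i - q_op j)"
    using assms by (simp add: lconst_mulx q_op_diff_mulx)
  finally show ?thesis .
qed

lemma pole_q_op_sum:
  assumes "i \<noteq> j"
  shows "q_op j * pole i j + pole i j * q_op i = lconst eps * (p_op i + p_op j)"
proof -
  let ?D = "mulx (\<lambda>x. eps / (v (lab x j) - v (lab x i)))"
  have "q_op j * pole i j + pole i j * q_op i = (q_op j * (q_op i - q_op j) + (q_op i - q_op j) * q_op i) * ?D"
    by (simp add: pole_def distrib_right mult.assoc q_op_mulx)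
  also have "q_op j * (q_op i - q_op j) + (q_op i - q_op j) * q_op i = q_op i * q_op i - q_op j * q_op j"
    by (simp add: left_diff_distrib right_diff_distrib)
  also have "\<dots> * ?D = lconst eps * (p_op i + p_op j)"
  proof -
    have id: "(1 - x\<^sup>2 - (1 - y\<^sup>2)) * (e / (y - x)) = e * (x + y)" if "x \<noteq> y" for x y e :: Cq
    proof -
      have "1 - x\<^sup>2 - (1 - y\<^sup>2) = (x + y) * (y - x)"
        by (simp add: power2_eq_square algebra_simps)
      then show ?thesis using that by simp
    qed
    show ?thesis
      unfolding q_op_def cliff_sq mulx_diff mulx_mulx p_op_def mulx_add lconst_mulx
      by (rule arg_cong[of _ _ mulx], rule ext, rule id) (use assms in simp)
  qed
  finally show ?thesis .
qed

lemma pole_mulx: "pole i j * mulx F = mulx F * pole i j"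
proof -
  have "pole i j * mulx F = (q_op i - q_op j) * mulx (\<lambda>x. F x * (eps / (v (lab x j) - v (lab x i))))"
    by (simp add: pole_def mult.assoc mulx_mulx mult.commute)
  also have "\<dots> = mulx F * pole i j"
    unfolding pole_def q_op_diff_mulx by (simp only: mulx_mulx flip: mult.assoc)
  finally show ?thesis .
qed

lemma pole_p_op: "pole i j * p_op k = p_op k * pole i j"
  unfolding p_op_def by (rule pole_mulx)

lemma pole_q_op:
  assumes "k \<noteq> i" "k \<noteq> j"
  shows "pole i j * q_op k = - (q_op k * pole i j)"
proof -
  have "(q_op i - q_op j) * q_op k = - (q_op k * (q_op i - q_op j))"
    using q_op_anti[OF assms(1)] q_op_anti[OF assms(2)] by (simp add: left_diff_distrib right_diff_distrib)
  moreover have "pole i j * q_op k = (q_op i - q_op j) * q_op k * mulx (\<lambda>x. eps / (v (lab x j) - v (lab x i)))"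
    by (simp add: pole_def mult.assoc q_op_mulx)
  ultimately show ?thesis
    by (simp add: pole_def mult.assoc)
qed

lemma R_op_sq: "R_op i * R_op i = lconst (- eps\<^sup>2 - 2)"
proof -
  have "phi i * pole i (Suc i) = - (pole i (Suc i) * phi i)"
    using phi_pole[of i i "Suc i"] pole_commute[of i "Suc i"] by simp
  then show ?thesis
    by (simp add: R_op_def left_diff_distrib right_diff_distrib phi_sq)
qed

lemma R_op_far:
  assumes "\<not> (i = j \<or> i = Suc j \<or> j = Suc i)"
  shows "R_op i * R_op j = - (R_op j * R_op i)"
proof -
  have "phi i * pole j (Suc j) = - (pole j (Suc j) * phi i)" "phi j * pole i (Suc i) = - (pole i (Suc i) * phi j)"
    using phi_pole[of i j "Suc j"] phi_pole[of j i "Suc i"] assms by (simp_all add: transpose_def)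
  moreover have "pole i (Suc i) * pole j (Suc j) = - (pole j (Suc j) * pole i (Suc i))"
    by (rule pole_far) (use assms in auto)
  ultimately show ?thesis
    using phi_far[OF assms] by (simp add: R_op_def left_diff_distrib right_diff_distrib)
qed

text \<open>
  Expanding \<open>(x - a) (y - b) (x - a) - (y - b) (x - a) (y - b)\<close> and moving \<open>x\<close>, \<open>y\<close> to the right,
  the terms with two of them cancel, those with one of them are collected by the triangle
  identities \<open>K\<close> and \<open>K'\<close>, and so are the terms without them once \<open>x\<^sup>2\<close> and \<open>y\<^sup>2\<close> are inserted.
\<close>

lemma intertwiner_shift_braid:
  fixes x y a b c k e :: "'r :: ring_1"
  assumes xa: "x * a = - (a * x)" and xb: "x * b = - (c * x)"
    and yb: "y * b = - (b * y)" and ya: "y * a = - (c * y)" and xc: "x * c = - (b * x)" and yc: "y * c = - (a * y)"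
    and xx: "x * x = k - a * a" and yy: "y * y = k - b * b" and br: "x * y * x = y * x * y"
    and K: "c * a + a * b + b * c = - e" and K': "c * b + b * a + a * c = - e"
    and caa: "c * (a * a) = a * a * c" and ae: "a * e = e * a"
  shows "(x - a) * (y - b) * (x - a) - (y - b) * (x - a) * (y - b) = e * ((y - b) - (x - a))"
proof -
  have 1: "x * y * a = b * x * y"
    by (simp add: mult.assoc ya) (simp add: xc flip: mult.assoc)
  have 2: "y * x * b = a * y * x"
    by (simp add: mult.assoc xb) (simp add: yc flip: mult.assoc)
  have 3: "x * b * x = - (c * (k - a * a))"
    by (simp add: xb) (simp add: mult.assoc xx)
  have 4: "y * a * y = - (c * (k - b * b))"
    by (simp add: ya) (simp add: mult.assoc yy)
  have 5: "x * b * a = c * a * x"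
    by (simp add: xb) (simp add: mult.assoc xa)
  have 6: "y * a * b = c * b * y"
    by (simp add: ya) (simp add: mult.assoc yb)
  have 7: "b * x * b = - (b * c * x)"
    by (simp add: mult.assoc xb)
  have 8: "a * y * a = - (a * c * y)"
    by (simp add: mult.assoc ya)
  have "(x - a) * (y - b) * (x - a) - (y - b) * (x - a) * (y - b)
    = (x * y * x - y * x * y) - x * y * a - x * b * x + x * b * a - a * y * x + a * y * a + a * b * x - a * b * a
      + y * x * b + y * a * y - y * a * b + b * x * y - b * x * b - b * a * y + b * a * b"
    by (simp add: algebra_simps)
  also have "\<dots> = (c * a + a * b + b * c) * x - (c * b + b * a + a * c) * y
      + (c * (b * b) - c * (a * a) - a * b * a + b * a * b)"
    unfolding br 1 2 3 4 5 6 7 8 by (simp add: algebra_simps)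
  also have "c * (b * b) - c * (a * a) - a * b * a + b * a * b = e * (a - b)"
  proof -
    have cb: "c * b = - e - b * a - a * c" unfolding K'[symmetric] by simp
    have "c * (b * b) = c * b * b" by (simp add: mult.assoc)
    also have "\<dots> = - (e * b) - b * a * b - a * (c * b)"
      by (subst cb) (simp add: left_diff_distrib mult.assoc)
    also have "a * (c * b) = - (e * a) - a * b * a - a * a * c"
      by (simp add: cb right_diff_distrib ae mult.assoc)
    finally show ?thesis
      by (simp add: caa algebra_simps)
  qed
  also have "(c * a + a * b + b * c) * x - (c * b + b * a + a * c) * y + e * (a - b) = e * ((y - b) - (x - a))"
    unfolding K K' by (simp add: algebra_simps)
  finally show ?thesis .
qed

lemma R_op_braid:
  "R_op i * R_op (Suc i) * R_op i - R_op (Suc i) * R_op i * R_op (Suc i) = lconst (eps\<^sup>2) * (R_op (Suc i) - R_op i)"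
  unfolding R_op_def
proof (rule intertwiner_shift_braid[where c = "pole i (Suc (Suc i))"])
  let ?j = "Suc i" and ?k = "Suc (Suc i)"
  show "phi i * pole i ?j = - (pole i ?j * phi i)"
    using phi_pole[of i i ?j] pole_commute[of i ?j] by simp
  show "phi i * pole ?j ?k = - (pole i ?k * phi i)"
    using phi_pole[of i ?j ?k] by simp
  show "phi i * pole i ?k = - (pole ?j ?k * phi i)"
    using phi_pole[of i i ?k] by simp
  show "phi ?j * pole ?j ?k = - (pole ?j ?k * phi ?j)"
    using phi_pole[of ?j ?j ?k] pole_commute[of ?j ?k] by simp
  show "phi ?j * pole i ?j = - (pole i ?k * phi ?j)"
    using phi_pole[of ?j i ?j] by simp
  show "phi ?j * pole i ?k = - (pole i ?j * phi ?j)"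
    using phi_pole[of ?j i ?k] by simp
  show "phi i * phi i = lconst (- eps\<^sup>2 - 2) - pole i ?j * pole i ?j"
    "phi ?j * phi ?j = lconst (- eps\<^sup>2 - 2) - pole ?j ?k * pole ?j ?k"
    by (rule phi_sq)+
  show "phi i * phi ?j * phi i = phi ?j * phi i * phi ?j"
    by (rule phi_braid)
  show "pole i ?k * pole i ?j + pole i ?j * pole ?j ?k + pole ?j ?k * pole i ?k = - lconst (eps\<^sup>2)"
    by (rule pole_triangle) simp_all
  \<comment> \<open>The triangle identity for the three positions in the reverse order.\<close>
  show "pole i ?k * pole ?j ?k + pole ?j ?k * pole i ?j + pole i ?j * pole i ?k = - lconst (eps\<^sup>2)"
    using pole_triangle[of ?k ?j i] by (simp add: pole_commute[of ?k] pole_commute[of ?j i])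
  show "pole i ?k * (pole i ?j * pole i ?j) = pole i ?j * pole i ?j * pole i ?k"
    unfolding pole_sq by (rule pole_mulx)
  show "pole i ?j * lconst (eps\<^sup>2) = lconst (eps\<^sup>2) * pole i ?j"
    by (rule lconst_central)
qed

lemma R_op_p_op: "R_op i * p_op i = p_op (Suc i) * R_op i + lconst eps * (q_op i - q_op (Suc i))"
proof -
  have "lconst eps * (q_op i - q_op (Suc i)) = p_op (Suc i) * pole i (Suc i) - p_op i * pole i (Suc i)"
    using pole_q_op_diff[of i "Suc i"] by (simp add: right_diff_distrib pole_p_op)
  then show ?thesis
    using phi_p_op[of i i] by (simp add: R_op_def left_diff_distrib right_diff_distrib pole_p_op)
qed

lemma R_op_q_op: "R_op i * q_op i = - (q_op (Suc i) * R_op i) - lconst eps * (p_op i + p_op (Suc i))"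
proof -
  have "lconst eps * (p_op i + p_op (Suc i)) = q_op (Suc i) * pole i (Suc i) + pole i (Suc i) * q_op i"
    using pole_q_op_sum[of i "Suc i"] by simp
  then show ?thesis
    using phi_q_op[of i i] by (simp add: R_op_def left_diff_distrib right_diff_distrib)
qed

lemma R_op_p_op_far: "j \<noteq> i \<Longrightarrow> j \<noteq> Suc i \<Longrightarrow> R_op i * p_op j = p_op j * R_op i"
  using phi_p_op[of i j] pole_p_op[of i "Suc i"]
  by (simp add: R_op_def left_diff_distrib right_diff_distrib)

lemma R_op_q_op_far: "j \<noteq> i \<Longrightarrow> j \<noteq> Suc i \<Longrightarrow> R_op i * q_op j = - (q_op j * R_op i)"
  using phi_q_op[of i j] pole_q_op[of j i "Suc i"]
  by (simp add: R_op_def left_diff_distrib right_diff_distrib)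

fun gen_op :: "gen \<Rightarrow> op" where
  "gen_op (GR i) = R_op i" | "gen_op (GP i) = p_op i" | "gen_op (GQ i) = q_op i"

abbreviation rho :: "falg \<Rightarrow> op" where "rho \<equiv> alg_map gen_op"

lemma rho_relator:
  assumes "r \<in> relators n"
  shows "rho r = 0"
proof -
  have 1: "R_op i * R_op j + R_op j * R_op i = 0" if "1 < \<bar>int i - int j\<bar>" for i j
  proof -
    have "\<not> (i = j \<or> i = Suc j \<or> j = Suc i)" using that by auto
    then show ?thesis using R_op_far[of i j] by simp
  qed
  have 2: "q_op i * q_op j + q_op j * q_op i = 0" if "i \<noteq> j" for i j
    using q_op_anti[OF that] by simp
  have 3: "p_op i * p_op j - p_op j * p_op i = 0" for i j
    using p_op_commute[of i j] by simp
  from assms show ?thesis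
    unfolding relators_def
    by (elim UnE CollectE exE conjE; hypsubst)
      (simp_all add: alg_map_simps R_op_sq 1 R_op_braid[simplified] R_op_p_op R_op_q_op R_op_p_op_far R_op_q_op_far
        p_op_sq_q_op_sq 2 3 p_op_q_op)
qed

end

section \<open>Values of polynomials\<close>

definition monomial_value :: "nat \<Rightarrow> (nat \<Rightarrow>\<^sub>0 nat) \<Rightarrow> (nat \<Rightarrow> Cq) \<Rightarrow> Cq"
  where "monomial_value n m y = (\<Prod>i\<in>{1..n}. y i ^ Poly_Mapping.lookup m i)"

definition poly_value :: "nat \<Rightarrow> mpol \<Rightarrow> (nat \<Rightarrow> Cq) \<Rightarrow> Cq"
  where "poly_value n f y = (\<Sum>m\<in>Poly_Mapping.keys f. Poly_Mapping.lookup f m * monomial_value n m y)"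

lemma monomial_value_add: "monomial_value n (m + m') y = monomial_value n m y * monomial_value n m' y"
  by (simp add: monomial_value_def lookup_add power_add prod.distrib)

lemma poly_value_0: "poly_value n 0 y = 0"
  by (simp add: poly_value_def)

lemma poly_value_add: "poly_value n (f + g) y = poly_value n f y + poly_value n g y"
  unfolding poly_value_def
  by (rule sum_keys_add[where g = "\<lambda>m c. c * monomial_value n m y"]) (simp_all add: distrib_right)

lemma poly_value_single: "poly_value n (Poly_Mapping.single m c) y = c * monomial_value n m y"
  unfolding poly_value_def
  by (rule sum_keys_single[where g = "\<lambda>m c. c * monomial_value n m y"]) simp

lemma poly_value_mult: "poly_value n (f * g) y = poly_value n f y * poly_value n g y"
proof (induction f rule: poly_mapping_additive_induct)
  case (single m c)
  show ?case
    by (induction g rule: poly_mapping_additive_induct)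
      (simp_all add: mult_single poly_value_single monomial_value_add poly_value_0 poly_value_add algebra_simps)
qed (simp_all add: poly_value_0 poly_value_add algebra_simps)

lemma poly_value_uminus: "poly_value n (- f) y = - poly_value n f y"
  using poly_value_add[of n f "- f" y] by (simp add: poly_value_0 add_eq_0_iff)

lemma poly_value_diff: "poly_value n (f - g) y = poly_value n f y - poly_value n g y"
  using poly_value_add[of n f "- g" y] by (simp add: poly_value_uminus)

lemma lookup_map_key:
  assumes "inj \<pi>"
  shows "Poly_Mapping.lookup (Poly_Mapping.map_key \<pi> m) i = Poly_Mapping.lookup m (\<pi> i)"
  using assms by (simp add: map_key.rep_eq)

lemma map_key_inverse:
  fixes \<pi> :: "'a \<Rightarrow> 'a"
  assumes "bij \<pi>"
  shows "Poly_Mapping.map_key \<pi> (Poly_Mapping.map_key (inv_into UNIV \<pi>) m) = m"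
    and "Poly_Mapping.map_key (inv_into UNIV \<pi>) (Poly_Mapping.map_key \<pi> m) = m"
  using assms
  by (auto intro!: poly_mapping_eqI simp: lookup_map_key bij_imp_bij_inv bij_is_inj bij_is_surj surj_f_inv_f)

lemma inj_map_key:
  fixes \<pi> :: "'a \<Rightarrow> 'a"
  assumes "bij \<pi>"
  shows "inj (Poly_Mapping.map_key \<pi>)"
  by (rule inj_on_inverseI[where g = "Poly_Mapping.map_key (inv_into UNIV \<pi>)"]) (simp add: map_key_inverse assms)

lemma lookup_permute_vars:
  assumes "bij \<pi>"
  shows "Poly_Mapping.lookup (permute_vars \<pi> f) m = Poly_Mapping.lookup f (Poly_Mapping.map_key \<pi> m)"
  by (simp add: permute_vars_def lookup_map_key[OF inj_map_key[OF assms]])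

lemma poly_value_permute_vars:
  assumes \<pi>: "\<pi> permutes {1..n}"
  shows "poly_value n (permute_vars \<pi> f) y = poly_value n f (y \<circ> \<pi>)"
proof -
  have bij: "bij \<pi>" using \<pi> by (rule permutes_bij)
  have monomial_value: "monomial_value n m y = monomial_value n (Poly_Mapping.map_key \<pi> m) (y \<circ> \<pi>)" for m
  proof -
    have "monomial_value n m y = (\<Prod>i\<in>{1..n}. y (\<pi> i) ^ Poly_Mapping.lookup m (\<pi> i))"
      unfolding monomial_value_def by (rule prod.permute[OF \<pi>, unfolded comp_def])
    then show ?thesis
      by (simp add: monomial_value_def lookup_map_key bij bij_is_inj)
  qed
  show ?thesis
    unfolding poly_value_def
    by (rule sum.reindex_bij_witness[where i = "Poly_Mapping.map_key (inv_into UNIV \<pi>)" and j = "Poly_Mapping.map_key \<pi>"])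
      (simp_all add: map_key_inverse bij in_keys_iff lookup_permute_vars flip: monomial_value)
qed

lemma permute_vars_mpols:
  assumes \<pi>: "\<pi> permutes {1..n}" and f: "f \<in> mpols n"
  shows "permute_vars \<pi> f \<in> mpols n"
proof -
  have bij: "bij \<pi>" using \<pi> by (rule permutes_bij)
  have "i \<in> {1..n}" if "m \<in> Poly_Mapping.keys (permute_vars \<pi> f)" "i \<in> Poly_Mapping.keys m" for m i
  proof -
    have "Poly_Mapping.map_key \<pi> m \<in> Poly_Mapping.keys f"
      using that by (simp add: in_keys_iff lookup_permute_vars bij)
    moreover have "inv_into UNIV \<pi> i \<in> Poly_Mapping.keys (Poly_Mapping.map_key \<pi> m)"
      using that bij by (simp add: in_keys_iff lookup_map_key bij_is_inj surj_f_inv_f bij_is_surj)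
    ultimately have "inv_into UNIV \<pi> i \<in> {1..n}"
      using f unfolding mpols_def by blast
    then show ?thesis
      using permutes_in_image[OF \<pi>, of "inv_into UNIV \<pi> i"] bij by (simp add: surj_f_inv_f bij_is_surj)
  qed
  then show ?thesis by (auto simp: mpols_def)
qed

text \<open>
  Any polynomial without constant term may replace the powers, in particular one that
  vanishes at all \<open>u m'\<close> but one.
\<close>

lemma power_sums_zero:
  fixes c u :: "'i \<Rightarrow> 'k :: field"
  assumes fin: "finite K" and inj: "inj_on u K" and nz: "\<And>m. m \<in> K \<Longrightarrow> u m \<noteq> 0"
    and zero: "\<And>r. (\<Sum>m\<in>K. c m * u m ^ Suc r) = 0" and m: "m \<in> K"
  shows "c m = 0"
proof -
  have *: "(\<Sum>m\<in>K. c m * u m * poly h (u m)) = 0" for h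
  proof -
    have "(\<Sum>m\<in>K. c m * u m * poly h (u m)) = (\<Sum>m\<in>K. \<Sum>r\<le>degree h. coeff h r * (c m * u m ^ Suc r))"
      by (simp add: poly_altdef sum_distrib_left mult_ac)
    also have "\<dots> = (\<Sum>r\<le>degree h. coeff h r * (\<Sum>m\<in>K. c m * u m ^ Suc r))"
      by (subst sum.swap) (simp add: sum_distrib_left)
    finally show ?thesis by (simp only: zero) simp
  qed
  define h where "h = (\<Prod>m'\<in>K - {m}. [:- u m', 1:])"
  have "poly h (u m') = 0" if "m' \<in> K - {m}" for m'
    using that fin by (auto simp: h_def poly_prod)
  then have "(\<Sum>m'\<in>K. c m' * u m' * poly h (u m')) = c m * u m * poly h (u m)"
    using fin m by (subst sum.remove[of _ m]) auto
  moreover have "poly h (u m) \<noteq> 0"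
    using fin inj m by (auto simp: h_def poly_prod inj_on_def)
  ultimately show ?thesis
    using * nz[OF m] by simp
qed

lemma (in weights) weights_permute: "bij \<pi> \<Longrightarrow> weights (v \<circ> \<pi>)"
  by unfold_locales (simp_all add: v_sq inj_compose v_inj bij_is_inj)

text \<open>
  Give the variable \<open>i\<close> the value \<open>\<pi>\<^sub>i\<^sup>r\<close>, for distinct primes \<open>\<pi>\<^sub>i\<close>. The monomials then take the
  values \<open>u\<^sup>r\<close>, where the \<open>u\<close> are different numbers by unique factorization, and letting \<open>r\<close> vary
  isolates each coefficient.
\<close>

lemma poly_value_eq_0:
  assumes f: "f \<in> mpols n" and zero: "\<And>v. weights v \<Longrightarrow> poly_value n f v = 0"
  shows "f = 0"
proof -
  obtain pr :: "nat \<Rightarrow> nat" where inj: "inj pr" and "range pr \<subseteq> {p. prime p}"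
    using infinite_countable_subset[OF primes_infinite] by auto
  then have pr: "prime (pr i)" for i by auto
  define u where "u m = (\<Prod>i\<in>{1..n}. pr i ^ Poly_Mapping.lookup m i)" for m
  have mult: "multiplicity (pr j) (u m) = Poly_Mapping.lookup m j" if "j \<in> {1..n}" for m j
  proof -
    have "u m = (\<Prod>x\<in>pr ` {1..n}. x ^ Poly_Mapping.lookup m (inv_into UNIV pr x))"
      unfolding u_def by (subst prod.reindex) (use inj in \<open>auto simp: inj_on_def dest: injD\<close>)
    then show ?thesis
      using multiplicity_prod_prime_powers[of "pr ` {1..n}" "pr j" "\<lambda>x. Poly_Mapping.lookup m (inv_into UNIV pr x)"]
        that pr inj by auto
  qed
  have inj_u: "inj_on u (Poly_Mapping.keys f)"
  proof (rule inj_onI)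
    fix m m' assume m: "m \<in> Poly_Mapping.keys f" "m' \<in> Poly_Mapping.keys f" and eq: "u m = u m'"
    show "m = m'"
    proof (rule poly_mapping_eqI)
      fix j
      show "Poly_Mapping.lookup m j = Poly_Mapping.lookup m' j"
      proof (cases "j \<in> {1..n}")
        case True
        then show ?thesis using mult[OF True, of m] mult[OF True, of m'] eq by simp
      next
        case False
        then have "j \<notin> Poly_Mapping.keys m" "j \<notin> Poly_Mapping.keys m'"
          using f m unfolding mpols_def by blast+
        then show ?thesis by (simp add: in_keys_iff)
      qed
    qed
  qed
  \<comment> \<open>The exponent starts at 1, since the zeroth powers of the primes are neither distinct nor
    different from 1.\<close>
  have "weights (\<lambda>i. of_nat (pr i ^ Suc r))" for r
  proof
    show "inj (\<lambda>i. of_nat (pr i ^ Suc r) :: Cq)"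
    proof (rule injI)
      fix i j assume "of_nat (pr i ^ Suc r) = (of_nat (pr j ^ Suc r) :: Cq)"
      then have "pr i ^ Suc r = pr j ^ Suc r" by (simp only: of_nat_eq_iff)
      then have "pr i = pr j" by (metis power_eq_imp_eq_base zero_le zero_less_Suc)
      then show "i = j" using inj by (auto dest: injD)
    qed
    show "of_nat (pr l ^ Suc r) * of_nat (pr l ^ Suc r) \<noteq> (1 :: Cq)" for l
    proof -
      have "1 < pr l ^ Suc r" using prime_gt_1_nat[OF pr] by (metis one_less_power zero_less_Suc)
      then have "pr l ^ Suc r * pr l ^ Suc r \<noteq> 1" by (metis less_irrefl nat_mult_eq_1_iff)
      then show ?thesis by (metis of_nat_1 of_nat_eq_iff of_nat_mult)
    qed
  qed
  then have z: "poly_value n f (\<lambda>i. of_nat (pr i ^ Suc r)) = 0" for r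
    by (rule zero)
  have m: "monomial_value n m (\<lambda>i. of_nat (pr i ^ Suc r)) = of_nat (u m) ^ Suc r" for m r
    unfolding monomial_value_def u_def of_nat_prod prod_power_distrib of_nat_power
    by (simp only: flip: power_mult mult.commute)
  have "Poly_Mapping.lookup f m = 0" if "m \<in> Poly_Mapping.keys f" for m
  proof (rule power_sums_zero[OF finite_keys _ _ _ that, where u = "\<lambda>m. of_nat (u m)"])
    show "inj_on (\<lambda>m. of_nat (u m) :: Cq) (Poly_Mapping.keys f)"
      using inj_u by (simp add: inj_on_def)
    show "of_nat (u m) \<noteq> (0 :: Cq)" for m
      using pr by (auto simp: u_def dest: prime_gt_0_nat)
    show "(\<Sum>m\<in>Poly_Mapping.keys f. Poly_Mapping.lookup f m * of_nat (u m) ^ Suc r) = 0" for r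
      using z[of r] unfolding poly_value_def m .
  qed
  then have "Poly_Mapping.keys f = {}"
    by (meson all_not_in_conv in_keys_iff)
  then show "f = 0" by simp
qed

text \<open>
  Adjacent transpositions generate the symmetric group: conjugating \<open>(a b)\<close> by \<open>(b b+1)\<close> gives
  \<open>(a b+1)\<close>, and transpositions generate.
\<close>

lemma adjacent_transpositions_induct:
  assumes \<pi>: "\<pi> permutes {1..n}"
    and id: "Q id" and comp: "\<And>\<pi> \<sigma>. Q \<pi> \<Longrightarrow> Q \<sigma> \<Longrightarrow> Q (\<pi> \<circ> \<sigma>)"
    and adj: "\<And>i. 1 \<le> i \<Longrightarrow> i < n \<Longrightarrow> Q (transpose i (Suc i))"
  shows "Q \<pi>"
proof -
  have tr: "Q (transpose a (a + Suc d))" if "1 \<le> a" "a + Suc d \<le> n" for a d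
    using that
  proof (induction d)
    case 0
    then show ?case using adj[of a] by simp
  next
    case (Suc d)
    let ?t = "transpose (a + Suc d) (Suc (a + Suc d))"
    have "transpose a (a + Suc (Suc d)) = ?t \<circ> (transpose a (a + Suc d) \<circ> ?t)"
      by (auto simp: transpose_def fun_eq_iff)
    moreover have t: "Q ?t" using Suc.prems by (intro adj) auto
    moreover have "Q (transpose a (a + Suc d))" using Suc by simp
    ultimately show ?case by (metis comp)
  qed
  have tr': "Q (transpose a b)" if "a \<in> {1..n}" "b \<in> {1..n}" for a b
  proof -
    consider "a = b" | "a < b" | "b < a" by linarith
    then show ?thesis
    proof cases
      case 1
      then show ?thesis using id by simp
    next
      case 2
      then show ?thesis using tr[of a "b - a - 1"] that by simp
    next
      case 3
      then show ?thesis using tr[of b "a - b - 1"] that by (simp add: transpose_commute)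
    qed
  qed
  show ?thesis
    using \<pi> finite_atLeastAtMost
  proof (induction \<pi> rule: permutes_induct)
    case id
    show ?case by (rule assms)
  next
    case (swap a b \<pi>)
    then show ?case by (intro comp tr')
  qed
qed

section \<open>Calculating modulo the relations\<close>

locale spin =
  fixes n :: nat
begin

abbreviation "C \<equiv> carrier (free_alg n)"
abbreviation "I \<equiv> rel_ideal n"

lemma I_add: "x \<in> I \<Longrightarrow> y \<in> I \<Longrightarrow> x + y \<in> I"
  using additive_subgroup.a_closed[OF ideal.axioms(1)[OF ideal_rel_ideal], of x n y]
  by (simp add: free_alg_ops)

lemma I_lmult: "a \<in> C \<Longrightarrow> x \<in> I \<Longrightarrow> a * x \<in> I"
  using ideal.I_l_closed[OF ideal_rel_ideal, of x n a] by (simp add: free_alg_ops)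

lemma I_rmult: "a \<in> C \<Longrightarrow> x \<in> I \<Longrightarrow> x * a \<in> I"
  using ideal.I_r_closed[OF ideal_rel_ideal, of x n a] by (simp add: free_alg_ops)

lemma I_0: "0 \<in> I"
  using additive_subgroup.zero_closed[OF ideal.axioms(1)[OF ideal_rel_ideal], of n]
  by (simp add: free_alg_ops)

lemma C_minus_1: "- 1 \<in> C"
  by (intro free_alg_subset_uminus free_alg_subset_one)

lemma I_uminus: "x \<in> I \<Longrightarrow> - x \<in> I"
  using I_lmult[OF C_minus_1, of x] by simp

lemma I_diff: "x \<in> I \<Longrightarrow> y \<in> I \<Longrightarrow> x - y \<in> I"
  using I_add[of x "- y"] I_uminus by simp

lemma I_relator: "r \<in> relators n \<Longrightarrow> r \<in> I"
  unfolding rel_ideal_def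
  using ring.genideal_self[OF ring_free_alg relators_subset] by blast

lemma C_R: "1 \<le> i \<Longrightarrow> i < n \<Longrightarrow> R i \<in> C"
  and C_p: "1 \<le> i \<Longrightarrow> i \<le> n \<Longrightarrow> p i \<in> C"
  and C_q: "1 \<le> i \<Longrightarrow> i \<le> n \<Longrightarrow> q i \<in> C"
  by (auto intro!: free_alg_subset_gen simp: gens_def)

lemma C_0: "0 \<in> C"
  by (simp add: free_alg_def)

lemmas C_intros = free_alg_subset_add free_alg_subset_uminus free_alg_subset_diff
  free_alg_subset_mult free_alg_subset_one free_alg_subset_scalar C_0

lemma C_prod_list: "(\<And>x. x \<in> set xs \<Longrightarrow> x \<in> C) \<Longrightarrow> prod_list xs \<in> C"
  by (induction xs) (auto intro: C_intros)

lemma C_sum: "(\<And>x. x \<in> A \<Longrightarrow> f x \<in> C) \<Longrightarrow> sum f A \<in> C"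
  by (induction A rule: infinite_finite_induct) (auto intro: C_intros)

lemma C_power: "x \<in> C \<Longrightarrow> x ^ k \<in> C"
  by (induction k) (auto intro: C_intros)

text \<open>
  Equality in the quotient. Membership in the free algebra on the generators of index at most
  \<open>n\<close> is made part of the relation because multiplication preserves the ideal only there.
\<close>

definition eqv :: "falg \<Rightarrow> falg \<Rightarrow> bool" (infix "\<approx>" 50)
  where "f \<approx> g \<longleftrightarrow> f \<in> C \<and> g \<in> C \<and> f - g \<in> I"

lemma eqvI: "f \<in> C \<Longrightarrow> g \<in> C \<Longrightarrow> f - g \<in> I \<Longrightarrow> f \<approx> g"
  by (simp add: eqv_def)

lemma eqv_C: "f \<approx> g \<Longrightarrow> f \<in> C" "f \<approx> g \<Longrightarrow> g \<in> C"
  by (simp_all add: eqv_def)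

lemma eqv_refl: "f \<in> C \<Longrightarrow> f \<approx> f"
  by (simp add: eqv_def I_0)

lemma eqv_sym: "f \<approx> g \<Longrightarrow> g \<approx> f"
  using I_uminus[of "f - g"] by (auto simp: eqv_def)

lemma eqv_trans [trans]: "f \<approx> g \<Longrightarrow> g \<approx> h \<Longrightarrow> f \<approx> h"
  using I_add[of "f - g" "g - h"] by (auto simp: eqv_def)

lemma eqv_add: "f \<approx> g \<Longrightarrow> f' \<approx> g' \<Longrightarrow> f + f' \<approx> g + g'"
  using I_add[of "f - g" "f' - g'"] by (auto simp: eqv_def C_intros algebra_simps)

lemma eqv_uminus: "f \<approx> g \<Longrightarrow> - f \<approx> - g"
  using I_uminus[of "f - g"] by (auto simp: eqv_def free_alg_subset_uminus)

lemma eqv_diff: "f \<approx> g \<Longrightarrow> f' \<approx> g' \<Longrightarrow> f - f' \<approx> g - g'"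
  using eqv_add[of f g "- f'" "- g'"] by (simp add: eqv_uminus)

lemma eqv_mult:
  assumes "f \<approx> g" "f' \<approx> g'"
  shows "f * f' \<approx> g * g'"
proof -
  have "f * f' - g * g' = (f - g) * f' + g * (f' - g')"
    by (simp add: algebra_simps)
  then show ?thesis
    using assms I_add[OF I_rmult[of f' "f - g"] I_lmult[of g "f' - g'"]]
    by (auto simp: eqv_def C_intros)
qed

lemma eqv_lmult: "a \<in> C \<Longrightarrow> f \<approx> g \<Longrightarrow> a * f \<approx> a * g"
  by (intro eqv_mult eqv_refl)

lemma eqv_rmult: "a \<in> C \<Longrightarrow> f \<approx> g \<Longrightarrow> f * a \<approx> g * a"
  by (intro eqv_mult eqv_refl)

lemma scalar_mult: "scalar (a * b) = scalar a * scalar b"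
  and scalar_add: "scalar (a + b) = scalar a + scalar b"
  and scalar_uminus: "scalar (- a) = - scalar a"
  and scalar_1: "scalar 1 = 1" and scalar_0: "scalar 0 = 0"
  by (simp_all add: scalar_def mult_single single_add single_uminus)

lemma scalar_central: "x * scalar c = scalar c * x"
proof (induction x rule: poly_mapping_additive_induct)
  case (single w d)
  show ?case by (simp add: scalar_def mult_single mult.commute)
qed (simp_all add: algebra_simps)

lemma eqv_scalar_cancel:
  assumes "c \<noteq> 0" "scalar c * f \<in> I" "f \<in> C"
  shows "f \<in> I"
proof -
  have "scalar (inverse c) * (scalar c * f) = f"
    using assms(1) by (simp add: scalar_1 flip: mult.assoc scalar_mult)
  then show ?thesis
    using I_lmult[OF free_alg_subset_scalar assms(2), of "inverse c"] by simp
qed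

lemma relators_I:
  shows "i \<in> {1..<n} \<Longrightarrow> R i * R i - scalar (- eps\<^sup>2 - 2) \<in> I"
    and "i \<in> {1..<n} \<and> j \<in> {1..<n} \<and> \<bar>int i - int j\<bar> > 1 \<Longrightarrow> R i * R j - (- (R j * R i)) \<in> I"
    and "i \<in> {1..<n} \<and> i + 1 \<in> {1..<n} \<Longrightarrow>
      (R i * R (i+1) * R i - R (i+1) * R i * R (i+1)) - scalar (eps\<^sup>2) * (R (i+1) - R i) \<in> I"
    and "i \<in> {1..n} \<and> j \<in> {1..n} \<and> i \<noteq> j \<Longrightarrow> p i * p j - p j * p i \<in> I"
    and "i \<in> {1..n} \<and> j \<in> {1..n} \<and> i \<noteq> j \<Longrightarrow> q i * q j - (- (q j * q i)) \<in> I"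
    and "i \<in> {1..n} \<Longrightarrow> (p i * p i + q i * q i) - 1 \<in> I"
    and "i \<in> {1..n} \<and> j \<in> {1..n} \<Longrightarrow> p i * q j - q j * p i \<in> I"
    and "i \<in> {1..<n} \<and> j \<in> {1..n} \<and> j \<noteq> i \<and> j \<noteq> i + 1 \<Longrightarrow> R i * p j - p j * R i \<in> I"
    and "i \<in> {1..<n} \<and> j \<in> {1..n} \<and> j \<noteq> i \<and> j \<noteq> i + 1 \<Longrightarrow> R i * q j - (- (q j * R i)) \<in> I"
    and "i \<in> {1..<n} \<Longrightarrow> R i * p i - (p (i+1) * R i + scalar eps * (q i - q (i+1))) \<in> I"
    and "i \<in> {1..<n} \<Longrightarrow> R i * q i - (- (q (i+1) * R i) - scalar eps * (p i + p (i+1))) \<in> I"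
  by (rule I_relator, unfold relators_def, blast)+

lemma rel_RR: "1 \<le> i \<Longrightarrow> i < n \<Longrightarrow> R i * R i \<approx> scalar (- eps\<^sup>2 - 2)"
  by (intro eqvI C_intros C_R relators_I) auto

lemma rel_RR_far:
  "1 \<le> i \<Longrightarrow> i < n \<Longrightarrow> 1 \<le> j \<Longrightarrow> j < n \<Longrightarrow> 1 < \<bar>int i - int j\<bar> \<Longrightarrow> R i * R j \<approx> - (R j * R i)"
  by (intro eqvI C_intros C_R relators_I) auto

lemma rel_braid:
  assumes "1 \<le> i" "Suc i < n"
  shows "R (Suc i) * R i * R (Suc i) \<approx> R i * R (Suc i) * R i - scalar (eps\<^sup>2) * (R (Suc i) - R i)"
proof -
  let ?d = "R i * R (Suc i) * R i - R (Suc i) * R i * R (Suc i) - scalar (eps\<^sup>2) * (R (Suc i) - R i)"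
  have "?d \<in> I"
    using relators_I(3)[of i] assms by simp
  moreover have "R (Suc i) * R i * R (Suc i) - (R i * R (Suc i) * R i - scalar (eps\<^sup>2) * (R (Suc i) - R i)) = - ?d"
    by simp
  ultimately have "R (Suc i) * R i * R (Suc i) - (R i * R (Suc i) * R i - scalar (eps\<^sup>2) * (R (Suc i) - R i)) \<in> I"
    by (simp only: I_uminus)
  then show ?thesis
    using assms by (intro eqvI C_intros C_R) auto
qed

lemma rel_p_p:
  assumes "1 \<le> i" "i \<le> n" "1 \<le> j" "j \<le> n"
  shows "p i * p j \<approx> p j * p i"
proof (cases "i = j")
  case True
  then show ?thesis using assms by (auto intro!: eqv_refl C_intros C_p)
next
  case False
  then show ?thesis
    using assms by (intro eqvI C_intros C_p relators_I) auto
qed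

lemma rel_q_q:
  "1 \<le> i \<Longrightarrow> i \<le> n \<Longrightarrow> 1 \<le> j \<Longrightarrow> j \<le> n \<Longrightarrow> i \<noteq> j \<Longrightarrow> q i * q j \<approx> - (q j * q i)"
  by (intro eqvI C_intros C_q relators_I) auto

lemma rel_sq:
  assumes "1 \<le> i" "i \<le> n"
  shows "q i * q i \<approx> 1 - p i * p i"
proof -
  have "q i * q i - (1 - p i * p i) = p i * p i + q i * q i - 1"
    by simp
  moreover have "p i * p i + q i * q i - 1 \<in> I"
    using assms by (intro relators_I) auto
  ultimately have "q i * q i - (1 - p i * p i) \<in> I"
    by (simp only:)
  then show ?thesis
    using assms by (intro eqvI C_intros C_p C_q)
qed

lemma rel_pq: "1 \<le> i \<Longrightarrow> i \<le> n \<Longrightarrow> 1 \<le> j \<Longrightarrow> j \<le> n \<Longrightarrow> p i * q j \<approx> q j * p i"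
  by (intro eqvI C_intros C_p C_q relators_I) auto

lemma rel_Rp_far:
  "1 \<le> i \<Longrightarrow> i < n \<Longrightarrow> 1 \<le> j \<Longrightarrow> j \<le> n \<Longrightarrow> j \<noteq> i \<Longrightarrow> j \<noteq> Suc i \<Longrightarrow> R i * p j \<approx> p j * R i"
  by (intro eqvI C_intros C_R C_p relators_I) auto

lemma rel_Rq_far:
  "1 \<le> i \<Longrightarrow> i < n \<Longrightarrow> 1 \<le> j \<Longrightarrow> j \<le> n \<Longrightarrow> j \<noteq> i \<Longrightarrow> j \<noteq> Suc i \<Longrightarrow> R i * q j \<approx> - (q j * R i)"
  by (intro eqvI C_intros C_R C_q relators_I) auto

lemma rel_Rp:
  "1 \<le> i \<Longrightarrow> i < n \<Longrightarrow> R i * p i \<approx> p (Suc i) * R i + scalar eps * (q i - q (Suc i))"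
  by (intro eqvI C_intros C_R C_p C_q relators_I[unfolded Suc_eq_plus1[symmetric]]) auto

lemma rel_Rq:
  "1 \<le> i \<Longrightarrow> i < n \<Longrightarrow> R i * q i \<approx> - (q (Suc i) * R i) - scalar eps * (p i + p (Suc i))"
  by (intro eqvI C_intros C_R C_p C_q relators_I[unfolded Suc_eq_plus1[symmetric]]) auto

text \<open>
  The relations prescribe how \<open>r = R\<^sub>i\<close> passes \<open>x = p\<^sub>i\<close> and \<open>y = q\<^sub>i\<close>, but not how it passes
  \<open>x' = p\<^sub>i\<^sub>+\<^sub>1\<close> and \<open>y' = q\<^sub>i\<^sub>+\<^sub>1\<close>. The missing rules follow because \<open>r\<^sup>2 = k\<close> is a scalar: computing
  \<open>r x' r\<close> and \<open>r y' r\<close> from the given relations and multiplying by \<open>r\<close> once more gives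
  \<open>(k + e\<^sup>2) w = 0\<close>, where \<open>k + e\<^sup>2 = -2\<close>. The identities below record these computations with the
  relators \<open>z1\<close>, \<open>z2\<close>, \<open>z3\<close> kept as unknowns.
\<close>

lemma cross_relation_certificate:
  fixes r x x' y y' e k z1 z2 z3 w :: "'r :: ring_1"
  assumes e: "r * e = e * r" "x * e = e * x" "x' * e = e * x'" "y * e = e * y" "y' * e = e * y'"
    and k: "r * k = k * r" "x * k = k * x" "x' * k = k * x'" "y * k = k * y" "y' * k = k * y'" "e * k = k * e"
    and z1_def: "z1 = r * r - k" and z2_def: "z2 = r * x - (x' * r + e * (y - y'))"
    and z3_def: "z3 = r * y - (- (y' * r) - e * (x + x'))"
    and w_def: "w = r * x' - (x * r - e * (y - y'))"
  shows "(k + e * e) * w = z1 * x * r - r * x' * z1 - r * z2 * r - e * e * z2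
      - e * (z3 * r - y' * z1 - r * z3 + z1 * y)"
    and "e * (r * (y - y') - (y - y') * r) = z1 * x - r * z2 - x * z1 - w * r"
    and "r * y' - (- (y * r) - e * (x + x')) = z3 - (r * (y - y') - (y - y') * r)"
proof -
  have e': "r * (e * a) = e * (r * a)" "x * (e * a) = e * (x * a)" "x' * (e * a) = e * (x' * a)"
    "y * (e * a) = e * (y * a)" "y' * (e * a) = e * (y' * a)" for a
    using e by (simp_all flip: mult.assoc)
  have k': "r * (k * a) = k * (r * a)" "x * (k * a) = k * (x * a)" "x' * (k * a) = k * (x' * a)"
    "y * (k * a) = k * (y * a)" "y' * (k * a) = k * (y' * a)" "e * (k * a) = k * (e * a)" for a
    using k by (simp_all flip: mult.assoc)
  show "(k + e * e) * w = z1 * x * r - r * x' * z1 - r * z2 * r - e * e * z2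
      - e * (z3 * r - y' * z1 - r * z3 + z1 * y)"
    unfolding z1_def z2_def z3_def w_def by (simp add: algebra_simps e k e' k')
  show "e * (r * (y - y') - (y - y') * r) = z1 * x - r * z2 - x * z1 - w * r"
    unfolding z1_def z2_def w_def by (simp add: algebra_simps e k e' k')
  show "r * y' - (- (y * r) - e * (x + x')) = z3 - (r * (y - y') - (y - y') * r)"
    unfolding z3_def by (simp add: algebra_simps)
qed

lemma rel_R_next:
  assumes i: "1 \<le> i" "i < n"
  shows rel_Rp_next: "R i * p (Suc i) \<approx> p i * R i - scalar eps * (q i - q (Suc i))"
    and rel_Rq_next: "R i * q (Suc i) \<approx> - (q i * R i) - scalar eps * (p i + p (Suc i))"
proof -
  let ?r = "R i" and ?x = "p i" and ?x' = "p (Suc i)" and ?y = "q i" and ?y' = "q (Suc i)"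
    and ?e = "scalar eps" and ?k = "scalar (- eps\<^sup>2 - 2)"
  have C: "?r \<in> C" "?x \<in> C" "?x' \<in> C" "?y \<in> C" "?y' \<in> C" "?e \<in> C" "?k \<in> C"
    using i by (auto intro!: C_R C_p C_q free_alg_subset_scalar)
  note Cs = C C_intros
  define z1 where "z1 = ?r * ?r - ?k"
  define z2 where "z2 = ?r * ?x - (?x' * ?r + ?e * (?y - ?y'))"
  define z3 where "z3 = ?r * ?y - (- (?y' * ?r) - ?e * (?x + ?x'))"
  define w where "w = ?r * ?x' - (?x * ?r - ?e * (?y - ?y'))"
  have z: "z1 \<in> I" "z2 \<in> I" "z3 \<in> I"
    using rel_RR[OF i] rel_Rp[OF i] rel_Rq[OF i] by (simp_all add: eqv_def z1_def z2_def z3_def)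
  note cert = cross_relation_certificate[of ?r ?e ?x ?x' ?y ?y' ?k, OF scalar_central scalar_central
      scalar_central scalar_central scalar_central scalar_central scalar_central scalar_central
      scalar_central scalar_central scalar_central z1_def z2_def z3_def w_def]
  note Is = I_add I_diff I_lmult I_rmult
  have "?k + ?e * ?e = scalar (- 2)"
    by (simp add: power2_eq_square flip: scalar_add scalar_mult)
  moreover have "(?k + ?e * ?e) * w \<in> I"
    unfolding cert(1) by (simp only: Is z Cs)
  ultimately have "scalar (- 2) * w \<in> I"
    by simp
  then have w: "w \<in> I"
    by (rule eqv_scalar_cancel[rotated]) (simp_all add: w_def Cs)
  then show "?r * ?x' \<approx> ?x * ?r - ?e * (?y - ?y')"
    by (simp only: eqv_def w_def Cs simp_thms)
  have "?e * (?r * (?y - ?y') - (?y - ?y') * ?r) \<in> I"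
    unfolding cert(2) by (simp only: Is z w Cs)
  then have u: "?r * (?y - ?y') - (?y - ?y') * ?r \<in> I"
    by (rule eqv_scalar_cancel[rotated]) (simp_all only: Cs eps_nonzero not_False_eq_True)
  have "?r * ?y' - (- (?y * ?r) - ?e * (?x + ?x')) \<in> I"
    unfolding cert(3) by (simp only: Is z u)
  then show "?r * ?y' \<approx> - (?y * ?r) - ?e * (?x + ?x')"
    by (simp only: eqv_def Cs simp_thms)
qed

end

section \<open>Normal forms\<close>

text \<open>
  A permutation of \<open>{1..k}\<close> is encoded by its chain of coset representatives: \<open>t i \<le> i\<close> is the position to
  which \<open>i\<close> is carried among \<open>{1..i}\<close>. Outside \<open>{1..k}\<close> the tuple is the identity, so that tuples
  are determined by their relevant part and \<open>\<lambda>i. i\<close> encodes the identity permutation.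
\<close>

definition cosets :: "nat \<Rightarrow> (nat \<Rightarrow> nat) set"
  where "cosets k = {t. (\<forall>i\<in>{1..k}. 1 \<le> t i \<and> t i \<le> i) \<and> (\<forall>i. i \<notin> {1..k} \<longrightarrow> t i = i)}"

definition R_word :: "nat list \<Rightarrow> falg"
  where "R_word w = prod_list (map R w)"

text \<open>
  The product \<open>R\<^sub>k\<^sub>-\<^sub>1 R\<^sub>k\<^sub>-\<^sub>2 \<dots> R\<^sub>m\<close>, which represents a coset of the subgroup of permutations of
  \<open>{1..k-1}\<close> in that of \<open>{1..k}\<close>.
\<close>

definition descent :: "nat \<Rightarrow> nat \<Rightarrow> falg"
  where "descent k m = R_word (rev [m..<k])"

definition coset_word :: "nat \<Rightarrow> (nat \<Rightarrow> nat) \<Rightarrow> falg"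
  where "coset_word k t = prod_list (map (\<lambda>i. descent i (t i)) [1..<Suc k])"

lemma R_word_simps [simp]: "R_word [] = 1" "R_word (i # w) = R i * R_word w" "R_word (w @ w') = R_word w * R_word w'"
  by (simp_all add: R_word_def)

lemma descent_refl [simp]: "descent k k = 1"
  by (simp add: descent_def)

lemma descent_mult:
  assumes "m \<le> j" "j \<le> k"
  shows "descent k j * descent j m = descent k m"
proof -
  have "[m..<k] = [m..<j] @ [j..<k]"
    using assms by (metis le_Suc_ex upt_add_eq_append)
  then show ?thesis by (simp add: descent_def)
qed

lemma descent_Suc: "descent (Suc k) k = R k"
  by (simp add: descent_def)

lemma coset_word_Suc: "coset_word (Suc k) t = coset_word k t * descent (Suc k) (t (Suc k))"
  by (simp add: coset_word_def)

lemma coset_word_cong: "(\<And>i. 1 \<le> i \<Longrightarrow> i \<le> k \<Longrightarrow> t i = t' i) \<Longrightarrow> coset_word k t = coset_word k t'"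
  unfolding coset_word_def by (intro arg_cong[of _ _ prod_list] map_cong) auto

lemma id_cosets: "(\<lambda>i. i) \<in> cosets k"
  by (simp add: cosets_def)

lemma coset_word_id: "coset_word k (\<lambda>i. i) = 1"
  by (induction k) (simp_all add: coset_word_Suc, simp add: coset_word_def)

lemma cosets_0: "cosets 0 = {\<lambda>i. i}"
  by (auto simp: cosets_def)

lemma cosets_Suc: "bij_betw (\<lambda>(t, j). t(Suc k := j)) (cosets k \<times> {1..Suc k}) (cosets (Suc k))"
  by (rule bij_betw_byWitness[where f' = "\<lambda>t. (t(Suc k := Suc k), t (Suc k))"])
    (auto simp: cosets_def fun_eq_iff)

lemma finite_cosets: "finite (cosets k)"
proof (induction k)
  case (Suc k)
  then show ?case using bij_betw_finite[OF cosets_Suc[of k]] by simp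
qed (simp add: cosets_0)

context spin
begin

definition p_mon :: "(nat \<Rightarrow>\<^sub>0 nat) \<Rightarrow> falg"
  where "p_mon m = (\<Prod>i\<leftarrow>[1..<Suc n]. p i ^ Poly_Mapping.lookup m i)"

definition q_mon :: "nat set \<Rightarrow> falg"
  where "q_mon S = (\<Prod>i\<leftarrow>[1..<Suc n]. if i \<in> S then q i else 1)"

lemma C_R_word: "set w \<subseteq> {1..<n} \<Longrightarrow> R_word w \<in> C"
  unfolding R_word_def by (rule C_prod_list) (auto intro!: C_R)

lemma C_descent: "1 \<le> m \<Longrightarrow> k \<le> n \<Longrightarrow> descent k m \<in> C"
  unfolding descent_def by (rule C_R_word) auto

lemma C_coset_word: "t \<in> cosets k \<Longrightarrow> k \<le> n \<Longrightarrow> coset_word k t \<in> C"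
  unfolding coset_word_def by (rule C_prod_list) (auto intro!: C_descent simp: cosets_def)

lemma C_p_mon: "p_mon m \<in> C"
  unfolding p_mon_def by (rule C_prod_list) (auto intro!: C_power C_p)

lemma C_q_mon: "q_mon S \<in> C"
  unfolding q_mon_def by (rule C_prod_list) (auto intro!: C_q C_intros)

lemma scalar_left_commute: "a * (scalar c * b) = scalar c * (a * b)"
  using scalar_central[of a c] by (simp flip: mult.assoc)

inductive_set combs :: "falg set \<Rightarrow> falg set" for B
  where
    zero: "x \<approx> 0 \<Longrightarrow> x \<in> combs B"
  | step: "b \<in> B \<Longrightarrow> x \<in> combs B \<Longrightarrow> y \<approx> scalar c * b + x \<Longrightarrow> y \<in> combs B"

lemma combs_C: "x \<in> combs B \<Longrightarrow> x \<in> C"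
  by (induction rule: combs.induct) (auto dest: eqv_C)

lemma combs_eqv: "x \<in> combs B \<Longrightarrow> y \<approx> x \<Longrightarrow> y \<in> combs B"
  by (induction rule: combs.cases) (auto intro: combs.intros eqv_trans)

lemma combs_0: "0 \<in> combs B"
  by (rule combs.zero) (rule eqv_refl[OF C_0])

lemma combs_add:
  assumes "x \<in> combs B" "z \<in> combs B"
  shows "x + z \<in> combs B"
  using assms(1)
proof induction
  case (zero x)
  then have "x + z \<approx> 0 + z"
    using assms(2) by (intro eqv_add eqv_refl combs_C)
  then show ?case using combs_eqv[OF assms(2)] by simp
next
  case (step b x y c)
  then have "y + z \<approx> (scalar c * b + x) + z"
    using assms(2) by (intro eqv_add eqv_refl combs_C)
  then show ?case
    by (intro combs.step[OF step.hyps(1) step.IH]) (simp add: add.assoc)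
qed

lemma combs_base:
  assumes "b \<in> B" "b \<in> C"
  shows "b \<in> combs B"
  by (rule combs.step[OF assms(1) combs_0, of _ 1]) (simp add: scalar_1 eqv_refl assms)

lemma combs_scalar:
  assumes "x \<in> combs B"
  shows "scalar c * x \<in> combs B"
  using assms
proof induction
  case (zero x)
  then show ?case
    using eqv_lmult[OF free_alg_subset_scalar, of x 0 c] by (intro combs.zero) simp
next
  case (step b x y d)
  then have "scalar c * y \<approx> scalar c * (scalar d * b + x)"
    by (intro eqv_lmult free_alg_subset_scalar)
  then show ?case
    by (intro combs.step[OF step.hyps(1) step.IH, of _ "c * d"])
      (simp add: scalar_mult distrib_left mult.assoc)
qed

lemma combs_uminus: "x \<in> combs B \<Longrightarrow> - x \<in> combs B"
  using combs_scalar[of x B "- 1"] by (simp add: scalar_uminus scalar_1)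

lemma combs_diff: "x \<in> combs B \<Longrightarrow> y \<in> combs B \<Longrightarrow> x - y \<in> combs B"
  using combs_add[of x B "- y"] combs_uminus[of y B] by simp

lemma combs_mult:
  assumes x: "x \<in> combs B" and a: "a \<in> C" and a': "a' \<in> C"
    and B: "\<And>b. b \<in> B \<Longrightarrow> a * b * a' \<in> combs B'"
  shows "a * x * a' \<in> combs B'"
  using x
proof induction
  case (zero x)
  then have "a * x * a' \<approx> a * 0 * a'"
    by (intro eqv_mult eqv_refl a a')
  then show ?case by (intro combs.zero) simp
next
  case (step b x y c)
  then have "a * y * a' \<approx> a * (scalar c * b + x) * a'"
    by (intro eqv_mult eqv_refl a a')
  moreover have "a * (scalar c * b + x) * a' = scalar c * (a * b * a') + a * x * a'"
  proof -
    show ?thesis by (simp add: scalar_left_commute distrib_left distrib_right mult.assoc)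
  qed
  ultimately show ?case
    using combs_add[OF combs_scalar[OF B[OF step.hyps(1)]] step.IH, of c] combs_eqv by metis
qed

lemma combs_lmult:
  assumes "x \<in> combs B" "a \<in> C" "\<And>b. b \<in> B \<Longrightarrow> a * b \<in> combs B'"
  shows "a * x \<in> combs B'"
  using combs_mult[OF assms(1,2) free_alg_subset_one, of B'] assms(3) by simp

lemma combs_rmult:
  assumes "x \<in> combs B" "a \<in> C" "\<And>b. b \<in> B \<Longrightarrow> b * a \<in> combs B'"
  shows "x * a \<in> combs B'"
  using combs_mult[OF assms(1) free_alg_subset_one assms(2), of B'] assms(3) by simp

lemma eqv_scalar_left: "a \<in> C \<Longrightarrow> f \<approx> scalar c * g \<Longrightarrow> a * f \<approx> scalar c * (a * g)"
  using eqv_lmult[of a f "scalar c * g"] by (simp add: scalar_left_commute)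

text \<open>
  The scalar is left unspecified: where this is used to show that a product lies in a span,
  the signs are irrelevant.
\<close>

lemma commute_prod_list:
  assumes "a \<in> C" "\<And>x. x \<in> set xs \<Longrightarrow> f x \<in> C \<and> (\<exists>c. a * f x \<approx> scalar c * (f x * a))"
  shows "\<exists>c. a * prod_list (map f xs) \<approx> scalar c * (prod_list (map f xs) * a)"
  using assms(2)
proof (induction xs)
  case Nil
  show ?case by (rule exI[of _ 1]) (simp add: scalar_1 eqv_refl assms(1))
next
  case (Cons x xs)
  let ?P = "prod_list (map f xs)"
  obtain c where c: "a * f x \<approx> scalar c * (f x * a)" and fx: "f x \<in> C" using Cons.prems[of x] by auto
  obtain d where d: "a * ?P \<approx> scalar d * (?P * a)" using Cons by auto
  have P: "?P \<in> C" by (rule C_prod_list) (use Cons.prems in auto)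
  have "a * f x * ?P \<approx> scalar c * (f x * a) * ?P"
    by (rule eqv_rmult[OF P c])
  also have "scalar c * (f x * a) * ?P = scalar c * (f x * (a * ?P))"
    by (simp add: mult.assoc)
  also have "\<dots> \<approx> scalar c * (scalar d * (f x * (?P * a)))"
    by (intro eqv_lmult free_alg_subset_scalar eqv_scalar_left fx d)
  finally show ?case
    by (intro exI[of _ "c * d"]) (simp add: scalar_mult mult.assoc)
qed

lemma commute_exactly_prod_list:
  assumes "a \<in> C" "\<And>x. x \<in> set xs \<Longrightarrow> f x \<in> C \<and> a * f x \<approx> f x * a"
  shows "a * prod_list (map f xs) \<approx> prod_list (map f xs) * a"
  using assms(2)
proof (induction xs)
  case Nil
  show ?case by (simp add: eqv_refl assms(1))
next
  case (Cons x xs)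
  let ?P = "prod_list (map f xs)"
  have P: "?P \<in> C" by (rule C_prod_list) (use Cons.prems in auto)
  have "a * f x * ?P \<approx> (f x * a) * ?P"
    using Cons.prems[of x] by (intro eqv_rmult P) auto
  also have "f x * a * ?P = f x * (a * ?P)"
    by (simp add: mult.assoc)
  also have "\<dots> \<approx> f x * (?P * a)"
    using Cons by (intro eqv_lmult) auto
  finally show ?case by (simp add: mult.assoc)
qed

lemma scalar_minus_one: "scalar (- 1) * x = - x"
  by (simp add: scalar_uminus scalar_1)


subsection \<open>The finite spin Hecke algebra\<close>

lemma R_word_far:
  assumes "set u \<subseteq> {1..<n}" "set w \<subseteq> {1..<n}"
    and "\<And>i j. i \<in> set u \<Longrightarrow> j \<in> set w \<Longrightarrow> 1 < \<bar>int i - int j\<bar>"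
  shows "\<exists>c. R_word u * R_word w \<approx> scalar c * (R_word w * R_word u)"
  using assms(1,3)
proof (induction u)
  case Nil
  show ?case by (rule exI[of _ 1]) (simp add: scalar_1 eqv_refl C_R_word[OF assms(2)])
next
  case (Cons i u)
  obtain c where c: "R_word u * R_word w \<approx> scalar c * (R_word w * R_word u)"
    using Cons by auto
  have i: "1 \<le> i" "i < n" using Cons.prems by auto
  have "\<exists>d. R i * prod_list (map R w) \<approx> scalar d * (prod_list (map R w) * R i)"
  proof (rule commute_prod_list)
    show "R i \<in> C" by (rule C_R[OF i])
    fix j assume "j \<in> set w"
    then have "R i * R j \<approx> - (R j * R i)" "R j \<in> C"
      using i Cons.prems assms(2) by (auto intro!: rel_RR_far C_R)
    then show "R j \<in> C \<and> (\<exists>c. R i * R j \<approx> scalar c * (R j * R i))"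
      using scalar_minus_one by metis
  qed
  then obtain d where d: "R i * R_word w \<approx> scalar d * (R_word w * R i)"
    by (auto simp: R_word_def)
  have "R i * (R_word u * R_word w) \<approx> scalar c * (R i * (R_word w * R_word u))"
    by (intro eqv_scalar_left C_R i c)
  also have "R i * (R_word w * R_word u) = R i * R_word w * R_word u" by (simp add: mult.assoc)
  also have "scalar c * (R i * R_word w * R_word u) \<approx> scalar c * (scalar d * (R_word w * R i) * R_word u)"
    using Cons.prems by (intro eqv_lmult eqv_rmult d free_alg_subset_scalar C_R_word) auto
  finally show ?case
    by (intro exI[of _ "c * d"]) (simp add: mult.assoc scalar_mult)
qed

definition coset_words :: "nat \<Rightarrow> falg set"
  where "coset_words k = coset_word k ` cosets k"

lemma coset_words_C: "k \<le> n \<Longrightarrow> b \<in> coset_words k \<Longrightarrow> b \<in> C"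
  by (auto simp: coset_words_def C_coset_word)

text \<open>
  By induction on \<open>k\<close> it suffices to write \<open>descent (k + 1) m * R j\<close> as a combination of products
  \<open>w * descent (k + 1) m'\<close> with \<open>w\<close> a word in \<open>R\<^sub>1, \<dots>, R\<^sub>k\<^sub>-\<^sub>1\<close>; such products are
  good: they carry the span for \<open>k\<close> into that for \<open>k + 1\<close>.
  Multiplying by \<open>R\<^sub>m\<^sub>-\<^sub>1\<close> lengthens the descending product, by \<open>R\<^sub>m\<close> shortens it, and smaller
  generators pass through it. For \<open>j > m\<close> the factor \<open>R\<^sub>j\<close> travels left until it meets
  \<open>R\<^sub>j R\<^sub>j\<^sub>-\<^sub>1\<close>, where the braid relation applies; its leading term releases \<open>R\<^sub>j\<^sub>-\<^sub>1\<close> to the left, and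
  its two lower terms break the descending product into two commuting pieces.
\<close>

lemma coset_words_closed:
  assumes "k \<le> n" "x \<in> combs (coset_words k)" "1 \<le> j" "j < k"
  shows "x * R j \<in> combs (coset_words k)"
  using assms
proof (induction k arbitrary: x j)
  case 0
  then show ?case by simp
next
  case (Suc k)
  define L where "L = combs (coset_words k)"
  define L' where "L' = combs (coset_words (Suc k))"
  have Sk: "Suc k \<le> n" "k \<le> n" using Suc.prems by auto
  have Rd: "l * descent (Suc k) m \<in> L'" if "l \<in> L" "1 \<le> m" "m \<le> Suc k" for l m
    unfolding L'_def
  proof (rule combs_rmult[OF that(1)[unfolded L_def]])
    show "descent (Suc k) m \<in> C" using that Sk by (intro C_descent)
    fix b assume "b \<in> coset_words k"
    then obtain t where t: "t \<in> cosets k" "b = coset_word k t" by (auto simp: coset_words_def)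
    have "coset_word k t = coset_word k (t(Suc k := m))" by (rule coset_word_cong) simp
    then have "b * descent (Suc k) m = coset_word (Suc k) (t(Suc k := m))"
      by (simp add: t coset_word_Suc)
    moreover have "t(Suc k := m) \<in> cosets (Suc k)"
      using t that by (auto simp: cosets_def)
    ultimately show "b * descent (Suc k) m \<in> combs (coset_words (Suc k))"
      using Sk by (intro combs_base) (auto simp: coset_words_def intro!: C_coset_word)
  qed
  have Rw: "l * R_word w \<in> L" if "l \<in> L" "set w \<subseteq> {1..<k}" for l w
    using that
  proof (induction w arbitrary: l)
    case (Cons i w)
    then have "l * R i \<in> L" unfolding L_def by (intro Suc.IH Sk) auto
    then show ?case using Cons by (auto simp flip: mult.assoc)
  qed simp
  define good where "good x \<longleftrightarrow> x \<in> C \<and> (\<forall>l\<in>L. l * x \<in> L')" for x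
  have LC: "l \<in> C" if "l \<in> L" for l using that combs_C by (auto simp: L_def)
  have g_word: "good (R_word w * descent (Suc k) m)" if "set w \<subseteq> {1..<k}" "1 \<le> m" "m \<le> Suc k" for w m
    using Rd[OF Rw[OF _ that(1)] that(2,3)] that Sk
    by (auto simp: good_def mult.assoc intro!: C_intros C_R_word C_descent)
  have g_eqv: "good y" if "good x" "y \<approx> x" for x y
    using that unfolding good_def L'_def
    by (meson LC eqv_C(1) eqv_lmult combs_eqv)
  have g_add: "good (x + y)" "good (x - y)" if "good x" "good y" for x y
    using that by (auto simp: good_def distrib_left right_diff_distrib L'_def intro!: C_intros combs_add combs_diff)
  have g_scalar: "good (scalar c * x)" if "good x" for c x
  proof -
    show ?thesis using that by (auto simp: good_def scalar_left_commute L'_def intro!: C_intros combs_scalar)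
  qed
  have g_far: "good (descent (Suc k) m * R_word w)"
    if "set w \<subseteq> {1..<k}" "1 \<le> m" "m \<le> Suc k" "\<And>i. i \<in> set w \<Longrightarrow> Suc i < m" for w m
  proof -
    have "\<exists>c. R_word (rev [m..<Suc k]) * R_word w \<approx> scalar c * (R_word w * R_word (rev [m..<Suc k]))"
    proof (rule R_word_far)
      fix i j assume "i \<in> set (rev [m..<Suc k])" "j \<in> set w"
      then show "1 < \<bar>int i - int j\<bar>" using that(4)[of j] by auto
    qed (use that Sk in auto)
    then obtain c where "descent (Suc k) m * R_word w \<approx> scalar c * (R_word w * descent (Suc k) m)"
      by (auto simp: descent_def)
    then show ?thesis using g_eqv g_scalar g_word[OF that(1-3)] by blast
  qed
  have main: "good (descent (Suc k) m * R j)" if m: "1 \<le> m" "m \<le> Suc k" for m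
  proof -
    have jn: "1 \<le> j" "j < n" "j \<le> k" using Suc.prems by auto
    consider "Suc j = m" | "j = m" | "Suc j < m" | "m < j" by linarith
    then show ?thesis
    proof cases
      case 1
      have "descent (Suc k) m * R j = descent (Suc k) j"
        using descent_mult[of j "Suc j" "Suc k"] jn unfolding 1[symmetric] by (simp add: descent_Suc)
      then show ?thesis using g_word[of "[]" j] jn by simp
    next
      case 2
      have "descent (Suc k) m * R j = descent (Suc k) (Suc j) * (R j * R j)"
        using descent_mult[of j "Suc j" "Suc k"] 2 jn by (simp add: descent_Suc mult.assoc[symmetric])
      also have "\<dots> \<approx> descent (Suc k) (Suc j) * scalar (- eps\<^sup>2 - 2)"
        using jn Sk by (intro eqv_lmult rel_RR C_descent) auto
      finally have "descent (Suc k) m * R j \<approx> scalar (- eps\<^sup>2 - 2) * (R_word [] * descent (Suc k) (Suc j))"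
        by (simp add: scalar_central)
      then show ?thesis
        by (rule g_eqv[rotated]) (use jn in \<open>intro g_scalar g_word; simp\<close>)
    next
      case 3
      then show ?thesis using g_far[of "[j]" m] m jn by simp
    next
      case 4
      then obtain i where ij: "j = Suc i" and mi: "m \<le> i" "1 \<le> i" using m by (cases j) auto
      let ?A = "descent (Suc k) (Suc j)" and ?B = "descent i m"
      have A: "?A \<in> C" and B: "?B \<in> C" and RiC: "R i \<in> C" and RjC: "R j \<in> C"
        using mi m jn ij Sk by (auto intro!: C_descent C_R)
      have split: "descent (Suc k) m = ?A * R j * R i * ?B"
        using descent_mult[of m i "Suc k"] descent_mult[of i j "Suc k"] descent_mult[of j "Suc j" "Suc k"] mi ij jn
        by (simp add: descent_Suc)
      have "\<exists>c. R_word (rev [m..<i]) * R_word [j] \<approx> scalar c * (R_word [j] * R_word (rev [m..<i]))"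
        by (rule R_word_far) (use m jn ij mi in auto)
      then obtain c where c: "?B * R j \<approx> scalar c * (R j * ?B)"
        by (auto simp: descent_def)
      have t1: "good (?A * R i * (R j * R i * ?B))"
      proof -
        have "\<exists>c. R_word (rev [Suc j..<Suc k]) * R_word [i] \<approx> scalar c * (R_word [i] * R_word (rev [Suc j..<Suc k]))"
          by (rule R_word_far) (use m jn ij mi Sk in auto)
        then obtain c where c: "?A * R i \<approx> scalar c * (R i * ?A)"
          by (auto simp: descent_def)
        have "?A * R i * (R j * R i * ?B) \<approx> scalar c * (R i * ?A) * (R j * R i * ?B)"
          by (intro eqv_rmult c C_intros B RiC RjC)
        also have "\<dots> = scalar c * (R_word [i] * descent (Suc k) m)"
          by (simp add: split mult.assoc)
        finally show ?thesis
          by (rule g_eqv[rotated]) (use m mi ij jn in \<open>intro g_scalar g_word; simp\<close>)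
      qed
      have t2: "good (?A * R j * ?B)"
      proof -
        have "?A * R j = descent (Suc k) j"
          using descent_mult[of j "Suc j" "Suc k"] jn by (simp add: descent_Suc)
        then show ?thesis
          using g_far[of "rev [m..<i]" j] m mi ij jn by (auto simp: descent_def[of i])
      qed
      have t3: "good (?A * R i * ?B)"
      proof -
        have "R i * ?B = descent j m"
          using descent_mult[of m i j] mi ij by (simp add: descent_Suc)
        moreover have "good (?A * R_word (rev [m..<j]))"
          by (rule g_far) (use m mi ij jn in auto)
        ultimately show ?thesis
          by (simp only: mult.assoc descent_def[of j])
      qed
      have "descent (Suc k) m * R j = ?A * R j * R i * (?B * R j)"
        by (simp add: split mult.assoc)
      also have "\<dots> \<approx> scalar c * (?A * R j * R i * (R j * ?B))"
        by (intro eqv_scalar_left C_intros A RiC RjC c)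
      also have "?A * R j * R i * (R j * ?B) = ?A * (R j * R i * R j) * ?B"
        by (simp add: mult.assoc)
      also have "scalar c * \<dots> \<approx> scalar c * (?A * (R i * R j * R i - scalar (eps\<^sup>2) * (R j - R i)) * ?B)"
        unfolding ij using mi jn ij A B
        by (intro eqv_lmult eqv_rmult rel_braid free_alg_subset_scalar) auto
      also have "?A * (R i * R j * R i - scalar (eps\<^sup>2) * (R j - R i)) * ?B
          = ?A * R i * (R j * R i * ?B) - scalar (eps\<^sup>2) * (?A * R j * ?B - ?A * R i * ?B)"
      proof -
        show ?thesis
          by (simp add: scalar_left_commute left_diff_distrib right_diff_distrib mult.assoc)
      qed
      finally show ?thesis
        by (rule g_eqv[rotated]) (intro g_scalar g_add t1 t2 t3)
    qed
  qed
  show ?case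
  proof (rule combs_rmult[OF Suc.prems(2)])
    show "R j \<in> C" using Suc.prems by (intro C_R) auto
    fix b assume "b \<in> coset_words (Suc k)"
    then obtain t where t: "t \<in> cosets (Suc k)" "b = coset_word (Suc k) t" by (auto simp: coset_words_def)
    have "t(Suc k := Suc k) \<in> cosets k" using t(1) by (auto simp: cosets_def)
    moreover have "coset_word k t = coset_word k (t(Suc k := Suc k))" by (rule coset_word_cong) simp
    ultimately have "coset_word k t \<in> L"
      using Sk by (auto simp: L_def coset_words_def intro!: combs_base C_coset_word)
    moreover have "1 \<le> t (Suc k)" "t (Suc k) \<le> Suc k" using t(1) by (auto simp: cosets_def)
    ultimately show "b * R j \<in> combs (coset_words (Suc k))"
      using main[of "t (Suc k)"] by (auto simp: good_def L'_def t(2) coset_word_Suc mult.assoc)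
  qed
qed

lemma coset_words_span:
  assumes "set w \<subseteq> {1..<n}"
  shows "R_word w \<in> combs (coset_words n)"
  using assms
proof (induction w rule: rev_induct)
  case Nil
  have "coset_word n (\<lambda>i. i) \<in> coset_words n" unfolding coset_words_def by (rule imageI[OF id_cosets])
  then show ?case by (auto intro!: combs_base C_intros simp: coset_word_id)
next
  case (snoc j w)
  then show ?case using coset_words_closed[of n "R_word w" j] by simp
qed

end

lemma upt_split:
  assumes "1 \<le> j" "j \<le> (n :: nat)"
  shows "[1..<Suc n] = [1..<j] @ j # [Suc j..<Suc n]"
proof -
  have "[1..<Suc n] = [1..<j] @ [j..<Suc n]"
    using assms by (metis le_Suc_ex le_SucI upt_add_eq_append)
  then show ?thesis using assms by (simp add: upt_conv_Cons)
qed

context spin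
begin

subsection \<open>The subalgebra generated by the \<open>p\<close> and the \<open>q\<close>\<close>

lemma commute_power:
  assumes "a \<in> C" "x \<in> C" "a * x \<approx> x * a"
  shows "a * x ^ k \<approx> x ^ k * a"
proof (induction k)
  case 0
  show ?case using assms by (simp add: eqv_refl)
next
  case (Suc k)
  have "a * x * x ^ k \<approx> x * a * x ^ k"
    by (intro eqv_rmult assms C_power)
  also have "x * a * x ^ k = x * (a * x ^ k)" by (simp add: mult.assoc)
  also have "\<dots> \<approx> x * (x ^ k * a)"
    by (intro eqv_lmult assms Suc)
  finally show ?case by (simp add: mult.assoc)
qed

text \<open>
  Partial products of \<open>p_mon\<close> and \<open>q_mon\<close>, used to cut these at one index.
\<close>

definition p_factors :: "(nat \<Rightarrow>\<^sub>0 nat) \<Rightarrow> nat list \<Rightarrow> falg"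
  where "p_factors m is = prod_list (map (\<lambda>i. p i ^ Poly_Mapping.lookup m i) is)"

definition q_factors :: "nat set \<Rightarrow> nat list \<Rightarrow> falg"
  where "q_factors S is = prod_list (map (\<lambda>i. if i \<in> S then q i else 1) is)"

lemma C_p_factors: "set is \<subseteq> {1..n} \<Longrightarrow> p_factors m is \<in> C"
  unfolding p_factors_def by (rule C_prod_list) (auto intro!: C_power C_p)

lemma C_q_factors: "set is \<subseteq> {1..n} \<Longrightarrow> q_factors S is \<in> C"
  unfolding q_factors_def by (rule C_prod_list) (auto intro!: C_q C_intros)

lemma p_p_factors:
  assumes j: "1 \<le> j" "j \<le> n" and "set is \<subseteq> {1..n}"
  shows "p j * p_factors m is \<approx> p_factors m is * p j"
  unfolding p_factors_def
proof (rule commute_exactly_prod_list)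
  show "p j \<in> C" by (rule C_p[OF j])
  fix i assume "i \<in> set is"
  then have i: "1 \<le> i" "i \<le> n" using assms by auto
  show "p i ^ Poly_Mapping.lookup m i \<in> C \<and>
      p j * p i ^ Poly_Mapping.lookup m i \<approx> p i ^ Poly_Mapping.lookup m i * p j"
    by (intro conjI C_power commute_power C_p i j rel_p_p)
qed

lemma q_p_factors:
  assumes j: "1 \<le> j" "j \<le> n" and "set is \<subseteq> {1..n}"
  shows "q j * p_factors m is \<approx> p_factors m is * q j"
  unfolding p_factors_def
proof (rule commute_exactly_prod_list)
  show "q j \<in> C" by (rule C_q[OF j])
  fix i assume "i \<in> set is"
  then have i: "1 \<le> i" "i \<le> n" using assms by auto
  show "p i ^ Poly_Mapping.lookup m i \<in> C \<and>
      q j * p i ^ Poly_Mapping.lookup m i \<approx> p i ^ Poly_Mapping.lookup m i * q j"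
    by (intro conjI C_power commute_power C_p C_q i j eqv_sym[OF rel_pq])
qed

lemma p_q_factors:
  assumes j: "1 \<le> j" "j \<le> n" and "set is \<subseteq> {1..n}"
  shows "p j * q_factors S is \<approx> q_factors S is * p j"
  unfolding q_factors_def
proof (rule commute_exactly_prod_list)
  show "p j \<in> C" by (rule C_p[OF j])
  fix i assume "i \<in> set is"
  then have i: "1 \<le> i" "i \<le> n" using assms by auto
  show "(if i \<in> S then q i else 1) \<in> C \<and> p j * (if i \<in> S then q i else 1) \<approx> (if i \<in> S then q i else 1) * p j"
    using C_q[OF i] C_p[OF j] rel_pq[OF j i] by (simp add: C_intros eqv_refl)
qed

lemma q_q_factors:
  assumes j: "1 \<le> j" "j \<le> n" and "set is \<subseteq> {1..n}" "j \<notin> set is"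
  shows "\<exists>c. q j * q_factors S is \<approx> scalar c * (q_factors S is * q j)"
  unfolding q_factors_def
proof (rule commute_prod_list)
  show "q j \<in> C" by (rule C_q[OF j])
  fix i assume "i \<in> set is"
  then have i: "1 \<le> i" "i \<le> n" "j \<noteq> i" using assms by auto
  have "\<exists>c. q j * (if i \<in> S then q i else 1) \<approx> scalar c * ((if i \<in> S then q i else 1) * q j)"
  proof (cases "i \<in> S")
    case True
    then show ?thesis
      using rel_q_q[OF j i] by (intro exI[of _ "- 1"]) (simp add: scalar_minus_one)
  next
    case False
    then show ?thesis
      using C_q[OF j] by (intro exI[of _ 1]) (simp add: scalar_1 eqv_refl)
  qed
  then show "(if i \<in> S then q i else 1) \<in> C \<and>
      (\<exists>c. q j * (if i \<in> S then q i else 1) \<approx> scalar c * ((if i \<in> S then q i else 1) * q j))"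
    using C_q[OF i(1,2)] by (simp add: C_intros)
qed

definition pq_mons :: "falg set"
  where "pq_mons = {p_mon m * q_mon S | m S. Poly_Mapping.keys m \<subseteq> {1..n} \<and> S \<subseteq> {1..n}}"

lemma pq_mons_C: "b \<in> pq_mons \<Longrightarrow> b \<in> C"
  by (auto simp: pq_mons_def intro!: C_intros C_p_mon C_q_mon)

lemma p_mon_split:
  assumes "1 \<le> j" "j \<le> n"
  shows "p_mon m = p_factors m [1..<j] * (p j ^ Poly_Mapping.lookup m j * p_factors m [Suc j..<Suc n])"
  unfolding p_mon_def p_factors_def by (subst upt_split[OF assms]) simp

lemma q_mon_split:
  assumes "1 \<le> j" "j \<le> n"
  shows "q_mon S = q_factors S [1..<j] * ((if j \<in> S then q j else 1) * q_factors S [Suc j..<Suc n])"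
  unfolding q_mon_def q_factors_def by (subst upt_split[OF assms]) simp

lemma p_factors_cong: "(\<And>i. i \<in> set is \<Longrightarrow> Poly_Mapping.lookup m i = Poly_Mapping.lookup m' i) \<Longrightarrow> p_factors m is = p_factors m' is"
  unfolding p_factors_def by (intro arg_cong[of _ _ prod_list] map_cong) auto

lemma q_factors_cong: "(\<And>i. i \<in> set is \<Longrightarrow> i \<in> S \<longleftrightarrow> i \<in> S') \<Longrightarrow> q_factors S is = q_factors S' is"
  unfolding q_factors_def by (intro arg_cong[of _ _ prod_list] map_cong) auto

lemma p_p_mon: "1 \<le> j \<Longrightarrow> j \<le> n \<Longrightarrow> p j * p_mon m \<approx> p_mon m * p j"
  and q_p_mon: "1 \<le> j \<Longrightarrow> j \<le> n \<Longrightarrow> q j * p_mon m \<approx> p_mon m * q j"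
  unfolding p_mon_def p_factors_def[symmetric] by (rule p_p_factors q_p_factors; auto)+

lemma p_pq_mons:
  assumes j: "1 \<le> j" "j \<le> n" and b: "b \<in> pq_mons"
  shows "p j * b \<in> combs pq_mons"
proof -
  obtain m S where m: "Poly_Mapping.keys m \<subseteq> {1..n}" "S \<subseteq> {1..n}" and b: "b = p_mon m * q_mon S"
    using b by (auto simp: pq_mons_def)
  let ?m = "m + Poly_Mapping.single j 1"
  let ?A = "p_factors m [1..<j]" and ?B = "p j ^ Poly_Mapping.lookup m j * p_factors m [Suc j..<Suc n]"
  have C: "?A \<in> C" "?B \<in> C" "p j \<in> C"
    using j by (auto intro!: C_p_factors C_intros C_power C_p)
  have A: "p_factors ?m [1..<j] = ?A" "p_factors ?m [Suc j..<Suc n] = p_factors m [Suc j..<Suc n]"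
    by (rule p_factors_cong; auto simp: lookup_add lookup_single when_def)+
  have "p j * ?A * ?B \<approx> ?A * p j * ?B"
    using j by (intro eqv_rmult p_p_factors C) auto
  also have "?A * p j * ?B = p_mon ?m"
    unfolding p_mon_split[OF j, of ?m] A by (simp add: lookup_add mult.assoc)
  finally have "p j * p_mon m \<approx> p_mon ?m"
    unfolding p_mon_split[OF j, of m] by (simp add: mult.assoc)
  then have "p j * b \<approx> p_mon ?m * q_mon S"
    unfolding b mult.assoc[symmetric] by (rule eqv_rmult[OF C_q_mon])
  moreover have "p_mon ?m * q_mon S \<in> pq_mons"
    using m j Poly_Mapping.keys_add[of m "Poly_Mapping.single j 1"] unfolding pq_mons_def by fastforce
  ultimately show ?thesis
    using combs_eqv combs_base pq_mons_C by blast
qed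

text \<open>
  The new \<open>q j\<close> travels to its place in the product. If \<open>j \<in> S\<close> it meets another \<open>q j\<close>, and
  \<open>q j * q j\<close> becomes \<open>1 - p j * p j\<close>, which travels back to the left.
\<close>

lemma q_pq_mons:
  assumes j: "1 \<le> j" "j \<le> n" and b: "b \<in> pq_mons"
  shows "q j * b \<in> combs pq_mons"
proof -
  obtain m S where m: "Poly_Mapping.keys m \<subseteq> {1..n}" "S \<subseteq> {1..n}" and b: "b = p_mon m * q_mon S"
    using b by (auto simp: pq_mons_def)
  let ?A = "q_factors S [1..<j]" and ?B = "q_factors S [Suc j..<Suc n]" and ?x = "if j \<in> S then q j else 1"
  have C: "?A \<in> C" "?B \<in> C" "p j \<in> C" "q j \<in> C" "?x \<in> C" "p_mon m \<in> C"
    using j by (auto intro!: C_q_factors C_intros C_p C_q C_p_mon)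
  have "set [1..<j] \<subseteq> {1..n}" "j \<notin> set [1..<j]"
    using j by auto
  then obtain c where c: "q j * ?A \<approx> scalar c * (?A * q j)"
    using q_q_factors[OF j] by blast
  have "q j * p_mon m * q_mon S \<approx> p_mon m * q j * q_mon S"
    by (intro eqv_rmult C_q_mon q_p_mon j)
  also have "p_mon m * q j * q_mon S = p_mon m * (q j * ?A * (?x * ?B))"
    unfolding q_mon_split[OF j, of S] by (simp add: mult.assoc)
  also have "\<dots> \<approx> p_mon m * (scalar c * (?A * q j) * (?x * ?B))"
    by (intro eqv_lmult eqv_rmult c C C_intros)
  also have "\<dots> = scalar c * (p_mon m * (?A * (q j * ?x) * ?B))"
    by (simp add: scalar_left_commute mult.assoc)
  finally have *: "q j * b \<approx> scalar c * (p_mon m * (?A * (q j * ?x) * ?B))"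
    by (simp add: b mult.assoc)
  have "p_mon m * (?A * (q j * ?x) * ?B) \<in> combs pq_mons"
  proof (cases "j \<in> S")
    case False
    have "q_factors (insert j S) [1..<j] = ?A" "q_factors (insert j S) [Suc j..<Suc n] = ?B"
      by (rule q_factors_cong; auto)+
    then have "p_mon m * (?A * (q j * ?x) * ?B) = p_mon m * q_mon (insert j S)"
      using False by (simp add: q_mon_split[OF j, of "insert j S"] mult.assoc)
    moreover have "p_mon m * q_mon (insert j S) \<in> pq_mons"
      using m j unfolding pq_mons_def by (intro CollectI exI[of _ m] exI[of _ "insert j S"]) auto
    ultimately show ?thesis using pq_mons_C by (simp add: combs_base)
  next
    case True
    let ?S = "S - {j}"
    have "q_factors ?S [1..<j] = ?A" "q_factors ?S [Suc j..<Suc n] = ?B"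
      by (rule q_factors_cong; auto)+
    then have AB: "?A * ?B = q_mon ?S"
      by (simp add: q_mon_split[OF j, of ?S])
    have base: "p_mon m * q_mon ?S \<in> pq_mons"
      using m unfolding pq_mons_def by blast
    have p_op: "p j * x \<in> combs pq_mons" if "x \<in> combs pq_mons" for x
      by (rule combs_lmult[OF that C(3) p_pq_mons[OF j]])
    have Ap: "?A * (p j * p j) \<approx> p j * p j * ?A"
    proof -
      have "p j * ?A \<approx> ?A * p j" using j by (intro p_q_factors) auto
      from commute_power[OF C(3,1) this, of 1]
      have "?A * p j * p j \<approx> p j * ?A * p j" "p j * (?A * p j) \<approx> p j * (p j * ?A)"
        by (auto intro!: eqv_rmult eqv_lmult C simp: eqv_sym)
      then show ?thesis by (auto simp: mult.assoc intro: eqv_trans)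
    qed
    have pm: "p_mon m * (p j * p j) \<approx> p j * p j * p_mon m"
    proof -
      have "p j * p_mon m \<approx> p_mon m * p j"
        by (intro p_p_mon j)
      then have "p_mon m * p j * p j \<approx> p j * p_mon m * p j" "p j * (p_mon m * p j) \<approx> p j * (p j * p_mon m)"
        by (auto intro!: eqv_rmult eqv_lmult C simp: eqv_sym)
      then show ?thesis by (auto simp: mult.assoc intro: eqv_trans)
    qed
    have "p_mon m * (?A * (q j * q j) * ?B) \<approx> p_mon m * (?A * (1 - p j * p j) * ?B)"
      by (intro eqv_lmult eqv_rmult C rel_sq j)
    also have "\<dots> = p_mon m * q_mon ?S - p_mon m * (?A * (p j * p j)) * ?B"
      by (simp add: AB[symmetric] left_diff_distrib right_diff_distrib mult.assoc)
    also have "\<dots> \<approx> p_mon m * q_mon ?S - p_mon m * (p j * p j * ?A) * ?B"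
      by (intro eqv_diff eqv_refl eqv_lmult eqv_rmult Ap C C_intros C_q_mon)
    also have "\<dots> = p_mon m * q_mon ?S - p_mon m * (p j * p j) * q_mon ?S"
      by (simp add: AB[symmetric] mult.assoc)
    also have "\<dots> \<approx> p_mon m * q_mon ?S - p j * p j * p_mon m * q_mon ?S"
      by (intro eqv_diff eqv_refl eqv_rmult pm C C_intros C_q_mon)
    also have "\<dots> = p_mon m * q_mon ?S - p j * (p j * (p_mon m * q_mon ?S))"
      by (simp add: mult.assoc)
    finally have "p_mon m * (?A * (q j * ?x) * ?B) \<approx> p_mon m * q_mon ?S - p j * (p j * (p_mon m * q_mon ?S))"
      using True by simp
    then show ?thesis
      by (rule combs_eqv[rotated]) (intro combs_diff p_op combs_base base pq_mons_C)
  qed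
  then show ?thesis
    using * combs_eqv combs_scalar by blast
qed

definition pq_gens :: "falg set"
  where "pq_gens = p ` {1..n} \<union> q ` {1..n}"

lemma pq_gens_C: "x \<in> pq_gens \<Longrightarrow> x \<in> C"
  by (auto simp: pq_gens_def intro!: C_p C_q)

lemma pq_mons_span:
  assumes "set xs \<subseteq> pq_gens"
  shows "prod_list xs \<in> combs pq_mons"
  using assms
proof (induction xs)
  case Nil
  have "p_mon 0 = 1" "q_mon {} = 1"
    by (simp_all add: p_mon_def q_mon_def prod_list_replicate map_replicate_const)
  then have "1 \<in> pq_mons" unfolding pq_mons_def by (auto intro!: exI[of _ 0] exI[of _ "{}"])
  then show ?case by (simp add: combs_base pq_mons_C)
next
  case (Cons x xs)
  then have x: "x \<in> pq_gens" and IH: "prod_list xs \<in> combs pq_mons" by auto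
  have "x * b \<in> combs pq_mons" if "b \<in> pq_mons" for b
    using x that by (auto simp: pq_gens_def intro: p_pq_mons q_pq_mons)
  then show ?case
    using combs_lmult[OF IH pq_gens_C[OF x]] by simp
qed


subsection \<open>Moving the \<open>R\<close> to the right\<close>

definition split_words :: "falg set"
  where "split_words = {prod_list xs * R_word w | xs w. set xs \<subseteq> pq_gens \<and> set w \<subseteq> {1..<n}}"

lemma split_words_C:
  assumes "b \<in> split_words"
  shows "b \<in> C"
proof -
  obtain xs w where b: "b = prod_list xs * R_word w" and xs: "set xs \<subseteq> pq_gens" and w: "set w \<subseteq> {1..<n}"
    using assms by (auto simp: split_words_def)
  have "prod_list xs \<in> C"
    by (rule C_prod_list) (use xs pq_gens_C in auto)
  then show ?thesis
    unfolding b by (intro C_intros C_R_word w)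
qed

lemma pq_gens_split_words:
  assumes "y \<in> pq_gens" "x \<in> combs split_words"
  shows "y * x \<in> combs split_words"
proof (rule combs_lmult[OF assms(2) pq_gens_C[OF assms(1)]])
  fix b assume "b \<in> split_words"
  then obtain xs w where "b = prod_list xs * R_word w" "set xs \<subseteq> pq_gens" "set w \<subseteq> {1..<n}"
    by (auto simp: split_words_def)
  then have "y * b = prod_list (y # xs) * R_word w" "set (y # xs) \<subseteq> pq_gens" "set w \<subseteq> {1..<n}"
    using assms by (auto simp: mult.assoc)
  then have "y * b \<in> split_words" unfolding split_words_def by blast
  then show "y * b \<in> combs split_words" by (simp add: combs_base split_words_C)
qed

lemma R_pq_gens:
  assumes j: "1 \<le> j" "j < n" and y: "y \<in> pq_gens"
  shows "\<exists>y' c v. y' \<in> pq_gens \<and> v \<in> combs pq_gens \<and> R j * y \<approx> scalar c * (y' * R j) + v"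
proof -
  have base: "x \<in> combs pq_gens" if "x \<in> pq_gens" for x
    using that by (simp add: combs_base pq_gens_C)
  have P: "p i \<in> pq_gens" and Q: "q i \<in> pq_gens" if "1 \<le> i" "i \<le> n" for i
    using that by (auto simp: pq_gens_def)
  have u: "scalar c * (q j - q (Suc j)) \<in> combs pq_gens" and v: "scalar c * (p j + p (Suc j)) \<in> combs pq_gens" for c
    by (intro combs_scalar combs_diff combs_add base P Q; use j in simp)+
  from y consider i where "y = p i" "1 \<le> i" "i \<le> n" | i where "y = q i" "1 \<le> i" "i \<le> n"
    by (auto simp: pq_gens_def)
  then show ?thesis
  proof cases
    case (1 i)
    consider "i = j" | "i = Suc j" | "i \<noteq> j" "i \<noteq> Suc j" by blast
    then show ?thesis
    proof cases
      case a: 1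
      show ?thesis
        using rel_Rp[OF j] u[of eps] P[of "Suc j"] j unfolding 1 a
        by (intro exI[of _ "p (Suc j)"] exI[of _ 1] exI[of _ "scalar eps * (q j - q (Suc j))"])
          (auto simp: scalar_1)
    next
      case a: 2
      show ?thesis
        using rel_Rp_next[OF j] combs_uminus[OF u[of eps]] P[of j] j unfolding 1 a
        by (intro exI[of _ "p j"] exI[of _ 1] exI[of _ "- (scalar eps * (q j - q (Suc j)))"])
          (auto simp: scalar_1)
    next
      case a: 3
      show ?thesis
        using rel_Rp_far[OF j 1(2,3) a] P[OF 1(2,3)] combs_0 unfolding 1
        by (intro exI[of _ "p i"] exI[of _ 1] exI[of _ 0]) (auto simp: scalar_1)
    qed
  next
    case (2 i)
    consider "i = j" | "i = Suc j" | "i \<noteq> j" "i \<noteq> Suc j" by blast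
    then show ?thesis
    proof cases
      case a: 1
      show ?thesis
        using rel_Rq[OF j] combs_uminus[OF v[of eps]] Q[of "Suc j"] j unfolding 2 a
        by (intro exI[of _ "q (Suc j)"] exI[of _ "- 1"] exI[of _ "- (scalar eps * (p j + p (Suc j)))"])
          (auto simp: scalar_minus_one)
    next
      case a: 2
      show ?thesis
        using rel_Rq_next[OF j] combs_uminus[OF v[of eps]] Q[of j] j unfolding 2 a
        by (intro exI[of _ "q j"] exI[of _ "- 1"] exI[of _ "- (scalar eps * (p j + p (Suc j)))"])
          (auto simp: scalar_minus_one)
    next
      case a: 3
      show ?thesis
        using rel_Rq_far[OF j 2(2,3) a] Q[OF 2(2,3)] combs_0 unfolding 2
        by (intro exI[of _ "q i"] exI[of _ "- 1"] exI[of _ 0]) (auto simp: scalar_minus_one)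
    qed
  qed
qed

lemma R_split_words:
  assumes j: "1 \<le> j" "j < n" and x: "x \<in> combs split_words"
  shows "R j * x \<in> combs split_words"
proof (rule combs_lmult[OF x C_R[OF j]])
  have *: "R j * (prod_list xs * R_word w) \<in> combs split_words" if "set xs \<subseteq> pq_gens" "set w \<subseteq> {1..<n}" for xs w
    using that(1)
  proof (induction xs)
    case Nil
    have "R j * R_word w = prod_list [] * R_word (j # w)" "set (j # w) \<subseteq> {1..<n}"
      using j that(2) by auto
    then have "R j * R_word w \<in> split_words" unfolding split_words_def by fastforce
    then show ?case by (simp add: combs_base split_words_C)
  next
    case (Cons y xs)
    let ?X = "prod_list xs * R_word w"
    have X: "?X \<in> split_words" using Cons that by (auto simp: split_words_def)
    obtain y' c v where *: "y' \<in> pq_gens" "v \<in> combs pq_gens" "R j * y \<approx> scalar c * (y' * R j) + v"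
      using R_pq_gens[OF j, of y] Cons by auto
    have "R j * y * ?X \<approx> (scalar c * (y' * R j) + v) * ?X"
      by (rule eqv_rmult[OF split_words_C[OF X] *(3)])
    also have "\<dots> = scalar c * (y' * (R j * ?X)) + v * ?X"
      by (simp add: distrib_right mult.assoc)
    finally have "R j * (prod_list (y # xs) * R_word w) \<approx> scalar c * (y' * (R j * ?X)) + v * ?X"
      by (simp add: mult.assoc)
    moreover have "v * ?X \<in> combs split_words"
      by (rule combs_rmult[OF *(2) split_words_C[OF X]]) (intro pq_gens_split_words combs_base X split_words_C)
    moreover have "y' * (R j * ?X) \<in> combs split_words"
      by (rule pq_gens_split_words[OF *(1) Cons.IH]) (use Cons.prems in auto)
    ultimately show ?case
      using combs_eqv combs_add combs_scalar by blast
  qed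
  fix b assume "b \<in> split_words"
  then show "R j * b \<in> combs split_words"
    using * by (auto simp: split_words_def)
qed

lemma single_Word: "Poly_Mapping.single (Word xs) 1 = prod_list (map gen xs)"
proof (induction xs)
  case Nil
  show ?case using single_one by (simp flip: zero_word_def)
next
  case (Cons x xs)
  have "Poly_Mapping.single (Word (x # xs)) (1 :: Cq) = gen x * Poly_Mapping.single (Word xs) 1"
    by (simp add: gen_def mult_single plus_word_def)
  then show ?case by (simp add: Cons)
qed

text \<open>
  The words are restricted to those of \<open>f\<close>, so that properties such as evenness of all words
  of \<open>f\<close> remain available in the induction.
\<close>

lemma C_induct [consumes 1, case_names zero add word]:
  assumes "f \<in> C" "Q 0" "\<And>f g. Q f \<Longrightarrow> Q g \<Longrightarrow> Q (f + g)"
    and word: "\<And>w c. w \<in> Poly_Mapping.keys f \<Longrightarrow> set (letters w) \<subseteq> gens n \<Longrightarrow> Q (scalar c * prod_list (map gen (letters w)))"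
  shows "Q f"
proof -
  have "Q (\<Sum>w\<in>F. Poly_Mapping.single w (Poly_Mapping.lookup f w))"
    if "finite F" "F \<subseteq> Poly_Mapping.keys f" for F
    using that
  proof (induction F)
    case (insert w F)
    have "Poly_Mapping.single w c = scalar c * prod_list (map gen (letters w))" for c
      by (simp add: scalar_def mult_single flip: single_Word)
    moreover have "set (letters w) \<subseteq> gens n"
      using insert.prems assms(1) by (auto simp: free_alg_def)
    ultimately have "Q (Poly_Mapping.single w (Poly_Mapping.lookup f w))"
      using word insert.prems by simp
    then show ?case using insert assms(3) by simp
  qed (simp add: assms)
  then show ?thesis
    by (subst poly_mapping_sum_single) simp
qed

lemma gens_cases:
  assumes "x \<in> gens n"
  obtains (R) i where "gen x = R i" "1 \<le> i" "i < n" | (pq_gens) "gen x \<in> pq_gens"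
  using assms by (auto simp: gens_def pq_gens_def)

lemma split_words_span: "f \<in> C \<Longrightarrow> f \<in> combs split_words"
proof (induction rule: C_induct)
  case (word w c)
  have "prod_list (map gen xs) \<in> combs split_words" if "set xs \<subseteq> gens n" for xs
    using that
  proof (induction xs)
    case Nil
    have "prod_list [] * R_word [] \<in> split_words" unfolding split_words_def by fastforce
    then show ?case by (simp add: combs_base split_words_C)
  next
    case (Cons x xs)
    then have "x \<in> gens n" and IH: "prod_list (map gen xs) \<in> combs split_words" by auto
    from this(1) show ?case
      by (cases rule: gens_cases) (simp_all add: R_split_words pq_gens_split_words IH)
  qed
  then show ?case using word by (intro combs_scalar) simp
qed (auto intro: combs_0 combs_add)

definition normal_words :: "falg set"
  where "normal_words = {p_mon m * q_mon S * coset_word n t | m S t. Poly_Mapping.keys m \<subseteq> {1..n} \<and> S \<subseteq> {1..n} \<and> t \<in> cosets n}"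

lemma normal_words_span:
  assumes "f \<in> C"
  shows "f \<in> combs normal_words"
proof -
  have "1 * f * 1 \<in> combs normal_words"
  proof (rule combs_mult[OF split_words_span[OF assms] free_alg_subset_one free_alg_subset_one])
    fix b assume "b \<in> split_words"
    then obtain xs w where b: "b = prod_list xs * R_word w" and xs: "set xs \<subseteq> pq_gens" and w: "set w \<subseteq> {1..<n}"
      by (auto simp: split_words_def)
    have "prod_list xs * R_word w \<in> combs normal_words"
    proof (rule combs_rmult[OF pq_mons_span[OF xs] C_R_word[OF w]])
      fix c assume c: "c \<in> pq_mons"
      show "c * R_word w \<in> combs normal_words"
      proof (rule combs_lmult[OF coset_words_span[OF w] pq_mons_C[OF c]])
        fix d assume d: "d \<in> coset_words n"
        have "c * d \<in> normal_words"
          using c d by (auto simp: pq_mons_def coset_words_def normal_words_def)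
        then show "c * d \<in> combs normal_words"
          using pq_mons_C[OF c] coset_words_C[OF order_refl d] by (intro combs_base C_intros)
      qed
    qed
    then show "1 * b * 1 \<in> combs normal_words" by (simp add: b)
  qed
  then show ?thesis by simp
qed

definition p_poly :: "mpol \<Rightarrow> falg"
  where "p_poly g = (\<Sum>m\<in>Poly_Mapping.keys g. scalar (Poly_Mapping.lookup g m) * p_mon m)"

lemma p_poly_0: "p_poly 0 = 0"
  by (simp add: p_poly_def)

lemma p_poly_add: "p_poly (f + g) = p_poly f + p_poly g"
  unfolding p_poly_def
  by (rule sum_keys_add[where g = "\<lambda>m c. scalar c * p_mon m"]) (simp_all add: scalar_0 scalar_add distrib_right)

lemma p_poly_single: "p_poly (Poly_Mapping.single m c) = scalar c * p_mon m"
  unfolding p_poly_def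
  by (rule sum_keys_single[where g = "\<lambda>m c. scalar c * p_mon m"]) (simp add: scalar_0)

lemma C_p_poly: "p_poly g \<in> C"
  unfolding p_poly_def by (intro C_sum C_intros C_p_mon)

lemma mpols_add: "f \<in> mpols n \<Longrightarrow> g \<in> mpols n \<Longrightarrow> f + g \<in> mpols n"
  using Poly_Mapping.keys_add[of f g] unfolding mpols_def by blast

text \<open>
  The coefficients of the powers of the \<open>p\<close> are collected into polynomials, because it is
  polynomials that will be recovered from their values at the weights.
\<close>

lemma normal_form:
  assumes "f \<in> C"
  shows "\<exists>a. (\<forall>S t. a S t \<in> mpols n) \<and> f \<approx> (\<Sum>t\<in>cosets n. \<Sum>S\<in>Pow {1..n}. p_poly (a S t) * q_mon S * coset_word n t)"
  using normal_words_span[OF assms]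
proof induction
  case (zero x)
  then show ?case by (intro exI[of _ "\<lambda>_ _. 0"]) (simp add: p_poly_0 mpols_def)
next
  case (step b x y c)
  let ?E = "\<lambda>a. \<Sum>t\<in>cosets n. \<Sum>S\<in>Pow {1..n}. p_poly (a S t) * q_mon S * coset_word n t"
  obtain m S0 t0 where b: "b = p_mon m * q_mon S0 * coset_word n t0"
    and m: "Poly_Mapping.keys m \<subseteq> {1..n}" and S0: "S0 \<in> Pow {1..n}" and t0: "t0 \<in> cosets n"
    using step.hyps(1) by (auto simp: normal_words_def)
  obtain a where a: "\<And>S t. a S t \<in> mpols n" and x: "x \<approx> ?E a"
    using step.IH by auto
  define g where "g = Poly_Mapping.single m c"
  define a' where "a' S t = a S t + (if t = t0 then if S = S0 then g else 0 else 0)" for S t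
  have "g \<in> mpols n" using m by (simp add: g_def mpols_def)
  then have "a' S t \<in> mpols n" for S t
    using a by (auto simp: a'_def intro!: mpols_add)
  moreover have "?E a' = ?E a + scalar c * b"
  proof -
    have "p_poly (a' S t) * q_mon S * coset_word n t = p_poly (a S t) * q_mon S * coset_word n t
        + (if t = t0 then if S = S0 then p_poly g * q_mon S0 * coset_word n t0 else 0 else 0)" for S t
      by (simp add: a'_def p_poly_add p_poly_0 distrib_right)
    then have "?E a' = ?E a + (\<Sum>t\<in>cosets n. if t = t0 then (\<Sum>S\<in>Pow {1..n}. if S = S0 then p_poly g * q_mon S0 * coset_word n t0 else 0) else 0)"
      by (simp add: sum.distrib) (rule sum.cong; simp)
    also have "\<dots> = ?E a + p_poly g * q_mon S0 * coset_word n t0"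
      using S0 t0 by (simp add: finite_cosets)
    finally show ?thesis by (simp add: g_def p_poly_single b mult.assoc)
  qed
  moreover have "y \<approx> ?E a + scalar c * b"
  proof -
    have "scalar c * b + x \<approx> scalar c * b + ?E a"
      using step.hyps(3) S0 t0 by (intro eqv_add x eqv_refl)
        (simp add: b C_intros C_p_mon C_q_mon C_coset_word)
    then show ?thesis using step.hyps(3) eqv_trans by (simp add: add.commute)
  qed
  ultimately show ?case by (intro exI[of _ a']) simp
qed

end

context weights
begin

section \<open>Linear independence of the normal forms\<close>

text \<open>
  The action of \<open>theta i\<close> on the Fock space over a single labelling.
\<close>

definition fock_theta :: "nat \<Rightarrow> (nat set \<Rightarrow> Cq) \<Rightarrow> nat set \<Rightarrow> Cq"
  where "fock_theta i h T = sgn_below (2 * i + 1) T * h (toggle (2 * i + 1) T) - sgn_below (2 * i + 3) T * h (toggle (2 * i + 3) T)"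

lemma app_theta: "app (theta i) f (x, T) = fock_theta i (\<lambda>U. f (x, U)) T"
  by (simp add: theta_def c_op_def fock_theta_def numeral_eq_Suc)

lemma fock_theta_fock_theta: "fock_theta i (fock_theta i h) T = 2 * h T"
proof -
  have "app (theta i * theta i) (\<lambda>(y, U). h U) (id_lab, T) = fock_theta i (fock_theta i h) T"
    by (simp add: app_theta)
  moreover have "app (theta i * theta i) (\<lambda>(y, U). h U) (id_lab, T) = 2 * h T"
    unfolding theta_sq one_add_one[symmetric] app_ring by (simp only: mult_2 split_conv one_add_one)
  ultimately show ?thesis by simp
qed

lemma fock_theta_scale: "fock_theta i (\<lambda>U. c * h U) T = c * fock_theta i h T"
  by (simp add: fock_theta_def algebra_simps)

lemma R_op_zero:
  assumes "\<And>T. g (x, T) = 0" "\<And>T. g (swap_lab i x, T) = 0"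
  shows "app (R_op i) g (x, T) = 0"
  using assms by (simp add: R_op_def phi_def phi_factor_def theta_def c_op_def pole_def q_op_def)

text \<open>
  Where the function vanishes at \<open>x\<close> the pole contributes nothing, and on ascending labels the
  intertwiner has the factor 1.
\<close>

lemma R_op_lead:
  assumes "lab x i < lab x (Suc i)" "\<And>T. g (x, T) = 0"
  shows "app (R_op i) g (x, T) = fock_theta i (\<lambda>U. g (swap_lab i x, U)) T"
  using assms by (simp add: R_op_def phi_def phi_factor_def app_theta pole_def q_op_def)

text \<open>
  A product of the \<open>R\<close> connects a labelling only to those reached by the swaps that occur in it.
\<close>

lemma R_word_zero:
  assumes "\<And>y i. y \<in> Z \<Longrightarrow> i \<in> set w \<Longrightarrow> swap_lab i y \<in> Z"
    and "\<And>y T. y \<in> Z \<Longrightarrow> g (y, T) = 0" and "x \<in> Z"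
  shows "app (rho (R_word w)) g (x, T) = 0"
  using assms(1,3)
proof (induction w arbitrary: x T)
  case (Cons i w)
  then show ?case by (auto simp: alg_map_simps intro!: R_op_zero)
qed (simp add: alg_map_simps assms)

lemma R_word_cong:
  assumes "\<And>y i. y \<in> Z \<Longrightarrow> i \<in> set w \<Longrightarrow> swap_lab i y \<in> Z"
    and "\<And>y T. y \<in> Z \<Longrightarrow> g (y, T) = h (y, T)" and "x \<in> Z"
  shows "app (rho (R_word w)) g (x, T) = app (rho (R_word w)) h (x, T)"
  using R_word_zero[of Z w "\<lambda>z. g z - h z" x T] assms by (simp add: app_minus)

lemma descent_Suc_left: "m \<le> k \<Longrightarrow> descent (Suc k) m = R k * descent k m"
  by (simp add: descent_def)

definition top_at :: "nat \<Rightarrow> nat \<Rightarrow> labelling set"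
  where "top_at K k = {x. lab x k = K \<and> (\<forall>i<k. lab x i < K)}"

text \<open>
  Starting at the position \<open>k\<close>, the swaps in \<open>descent k m\<close> carry the label \<open>K\<close> at most as far as
  the position \<open>m\<close>, so a function that requires it further to the left is not seen.
\<close>

lemma descent_far:
  assumes supp: "\<And>y T. lab y j \<noteq> K \<Longrightarrow> g (y, T) = 0" and "j < m" "m \<le> k" and x: "lab x k = K"
  shows "app (rho (descent k m)) g (x, T) = 0"
  unfolding descent_def
proof (rule R_word_zero[where Z = "{y. \<exists>i\<ge>m. lab y i = K}"])
  show "x \<in> {y. \<exists>i\<ge>m. lab y i = K}" using assms by auto
  fix y assume y: "y \<in> {y. \<exists>i\<ge>m. lab y i = K}"
  then obtain i where i: "m \<le> i" "lab y i = K" by auto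
  have "lab y j \<noteq> K" unfolding i(2)[symmetric] using i(1) \<open>j < m\<close> by simp
  then show "g (y, T) = 0" for T
    by (rule supp)
  fix l assume l: "l \<in> set (rev [m..<k])"
  have "lab (swap_lab l y) (transpose l (Suc l) i) = K" using i by simp
  moreover have "m \<le> transpose l (Suc l) i" using i l by (auto simp: transpose_def)
  ultimately show "swap_lab l y \<in> {y. \<exists>i\<ge>m. lab y i = K}" by blast
qed

text \<open>
  The word \<open>descent k j\<close> carries the top label from \<open>k\<close> to \<open>j\<close> through ascending swaps only. Among
  functions that require the label \<open>K\<close> at \<open>j\<close> its lower terms disappear, so it acts as a product of
  the invertible operators \<open>theta i\<close>, and every prescribed result is attained.
\<close>

lemma descent_onto:
  assumes "j \<le> k"
  shows "\<exists>g. (\<forall>y T. lab y j \<noteq> K \<longrightarrow> g (y, T) = 0) \<and> (\<forall>x\<in>top_at K k. \<forall>T. app (rho (descent k j)) g (x, T) = h (x, T))"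
  using assms
proof (induction k arbitrary: h rule: dec_induct)
  case base
  show ?case
    by (rule exI[of _ "\<lambda>(y, T). if lab y j = K then h (y, T) else 0"]) (auto simp: alg_map_simps top_at_def)
next
  case (step k)
  define h' where "h' = (\<lambda>(y, U). 1 / 2 * fock_theta k (\<lambda>V. h (swap_lab k y, V)) U)"
  obtain g where supp: "\<And>y T. lab y j \<noteq> K \<Longrightarrow> g (y, T) = 0"
    and g: "\<And>x T. x \<in> top_at K k \<Longrightarrow> app (rho (descent k j)) g (x, T) = h' (x, T)"
    using step.IH[of h'] by blast
  have "app (rho (descent (Suc k) j)) g (x, T) = h (x, T)" if x: "x \<in> top_at K (Suc k)" for x T
  proof -
    have xK: "lab x (Suc k) = K" using x by (simp add: top_at_def)
    have z: "app (rho (descent k j)) g (x, T) = 0" for T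
      unfolding descent_def
    proof (rule R_word_zero[where Z = "{y. lab y (Suc k) = K}"])
      show "x \<in> {y. lab y (Suc k) = K}" using xK by simp
      fix y assume y: "y \<in> {y. lab y (Suc k) = K}"
      then have yK: "lab y (Suc k) = K" by simp
      have "lab y j \<noteq> K" unfolding yK[symmetric] using step.hyps by simp
      then show "g (y, T) = 0" for T by (rule supp)
      fix l assume "l \<in> set (rev [j..<k])"
      then show "swap_lab l y \<in> {y. lab y (Suc k) = K}" using y by (simp add: transpose_def)
    qed
    have s: "swap_lab k x \<in> top_at K k"
      using x by (auto simp: top_at_def transpose_def)
    have "app (rho (descent (Suc k) j)) g (x, T) = app (R_op k) (app (rho (descent k j)) g) (x, T)"
      using step.hyps by (simp add: descent_Suc_left alg_map_simps)
    also have "\<dots> = fock_theta k (\<lambda>U. app (rho (descent k j)) g (swap_lab k x, U)) T"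
      by (rule R_op_lead) (use x z in \<open>auto simp: top_at_def\<close>)
    also have "\<dots> = fock_theta k (\<lambda>U. 1 / 2 * fock_theta k (\<lambda>V. h (x, V)) U) T"
      by (simp add: g s h'_def)
    also have "\<dots> = h (x, T)"
      by (simp only: fock_theta_scale fock_theta_fock_theta) simp
    finally show ?thesis .
  qed
  then show ?case using supp by blast
qed

lemma coset_word_cong_at_id:
  assumes t: "t \<in> cosets k" and eq: "\<And>y T. y \<in> top_at (Suc k) (Suc k) \<Longrightarrow> g (y, T) = h (y, T)"
  shows "app (rho (coset_word k t)) g (id_lab, T) = app (rho (coset_word k t)) h (id_lab, T)"
proof -
  have "\<exists>w. coset_word k t = R_word w \<and> set w \<subseteq> {..<k}"
    unfolding coset_word_def descent_def
  proof (induction k)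
    case (Suc k)
    then obtain w where "prod_list (map (\<lambda>i. R_word (rev [t i..<i])) [1..<Suc k]) = R_word w" "set w \<subseteq> {..<k}" by blast
    then show ?case by (intro exI[of _ "w @ rev [t (Suc k)..<Suc k]"]) auto
  qed (auto intro: exI[of _ "[]"])
  then obtain w where w: "coset_word k t = R_word w" "set w \<subseteq> {..<k}" by blast
  show ?thesis
    unfolding w(1)
  proof (rule R_word_cong[where Z = "top_at (Suc k) (Suc k)"])
    show "id_lab \<in> top_at (Suc k) (Suc k)" by (simp add: top_at_def)
    fix y i assume "y \<in> top_at (Suc k) (Suc k)" "i \<in> set w"
    then show "swap_lab i y \<in> top_at (Suc k) (Suc k)"
      using w(2) by (auto simp: top_at_def transpose_def)
  qed (rule eq)
qed

text \<open>
  Linear independence of the words \<open>D\<^sub>t\<close>, in the row of the labelling \<open>id\<close> and with arbitrary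
  coefficients \<open>b t\<close> that vanish at 0. In the step from \<open>k\<close> to \<open>k + 1\<close> the
  position \<open>j\<close> of the label \<open>k + 1\<close> is treated in increasing order: functions that require this
  label at \<open>j\<close> are invisible to the words that carry it less far, the words that carry it further
  have been dealt with, and what remains is an arbitrary relation between the words for \<open>k\<close>.
\<close>

lemma coset_word_independent:
  assumes "\<And>t. b t (\<lambda>T. 0) = (0 :: Cq)"
    and "\<And>g. (\<Sum>t\<in>cosets k. b t (\<lambda>T. app (rho (coset_word k t)) g (id_lab, T))) = 0"
    and "t \<in> cosets k"
  shows "b t h = 0"
  using assms
proof (induction k arbitrary: b t h)
  case 0
  then show ?case
    using 0(2)[of "\<lambda>(y, T). h T"] by (simp add: cosets_0 coset_word_def alg_map_simps)
next
  case (Suc k)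
  let ?K = "Suc k"
  define c where "c j t = b (t(?K := j))" for j t
  have sum: "(\<Sum>t\<in>cosets k. \<Sum>j\<in>{1..?K}. c j t (\<lambda>T. app (rho (coset_word k t)) (app (rho (descent ?K j)) g) (id_lab, T))) = 0" for g
  proof -
    have "(\<Sum>t\<in>cosets ?K. b t (\<lambda>T. app (rho (coset_word ?K t)) g (id_lab, T)))
      = (\<Sum>(t, j)\<in>cosets k \<times> {1..?K}. b (t(?K := j)) (\<lambda>T. app (rho (coset_word ?K (t(?K := j)))) g (id_lab, T)))"
      by (subst sum.reindex_bij_betw[OF cosets_Suc[of k], symmetric]) (simp add: case_prod_beta)
    also have "\<dots> = (\<Sum>(t, j)\<in>cosets k \<times> {1..?K}. c j t (\<lambda>T. app (rho (coset_word k t)) (app (rho (descent ?K j)) g) (id_lab, T)))"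
    proof (rule sum.cong[OF refl])
      fix tj :: "(nat \<Rightarrow> nat) \<times> nat" assume "tj \<in> cosets k \<times> {1..?K}"
      obtain t j where tj: "tj = (t, j)" by (cases tj)
      have "coset_word k (t(?K := j)) = coset_word k t" by (rule coset_word_cong) simp
      then show "(case tj of (t, j) \<Rightarrow> b (t(?K := j)) (\<lambda>T. app (rho (coset_word ?K (t(?K := j)))) g (id_lab, T)))
        = (case tj of (t, j) \<Rightarrow> c j t (\<lambda>T. app (rho (coset_word k t)) (app (rho (descent ?K j)) g) (id_lab, T)))"
        by (simp add: tj c_def coset_word_Suc alg_map_simps)
    qed
    finally show ?thesis
      using Suc.prems(2)[of g] by (simp only: sum.cartesian_product)
  qed
  have c0: "c j t h = 0" if "j \<in> {1..?K}" "t \<in> cosets k" for j t h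
    using that
  proof (induction j arbitrary: t h rule: less_induct)
    case (less j)
    have "(\<Sum>t\<in>cosets k. c j t (\<lambda>T. app (rho (coset_word k t)) h (id_lab, T))) = 0" for h
    proof -
      have j: "j \<le> ?K" using less.prems by simp
      obtain g where supp: "\<And>y T. lab y j \<noteq> ?K \<Longrightarrow> g (y, T) = 0"
        and g: "\<And>x T. x \<in> top_at ?K ?K \<Longrightarrow> app (rho (descent ?K j)) g (x, T) = h (x, T)"
        using descent_onto[OF j, of ?K h] by blast
      have "(\<Sum>i\<in>{1..?K}. c i t (\<lambda>T. app (rho (coset_word k t)) (app (rho (descent ?K i)) g) (id_lab, T)))
        = c j t (\<lambda>T. app (rho (coset_word k t)) h (id_lab, T))" if t: "t \<in> cosets k" for t
      proof -
        have "c i t (\<lambda>T. app (rho (coset_word k t)) (app (rho (descent ?K i)) g) (id_lab, T)) = 0"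
          if i: "i \<in> {1..?K} - {j}" for i
        proof (cases "i < j")
          case True
          then show ?thesis using less.IH[of i] t i by auto
        next
          case False
          have "app (rho (coset_word k t)) (app (rho (descent ?K i)) g) (id_lab, T) = app (rho (coset_word k t)) (\<lambda>z. 0) (id_lab, T)" for T
          proof (rule coset_word_cong_at_id[OF t])
            fix y T assume "y \<in> top_at ?K ?K"
            then show "app (rho (descent ?K i)) g (y, T) = 0"
              using i False by (intro descent_far[of j ?K]) (auto simp: top_at_def supp)
          qed
          then have "(\<lambda>T. app (rho (coset_word k t)) (app (rho (descent ?K i)) g) (id_lab, T)) = (\<lambda>T. 0)"
            by (simp add: app_zero)
          then show ?thesis using Suc.prems(1) by (simp add: c_def)
        qed
        then have "(\<Sum>i\<in>{1..?K}. c i t (\<lambda>T. app (rho (coset_word k t)) (app (rho (descent ?K i)) g) (id_lab, T)))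
          = c j t (\<lambda>T. app (rho (coset_word k t)) (app (rho (descent ?K j)) g) (id_lab, T))"
          using less.prems by (subst sum.remove[of _ j]) (auto simp del: sum.cl_ivl_Suc)
        also have "(\<lambda>T. app (rho (coset_word k t)) (app (rho (descent ?K j)) g) (id_lab, T)) = (\<lambda>T. app (rho (coset_word k t)) h (id_lab, T))"
          by (rule ext, rule coset_word_cong_at_id[OF t]) (rule g)
        finally show ?thesis .
      qed
      then show ?thesis using sum[of g] by (simp del: sum.cl_ivl_Suc)
    qed
    then show ?case
      using Suc.IH[of "c j" t h] less.prems Suc.prems(1) by (simp add: c_def)
  qed
  have t: "t(?K := ?K) \<in> cosets k" "t ?K \<in> {1..?K}"
    using Suc.prems(3) by (auto simp: cosets_def)
  have "c (t ?K) (t(?K := ?K)) h = 0" by (rule c0[OF t(2,1)])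
  then show ?case by (simp add: c_def)
qed

definition vacuum :: "labelling \<times> nat set \<Rightarrow> Cq"
  where "vacuum = (\<lambda>(y, U). if U = {} then 1 else 0)"

definition q_prod :: "nat set \<Rightarrow> nat list \<Rightarrow> op"
  where "q_prod S is = prod_list (map (\<lambda>i. if i \<in> S then q_op i else 1) is)"

lemma q_prod_simps [simp]: "q_prod S [] = 1" "q_prod S (i # is) = (if i \<in> S then q_op i else 1) * q_prod S is"
  by (simp_all add: q_prod_def)

lemma q_prod_local: "(\<And>U. g (x, U) = h (x, U)) \<Longrightarrow> app (q_prod S is) g (x, T) = app (q_prod S is) h (x, T)"
  by (induction "is" arbitrary: T) (simp_all add: q_op_def)

text \<open>
  A product of distinct \<open>q\<close> sends the vacuum to a multiple of one basis vector. The multiple is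
  a sign, because adding a mode to \<open>T\<close> does not involve the square of the generator.
\<close>

lemma q_prod_vacuum:
  assumes "distinct is"
  shows "app (q_prod S is) vacuum (id_lab, T) \<noteq> 0 \<longleftrightarrow> T = (\<lambda>i. 2 * i) ` (S \<inter> set is)"
  using assms
proof (induction "is" arbitrary: T)
  case Nil
  show ?case by (simp add: vacuum_def)
next
  case (Cons i "is")
  have sgn_below: "sgn_below k T \<noteq> 0" for k T by (simp add: sgn_below_def)
  let ?M = "(\<lambda>i. 2 * i) ` (S \<inter> set is)"
  show ?case
  proof (cases "i \<in> S")
    case True
    have "toggle (2 * i) T = ?M \<longleftrightarrow> T = toggle (2 * i) ?M" by (metis toggle_toggle)
    moreover have "2 * i \<notin> ?M" using Cons.prems by auto
    then have "toggle (2 * i) ?M = (\<lambda>i. 2 * i) ` (S \<inter> set (i # is))" "2 * i \<in> toggle (2 * i) ?M"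
      using True by (auto simp: toggle_def)
    ultimately show ?thesis
      using Cons True sgn_below by (auto simp: q_op_def)
  next
    case False
    then show ?thesis using Cons by simp
  qed
qed

end

context spin
begin

lemma rho_p_mon:
  assumes "weights v"
  shows "weights.rho v (p_mon m) = mulx (\<lambda>x. monomial_value n m (\<lambda>i. v (lab x i)))"
proof -
  interpret weights v by fact
  have "prod_list (map (\<lambda>i. p_op i ^ Poly_Mapping.lookup m i) is)
    = mulx (\<lambda>x. \<Prod>i\<leftarrow>is. v (lab x i) ^ Poly_Mapping.lookup m i)" for "is"
  proof (induction "is")
    case (Cons i "is")
    have "p_op i ^ k = mulx (\<lambda>x. v (lab x i) ^ k)" for k
      by (induction k) (simp_all add: mulx_1 p_op_def mulx_mulx)
    then show ?case by (simp add: Cons mulx_mulx)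
  qed (simp add: mulx_1)
  moreover have "(\<Prod>i\<leftarrow>[1..<Suc n]. f i) = (\<Prod>i\<in>{1..n}. f i)" for f :: "nat \<Rightarrow> Cq"
    using prod.distinct_set_conv_list[of "[1..<Suc n]" f]
    by (simp add: atLeastLessThanSuc_atLeastAtMost del: upt_Suc)
  ultimately show ?thesis
    by (simp add: p_mon_def monomial_value_def alg_map_simps comp_def del: upt_Suc)
qed

lemma rho_p_poly:
  assumes "weights v"
  shows "weights.rho v (p_poly g) = mulx (\<lambda>x. poly_value n g (\<lambda>i. v (lab x i)))"
proof (induction g rule: poly_mapping_additive_induct)
  case zero
  show ?case by (simp add: p_poly_0 alg_map_0 poly_value_0 mulx_0)
next
  case (single m c)
  show ?case
    by (simp add: p_poly_single alg_map_simps rho_p_mon[OF assms] poly_value_single lconst_mulx mulx_mulx)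
next
  case (add f g)
  then show ?case by (simp add: p_poly_add alg_map_add poly_value_add mulx_add)
qed

lemma rho_q_mon:
  assumes "weights v"
  shows "weights.rho v (q_mon S) = weights.q_prod v S [1..<Suc n]"
proof -
  interpret weights v by fact
  have "prod_list (map (rho \<circ> (\<lambda>i. if i \<in> S then q i else 1)) is) = q_prod S is" for "is"
    by (induction "is") (simp_all add: alg_map_simps)
  then show ?thesis by (simp only: q_mon_def alg_map_prod_list map_map)
qed

text \<open>
  The annihilator of the module is an ideal that contains the relators.
\<close>

lemma rho_I:
  assumes "weights v" "f \<in> I"
  shows "weights.rho v f = 0"
proof -
  interpret weights v by fact
  let ?K = "{f \<in> C. rho f = 0}"
  have "ideal ?K (free_alg n)"
  proof (rule idealI[OF ring_free_alg])
    have inv: "inv\<^bsub>add_monoid (free_alg n)\<^esub> f = - f" if "f \<in> C" for f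
    proof -
      interpret ring "free_alg n" by (rule ring_free_alg)
      have "\<ominus>\<^bsub>free_alg n\<^esub> f = - f"
        by (rule minus_equality) (use that in \<open>simp_all add: free_alg_ops free_alg_subset_uminus\<close>)
      then show ?thesis by (simp add: a_inv_def)
    qed
    show "subgroup ?K (add_monoid (free_alg n))"
    proof (rule subgroup.intro)
      fix f assume "f \<in> ?K"
      then show "inv\<^bsub>add_monoid (free_alg n)\<^esub> f \<in> ?K"
        by (subst inv) (auto simp: alg_map_simps intro: C_intros)
    qed (auto simp: free_alg_ops alg_map_simps intro: C_intros)
  qed (auto simp: free_alg_ops alg_map_simps intro: C_intros)
  moreover have "relators n \<subseteq> ?K"
    using relators_subset rho_relator by blast
  ultimately have "I \<subseteq> ?K"
    unfolding rel_ideal_def by (rule ring.genideal_minimal[OF ring_free_alg])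
  then show ?thesis using assms(2) by blast
qed

lemma rho_eqv: "weights v \<Longrightarrow> f \<approx> g \<Longrightarrow> weights.rho v f = weights.rho v g"
  using rho_I[of v "f - g"] by (auto simp: eqv_def alg_map_diff)

end

lemma commute_mult:
  fixes x :: "'r :: ring_1"
  assumes "x * a = a * x" "x * b = b * x"
  shows "x * (a * b) = a * b * x"
proof -
  have "x * (a * b) = a * (x * b)" using assms(1) by (simp flip: mult.assoc)
  then show ?thesis using assms(2) by (simp add: mult.assoc)
qed

context weights
begin

text \<open>
  The generator passes the others of the product with a sign each, except a copy of itself.
\<close>

lemma q_op_q_prod:
  assumes "distinct is"
  shows "q_op j * q_prod S is = lconst ((- 1) ^ card ((S - {j}) \<inter> set is)) * (q_prod S is * q_op j)"
  using assms
proof (induction "is")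
  case Nil
  show ?case by (simp add: lconst_1)
next
  case (Cons i "is")
  let ?c = "lconst ((- 1) ^ card ((S - {j}) \<inter> set is)) :: op"
  have IH: "q_op j * q_prod S is = ?c * (q_prod S is * q_op j)" using Cons by simp
  have "q_op j * q_prod S (i # is) = (if i \<in> S then (if i = j then 1 else - 1) * (q_op i * (q_op j * q_prod S is)) else q_op j * q_prod S is)"
    using q_op_anti[of j i] by (auto simp: mult.assoc[symmetric])
  also have "\<dots> = (if i \<in> S \<and> i \<noteq> j then - ?c else ?c) * (q_prod S (i # is) * q_op j)"
    using lconst_central[of "q_op i"] unfolding IH by (simp add: mult.assoc[symmetric])
  also have "(if i \<in> S \<and> i \<noteq> j then - ?c else ?c) = lconst ((- 1) ^ card ((S - {j}) \<inter> set (i # is)))"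
    using Cons.prems by (simp add: Int_insert_right lconst_uminus)
  finally show ?case .
qed

lemma even_card_toggle:
  assumes "finite T"
  shows "finite (toggle k T) \<and> (even (card (toggle k T)) \<longleftrightarrow> odd (card T))"
proof (cases "k \<in> T")
  case True
  then have c: "card T = Suc (card (T - {k}))" using assms by (metis card_Suc_Diff1)
  show ?thesis
    using assms by (simp only: toggle_def True if_True finite_Diff c even_Suc simp_thms)
next
  case False
  then show ?thesis using assms by (simp add: toggle_def)
qed

text \<open>
  \<open>vanishes True\<close> and \<open>vanishes False\<close> are the odd and the even part of the module. Infinite sets
  are ignored, since they have no parity.
\<close>

definition vanishes :: "bool \<Rightarrow> (labelling \<times> nat set \<Rightarrow> Cq) \<Rightarrow> bool"
  where "vanishes e g \<longleftrightarrow> (\<forall>y U. finite U \<longrightarrow> even (card U) = e \<longrightarrow> g (y, U) = 0)"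

lemma vanishes_gen_op: "vanishes e g \<Longrightarrow> vanishes (if odd_gen x then \<not> e else e) (app (gen_op x) g)"
  by (cases x) (auto simp: vanishes_def even_card_toggle R_op_def phi_def phi_factor_def theta_def c_op_def pole_def q_op_def p_op_def)

lemma vanishes_word:
  "vanishes e g \<Longrightarrow> vanishes (if even (length (filter odd_gen xs)) then e else \<not> e) (app (prod_list (map gen_op xs)) g)"
proof (induction xs)
  case (Cons x xs)
  then show ?case using vanishes_gen_op[OF Cons.IH[OF Cons.prems], of x] by (auto split: if_splits)
qed simp

lemma vanishes_vacuum: "vanishes False vacuum"
  by (auto simp: vanishes_def vacuum_def)

end

context spin
begin

section \<open>Faithfulness\<close>

text \<open>
  The part of a normal form with index \<open>t\<close>, stripped of \<open>D\<^sub>t\<close>, as a functional on the Fock space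
  over the labelling \<open>id\<close>: the coefficient of \<open>e\<^sub>T\<close> in the result.
\<close>

definition row_part :: "(nat \<Rightarrow> Cq) \<Rightarrow> (nat set \<Rightarrow> (nat \<Rightarrow> nat) \<Rightarrow> mpol) \<Rightarrow> nat set \<Rightarrow> (nat \<Rightarrow> nat) \<Rightarrow> (nat set \<Rightarrow> Cq) \<Rightarrow> Cq"
  where "row_part v a T t h = (\<Sum>S\<in>Pow {1..n}. poly_value n (a S t) v * app (weights.q_prod v S [1..<Suc n]) (\<lambda>(y, U). h U) (id_lab, T))"

abbreviation normal_comb :: "(nat set \<Rightarrow> (nat \<Rightarrow> nat) \<Rightarrow> mpol) \<Rightarrow> falg"
  where "normal_comb a \<equiv> \<Sum>t\<in>cosets n. \<Sum>S\<in>Pow {1..n}. p_poly (a S t) * q_mon S * coset_word n t"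

lemma row_part_zero: "row_part v a T t (\<lambda>T. 0) = 0"
proof -
  have "(\<lambda>(y, U). 0) = (\<lambda>z :: labelling \<times> nat set. 0 :: Cq)" by auto
  then show ?thesis by (simp add: row_part_def app_zero)
qed

lemma rho_normal_comb_at_id:
  assumes "weights v" "f \<approx> normal_comb a"
  shows "app (weights.rho v f) g (id_lab, T) = (\<Sum>t\<in>cosets n. row_part v a T t (\<lambda>U. app (weights.rho v (coset_word n t)) g (id_lab, U)))"
proof -
  interpret weights v by fact
  have q: "app (q_prod S is) h (id_lab, T) = app (q_prod S is) (\<lambda>(y, U). h (id_lab, U)) (id_lab, T)" for S "is" h
    by (rule q_prod_local) simp
  have "app (rho f) g (id_lab, T)
    = (\<Sum>t\<in>cosets n. \<Sum>S\<in>Pow {1..n}. poly_value n (a S t) v * app (q_prod S [1..<Suc n]) (app (rho (coset_word n t)) g) (id_lab, T))"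
    unfolding rho_eqv[OF assms]
    by (simp add: alg_map_simps app_sum_linop rho_p_poly[OF assms(1)] rho_q_mon[OF assms(1)] del: upt_Suc)
  then show ?thesis
    unfolding row_part_def by (subst (asm) q)
qed

lemma vacuum_coefficient:
  assumes "weights v" "S0 \<subseteq> {1..n}"
  defines "d \<equiv> app (weights.q_prod v S0 [1..<Suc n]) weights.vacuum (id_lab, (\<lambda>i. 2 * i) ` S0)"
  shows "d \<noteq> 0"
    and "(\<Sum>S\<in>Pow {1..n}. c S * app (weights.q_prod v S [1..<Suc n]) weights.vacuum (id_lab, (\<lambda>i. 2 * i) ` S0)) = c S0 * d"
proof -
  interpret weights v by fact
  let ?d = "\<lambda>S. app (q_prod S [1..<Suc n]) vacuum (id_lab, (\<lambda>i. 2 * i) ` S0)"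
  have set: "set [1..<Suc n] = {1..n}" by auto
  have nz: "?d S \<noteq> 0 \<longleftrightarrow> S = S0" if "S \<subseteq> {1..n}" for S
  proof -
    have "S \<inter> {1..n} = S" using that by blast
    moreover have "inj (\<lambda>i::nat. 2 * i)" by (rule injI) simp
    ultimately show ?thesis
      using q_prod_vacuum[of "[1..<Suc n]" S "(\<lambda>i. 2 * i) ` S0"] unfolding set
      by (auto simp: inj_image_eq_iff simp del: upt_Suc)
  qed
  show "d \<noteq> 0" using nz[OF assms(2)] by (simp add: d_def)
  show "(\<Sum>S\<in>Pow {1..n}. c S * ?d S) = c S0 * d"
  proof -
    have "c S * ?d S = 0" if "S \<in> Pow {1..n} - {S0}" for S
      using nz[of S] that by auto
    then have "(\<Sum>S\<in>Pow {1..n} - {S0}. c S * ?d S) = 0"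
      by (intro sum.neutral) blast
    then show ?thesis
      using assms(2) sum.remove[of "Pow {1..n}" S0 "\<lambda>S. c S * ?d S"] by (simp add: d_def del: upt_Suc)
  qed
qed

lemma row_part_vacuum: "row_part v a T t (\<lambda>U. if U = {} then 1 else 0)
    = (\<Sum>S\<in>Pow {1..n}. poly_value n (a S t) v * app (weights.q_prod v S [1..<Suc n]) (weights.vacuum) (id_lab, T))"
  if "weights v"
proof -
  interpret weights v by fact
  show ?thesis by (simp only: row_part_def vacuum_def)
qed

lemma coefficients_zero:
  assumes a: "\<And>S. a S t \<in> mpols n" and zero: "\<And>v T h. weights v \<Longrightarrow> row_part v a T t h = 0"
    and S: "S \<subseteq> {1..n}"
  shows "a S t = 0"
proof (rule poly_value_eq_0[OF a])
  fix v assume v: "weights v"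
  define d where "d = app (weights.q_prod v S [1..<Suc n]) weights.vacuum (id_lab, (\<lambda>i. 2 * i) ` S)"
  note d = vacuum_coefficient(1)[OF v S, folded d_def] and * = vacuum_coefficient(2)[OF v S, folded d_def]
  have "row_part v a ((\<lambda>i. 2 * i) ` S) t (\<lambda>U. if U = {} then 1 else 0) = poly_value n (a S t) v * d"
    by (rule trans[OF row_part_vacuum[OF v] *])
  then have "poly_value n (a S t) v * d = 0"
    by (simp only: zero[OF v])
  then show "poly_value n (a S t) v = 0" using d by simp
qed

text \<open>
  Both halves of the independence argument combined: first the \<open>D\<^sub>t\<close> are separated, then,
  applied to the vacuum, the products of the \<open>q\<close>.
\<close>

theorem rho_faithful:
  assumes f: "f \<in> C" and zero: "\<And>v. weights v \<Longrightarrow> weights.rho v f = 0"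
  shows "f \<in> I"
proof -
  obtain a where a: "\<And>S t. a S t \<in> mpols n" and normal_comb: "f \<approx> normal_comb a"
    using normal_form[OF f] by blast
  have "row_part v a T t h = 0" if v: "weights v" and t: "t \<in> cosets n" for v T t h
  proof -
    interpret weights v by fact
    show ?thesis
    proof (rule coset_word_independent[of "row_part v a T" n, OF _ _ t])
      show "row_part v a T t (\<lambda>T. 0) = 0" for t by (rule row_part_zero)
      show "(\<Sum>t\<in>cosets n. row_part v a T t (\<lambda>U. app (rho (coset_word n t)) g (id_lab, U))) = 0" for g
        using rho_normal_comb_at_id[OF v normal_comb, of g T] zero[OF v] by simp
    qed
  qed
  then have "a S t = 0" if "S \<subseteq> {1..n}" "t \<in> cosets n" for S t
    using coefficients_zero[of a t S] a that by blast
  then have "normal_comb a = 0"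
    by (simp add: p_poly_0)
  then show ?thesis using normal_comb by (simp add: eqv_def)
qed

section \<open>The even center\<close>

lemma commute_gens:
  assumes f: "f \<in> C" and gens: "\<And>x. x \<in> gens n \<Longrightarrow> A * h x = h x * A"
  shows "A * alg_map h f = alg_map h f * A"
  using f
proof (induction rule: C_induct)
  case (word w c)
  have "A * prod_list (map h xs) = prod_list (map h xs) * A" if "set xs \<subseteq> gens n" for xs
    using that
  proof (induction xs)
    case (Cons x xs)
    then show ?case using gens[of x] by (simp add: commute_mult)
  qed simp
  moreover have "A * (lconst c * B) = lconst c * (A * B)" for B
    using lconst_central[of A c] by (simp flip: mult.assoc)
  moreover have "alg_map h (prod_list (map gen xs)) = prod_list (map h xs)" for xs
    by (simp add: alg_map_prod_list comp_def alg_map_gen)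
  ultimately show ?case
    using word by (simp add: alg_map_mult alg_map_scalar mult.assoc)
qed (simp_all add: alg_map_0 alg_map_add distrib_left distrib_right)

text \<open>
  The algebra connects labellings only through the swaps of positions in \<open>{1..n}\<close>.
\<close>

lemma rho_zero_on_orbit:
  assumes "weights v" "f \<in> C" "\<And>x i. x \<in> Z \<Longrightarrow> 1 \<le> i \<Longrightarrow> i < n \<Longrightarrow> swap_lab i x \<in> Z"
    and g: "\<And>y T. y \<in> Z \<Longrightarrow> g (y, T) = 0" and x: "x \<in> Z"
  shows "app (weights.rho v f) g (x, T) = 0"
proof -
  interpret weights v by fact
  have "\<forall>x\<in>Z. \<forall>T. app (rho f) g (x, T) = 0"
    using assms(2)
  proof (induction rule: C_induct)
    case (word w c)
    have "\<forall>x\<in>Z. \<forall>T. app (prod_list (map gen_op xs)) g (x, T) = 0" if "set xs \<subseteq> gens n" for xs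
      using that
    proof (induction xs)
      case Nil
      then show ?case using g by simp
    next
      case (Cons y xs)
      then have "y \<in> gens n" and IH: "\<And>x T. x \<in> Z \<Longrightarrow> app (prod_list (map gen_op xs)) g (x, T) = 0" by auto
      from this(1) have "app (gen_op y) (app (prod_list (map gen_op xs)) g) (x, T) = 0" if "x \<in> Z" for x T
        using that assms(3) by (auto simp: gens_def p_op_def q_op_def IH intro!: R_op_zero)
      then show ?case by simp
    qed
    moreover have "rho (prod_list (map gen xs)) = prod_list (map gen_op xs)" for xs
      by (simp add: alg_map_prod_list comp_def alg_map_gen)
    ultimately show ?case using word by (simp add: alg_map_mult alg_map_scalar)
  qed (simp_all add: alg_map_0 alg_map_add)
  then show ?thesis using x by blast
qed

lemma C_gen: "x \<in> gens n \<Longrightarrow> gen x \<in> C"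
  by (rule free_alg_subset_gen)

lemma gens_intros: "1 \<le> i \<Longrightarrow> i < n \<Longrightarrow> GR i \<in> gens n" "1 \<le> i \<Longrightarrow> i \<le> n \<Longrightarrow> GP i \<in> gens n"
  "1 \<le> i \<Longrightarrow> i \<le> n \<Longrightarrow> GQ i \<in> gens n"
  by (auto simp: gens_def)

definition central :: "falg \<Rightarrow> bool"
  where "central f \<longleftrightarrow> f \<in> C \<and> (\<forall>x\<in>gens n. f * gen x \<approx> gen x * f)"

lemma central_rho:
  assumes "weights v" "central f" "x \<in> gens n"
  shows "weights.rho v f * weights.gen_op v x = weights.gen_op v x * weights.rho v f"
proof -
  interpret weights v by fact
  have "rho (f * gen x) = rho (gen x * f)"
    using assms by (intro rho_eqv) (auto simp: central_def)
  then show ?thesis by (simp add: alg_map_mult alg_map_gen)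
qed

text \<open>
  Commuting with the \<open>p\<close> forces the row of \<open>id\<close> to be diagonal, because among the labellings in
  the orbit of \<open>id\<close> the eigenvalues of the \<open>p\<close> tell \<open>id\<close> apart: an interpolation
  polynomial \<open>F\<close> in the \<open>p\<close> is 1 there and 0 at all others.
\<close>

lemma central_diagonal_at_id:
  assumes v: "weights v" and f: "central f" and g: "\<And>T. g (id_lab, T) = 0"
  shows "app (weights.rho v f) g (id_lab, T) = 0"
proof -
  interpret weights v by fact
  define D where "D i l x = (v (lab x i) - v l) / (v i - v l)" for i l x
  define F where "F x = (\<Prod>i\<in>{1..n}. \<Prod>l\<in>{1..n} - {i}. D i l x)" for x
  have "rho f * mulx (D i l) = mulx (D i l) * rho f" if "i \<in> {1..n}" for i l
  proof -
    have "mulx (D i l) = lconst (1 / (v i - v l)) * (p_op i - lconst (v l))"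
      by (simp add: D_def[abs_def] p_op_def lconst_mulx mulx_diff mulx_mulx)
    moreover have "rho f * p_op i = p_op i * rho f"
      using central_rho[OF v f gens_intros(2)[of i]] that by simp
    then have "rho f * (p_op i - lconst (v l)) = (p_op i - lconst (v l)) * rho f"
      by (simp add: left_diff_distrib right_diff_distrib lconst_central)
    ultimately show ?thesis
      by (simp only: commute_mult lconst_central)
  qed
  note D = this
  have prod: "rho f * mulx (\<lambda>x. \<Prod>j\<in>J. G j x) = mulx (\<lambda>x. \<Prod>j\<in>J. G j x) * rho f"
    if "finite J" "\<And>j. j \<in> J \<Longrightarrow> rho f * mulx (G j) = mulx (G j) * rho f" for J :: "nat set" and G
    using that
  proof (induction J)
    case empty
    then show ?case by (simp add: mulx_1)
  next
    case (insert j J)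
    then have "rho f * (mulx (G j) * mulx (\<lambda>x. \<Prod>j\<in>J. G j x)) = mulx (G j) * mulx (\<lambda>x. \<Prod>j\<in>J. G j x) * rho f"
      by (intro commute_mult) auto
    then show ?case using insert by (simp add: mulx_mulx)
  qed
  have F: "rho f * mulx F = mulx F * rho f"
    unfolding F_def[abs_def] by (intro prod D) auto
  have "F id_lab = 1"
    unfolding F_def by (intro prod.neutral ballI) (simp add: D_def)
  then have "app (rho f) g (id_lab, T) = app (mulx F * rho f) g (id_lab, T)"
    by simp
  also have "\<dots> = app (rho f) (app (mulx F) g) (id_lab, T)"
    by (simp flip: F)
  also have "\<dots> = 0"
  proof (rule rho_zero_on_orbit[OF v, where Z = "{x. (\<forall>i\<in>{1..n}. lab x i \<in> {1..n}) \<and> (\<forall>i. i \<notin> {1..n} \<longrightarrow> lab x i = i)}"])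
    show "f \<in> C" using f by (simp add: central_def)
    show "id_lab \<in> {x. (\<forall>i\<in>{1..n}. lab x i \<in> {1..n}) \<and> (\<forall>i. i \<notin> {1..n} \<longrightarrow> lab x i = i)}"
      by simp
    fix y assume y: "y \<in> {x. (\<forall>i\<in>{1..n}. lab x i \<in> {1..n}) \<and> (\<forall>i. i \<notin> {1..n} \<longrightarrow> lab x i = i)}"
    show "swap_lab i y \<in> {x. (\<forall>i\<in>{1..n}. lab x i \<in> {1..n}) \<and> (\<forall>i. i \<notin> {1..n} \<longrightarrow> lab x i = i)}"
      if "1 \<le> i" "i < n" for i
      using y that by (auto simp: transpose_def)
    show "app (mulx F) g (y, T) = 0" for T
    proof (cases "y = id_lab")
      case True
      then show ?thesis using g by simp
    next
      case False
      then obtain i where i: "lab y i \<noteq> i" using labelling_eqI[of y id_lab] by auto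
      then have i': "i \<in> {1..n}" "lab y i \<in> {1..n} - {i}" using y by auto
      have "D i (lab y i) y = 0" by (simp add: D_def)
      then have "(\<Prod>l\<in>{1..n} - {i}. D i l y) = 0"
        using i' by (intro prod_zero) auto
      then have "F y = 0"
        unfolding F_def using i' by (intro prod_zero) auto
      then show ?thesis by simp
    qed
  qed
  finally show ?thesis .
qed

text \<open>
  Since the row of \<open>id\<close> is diagonal, subtracting its diagonal part from the coefficient of
  \<open>D\<^sub>t = 1\<close> gives a vanishing combination of the \<open>D\<^sub>t\<close>. All its coefficients vanish, and those
  with \<open>t \<noteq> id\<close> have not been changed.
\<close>

lemma central_normal_form_trivial_t:
  assumes f: "central f" and a: "\<And>S t. a S t \<in> mpols n" and normal_comb: "f \<approx> normal_comb a"
    and t: "t \<in> cosets n" "t \<noteq> (\<lambda>i. i)" and S: "S \<subseteq> {1..n}"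
  shows "a S t = 0"
proof (rule coefficients_zero[of a t S, OF a _ S])
  fix v T and h :: "nat set \<Rightarrow> Cq"
  assume v: "weights v"
  interpret weights v by fact
  define b where "b t h = row_part v a T t h
    - (if t = (\<lambda>i. i) then app (rho f) (\<lambda>(y, U). if y = id_lab then h U else 0) (id_lab, T) else 0)" for t h
  have "b t h = 0"
  proof (rule coset_word_independent[of b n, OF _ _ t(1)])
    have "(\<lambda>(y, U). if y = id_lab then 0 else 0) = (\<lambda>z :: labelling \<times> nat set. 0 :: Cq)" by auto
    then show "b t (\<lambda>T. 0) = 0" for t by (simp add: b_def row_part_zero app_zero)
    fix g :: "labelling \<times> nat set \<Rightarrow> Cq"
    let ?g = "\<lambda>(y, U). if y = id_lab then g (id_lab, U) else 0"
    have "(\<Sum>t\<in>cosets n. b t (\<lambda>U. app (rho (coset_word n t)) g (id_lab, U)))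
      = app (rho f) g (id_lab, T) - (\<Sum>t\<in>cosets n. if t = (\<lambda>i. i) then
          app (rho f) (\<lambda>(y, U). if y = id_lab then app (rho (coset_word n t)) g (id_lab, U) else 0) (id_lab, T) else 0)"
      unfolding b_def by (simp add: sum_subtractf rho_normal_comb_at_id[OF v normal_comb])
    also have "\<dots> = app (rho f) g (id_lab, T) - app (rho f) ?g (id_lab, T)"
      by (simp add: finite_cosets id_cosets coset_word_id alg_map_1 cong: if_cong)
    also have "\<dots> = app (rho f) (\<lambda>z. g z - ?g z) (id_lab, T)"
      by (simp add: app_minus)
    also have "\<dots> = 0"
      by (rule central_diagonal_at_id[OF v f]) simp
    finally show "(\<Sum>t\<in>cosets n. b t (\<lambda>U. app (rho (coset_word n t)) g (id_lab, U))) = 0" .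
  qed
  then show "row_part v a T t h = 0" using t by (simp add: b_def)
qed

lemma even_rho_vanishes:
  assumes "weights v" "f \<in> C" "\<forall>w\<in>Poly_Mapping.keys f. even_word w"
  shows "weights.vanishes False (app (weights.rho v f) weights.vacuum)"
proof -
  interpret weights v by fact
  show ?thesis
    using assms(2)
  proof (induction rule: C_induct)
    case (word w c)
    have "even (length (filter odd_gen (letters w)))"
      using word assms(3) by (auto simp: even_word_def)
    then have "vanishes False (app (prod_list (map gen_op (letters w))) vacuum)"
      using vanishes_word[OF vanishes_vacuum, of "letters w"] by simp
    moreover have "rho (prod_list (map gen xs)) = prod_list (map gen_op xs)" for xs
      by (simp add: alg_map_prod_list comp_def alg_map_gen)
    ultimately show ?case by (simp add: vanishes_def alg_map_mult alg_map_scalar)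
  qed (simp_all add: vanishes_def alg_map_0 alg_map_add)
qed

text \<open>
  The terms \<open>q\<^sub>S\<close> with \<open>S\<close> odd vanish by parity. If \<open>S\<close> is even, \<open>q\<^sub>j\<close> commutes with \<open>q\<^sub>S\<close> for
  \<open>j \<notin> S\<close> and anticommutes with it for \<open>j \<in> S\<close>, which rules out every nonempty \<open>S\<close>.
\<close>

lemma even_central_polynomial:
  assumes f: "central f" and even: "\<forall>w\<in>Poly_Mapping.keys f. even_word w"
  shows "\<exists>g\<in>mpols n. f \<approx> p_poly g"
proof -
  have fC: "f \<in> C" using f by (simp add: central_def)
  obtain a where a: "\<And>S t. a S t \<in> mpols n" and normal_comb: "f \<approx> normal_comb a"
    using normal_form[OF fC] by blast
  define c where "c S = a S (\<lambda>i. i)" for S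
  have nf': "f \<approx> (\<Sum>S\<in>Pow {1..n}. p_poly (c S) * q_mon S)"
  proof -
    have "normal_comb a = (\<Sum>t\<in>cosets n. if t = (\<lambda>i. i) then (\<Sum>S\<in>Pow {1..n}. p_poly (c S) * q_mon S) else 0)"
      using central_normal_form_trivial_t[OF f a normal_comb]
      by (intro sum.cong refl) (auto simp: c_def coset_word_id p_poly_0)
    also have "\<dots> = (\<Sum>S\<in>Pow {1..n}. p_poly (c S) * q_mon S)"
      by (simp add: finite_cosets id_cosets)
    finally show ?thesis using normal_comb by simp
  qed
  have rho: "app (weights.rho v f) g (id_lab, T) = (\<Sum>S\<in>Pow {1..n}. poly_value n (c S) v * app (weights.q_prod v S [1..<Suc n]) g (id_lab, T))"
    if v: "weights v" for v g T
    unfolding rho_eqv[OF v nf']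
    by (simp add: alg_map_simps app_sum_linop rho_p_poly[OF v] rho_q_mon[OF v] del: upt_Suc)
  have cm: "c S \<in> mpols n" for S using a by (simp add: c_def)
  have odd0: "c S = 0" if S: "S \<subseteq> {1..n}" "odd (card S)" for S
  proof (rule poly_value_eq_0[OF cm])
    fix v assume v: "weights v"
    interpret weights v by fact
    have fin: "finite S" using S(1) finite_subset by blast
    define d where "d = app (q_prod S [1..<Suc n]) vacuum (id_lab, (\<lambda>i. 2 * i) ` S)"
    note d = vacuum_coefficient(1)[OF v S(1), folded d_def] and * = vacuum_coefficient(2)[OF v S(1), folded d_def]
    have "card ((\<lambda>i. 2 * i) ` S) = card S" by (rule card_image) (simp add: inj_on_def)
    then have "app (rho f) vacuum (id_lab, (\<lambda>i. 2 * i) ` S) = 0"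
      using even_rho_vanishes[OF v fC even] S fin by (simp add: vanishes_def)
    then have "poly_value n (c S) v * d = 0"
      unfolding rho[OF v] *[of "\<lambda>S. poly_value n (c S) v"] .
    then show "poly_value n (c S) v = 0" using d by simp
  qed
  have even0: "c S = 0" if S: "S \<subseteq> {1..n}" "even (card S)" "j \<in> S" for S j
  proof (rule poly_value_eq_0[OF cm])
    fix v assume v: "weights v"
    interpret weights v by fact
    let ?Q = "\<lambda>S. q_prod S [1..<Suc n]" and ?T = "(\<lambda>i. 2 * i) ` S"
    define d where "d = app (?Q S) vacuum (id_lab, ?T)"
    note d = vacuum_coefficient(1)[OF v S(1), folded d_def] and * = vacuum_coefficient(2)[OF v S(1), folded d_def]
    have j: "j \<in> {1..n}" using S by blast
    have set: "set [1..<Suc n] = {1..n}" by auto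
    define \<tau> where "\<tau> = 1 - (v j)\<^sup>2"
    \<comment> \<open>Multiplying by the generator a second time turns it into the nonzero scalar \<open>\<tau>\<close>, so that the
      coefficients can be read off the vacuum again.\<close>
    have qq2: "app (?Q S * q_op j * q_op j) vacuum (id_lab, T) = \<tau> * app (?Q S) vacuum (id_lab, T)" for S T
    proof -
      have "app (?Q S * q_op j * q_op j) vacuum (id_lab, T) = app (?Q S) (app (mulx (\<lambda>x. 1 - (v (lab x j))\<^sup>2)) vacuum) (id_lab, T)"
        by (simp add: q_op_def cliff_sq mult.assoc flip: app_ring(1) del: upt_Suc)
      also have "\<dots> = app (?Q S) (\<lambda>z. \<tau> * vacuum z) (id_lab, T)"
        by (rule q_prod_local) (simp add: \<tau>_def)
      finally show ?thesis by (simp add: app_scale)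
    qed
    have sgn: "poly_value n (c S') v * app (q_op j * ?Q S' * q_op j) vacuum (id_lab, T)
      = (if j \<in> S' then - 1 else 1) * (poly_value n (c S') v * (\<tau> * app (?Q S') vacuum (id_lab, T)))"
      if S': "S' \<subseteq> {1..n}" for S' T
    proof (cases "even (card S')")
      case False
      then show ?thesis using odd0[OF S'] by (simp add: poly_value_0)
    next
      case True
      have fin: "finite S'" using S' finite_subset by blast
      have "(S' - {j}) \<inter> {1..n} = S' - {j}" using S' by blast
      then have "q_op j * ?Q S' = lconst ((- 1) ^ card (S' - {j})) * (?Q S' * q_op j)"
        using q_op_q_prod[of "[1..<Suc n]" j S'] unfolding set by simp
      moreover have "(- 1 :: Cq) ^ card (S' - {j}) = (if j \<in> S' then - 1 else 1)"
      proof (cases "j \<in> S'")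
        case j: True
        then have "card S' = Suc (card (S' - {j}))" using fin by (metis card_Suc_Diff1)
        then show ?thesis using True j by simp
      qed (use True in simp)
      ultimately have "q_op j * ?Q S' * q_op j = lconst (if j \<in> S' then - 1 else 1) * (?Q S' * q_op j * q_op j)"
        by (simp only: mult.assoc)
      then show ?thesis
        by (simp only: app_ring(1) app_lconst qq2[unfolded app_ring(1)]) (simp add: mult_ac)
    qed
    have "app (rho f * q_op j * q_op j) vacuum (id_lab, ?T) = app (q_op j * rho f * q_op j) vacuum (id_lab, ?T)"
      using central_rho[OF v f gens_intros(3)[of j]] j by simp
    moreover have "app (rho f * q_op j * q_op j) vacuum (id_lab, ?T) = (\<Sum>S'\<in>Pow {1..n}. poly_value n (c S') v * (\<tau> * app (?Q S') vacuum (id_lab, ?T)))"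
      using qq2 by (simp add: rho[OF v] del: upt_Suc)
    moreover have "app (q_op j * rho f * q_op j) vacuum (id_lab, ?T)
      = (\<Sum>S'\<in>Pow {1..n}. (if j \<in> S' then - 1 else 1) * (poly_value n (c S') v * (\<tau> * app (?Q S') vacuum (id_lab, ?T))))"
    proof -
      have "app (q_op j * rho f * q_op j) vacuum (id_lab, ?T)
        = (\<Sum>S'\<in>Pow {1..n}. poly_value n (c S') v * app (q_op j * ?Q S' * q_op j) vacuum (id_lab, ?T))"
        by (simp add: q_op_def rho[OF v] sum_distrib_left mult_ac del: upt_Suc)
      also have "\<dots> = (\<Sum>S'\<in>Pow {1..n}. (if j \<in> S' then - 1 else 1) * (poly_value n (c S') v * (\<tau> * app (?Q S') vacuum (id_lab, ?T))))"
        by (intro sum.cong refl sgn) auto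
      finally show ?thesis .
    qed
    ultimately have eq: "(\<Sum>S'\<in>Pow {1..n}. poly_value n (c S') v * (\<tau> * app (?Q S') vacuum (id_lab, ?T)))
      = (\<Sum>S'\<in>Pow {1..n}. (if j \<in> S' then - 1 else 1) * (poly_value n (c S') v * (\<tau> * app (?Q S') vacuum (id_lab, ?T))))"
      by (simp only:)
    have "(\<Sum>S'\<in>Pow {1..n}. (if j \<in> S' then 2 else 0) * (poly_value n (c S') v * \<tau>) * app (?Q S') vacuum (id_lab, ?T))
      = (\<Sum>S'\<in>Pow {1..n}. poly_value n (c S') v * (\<tau> * app (?Q S') vacuum (id_lab, ?T))
          - (if j \<in> S' then - 1 else 1) * (poly_value n (c S') v * (\<tau> * app (?Q S') vacuum (id_lab, ?T))))"
      by (intro sum.cong refl) (simp add: mult.assoc del: upt_Suc)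
    also have "\<dots> = 0"
      by (simp only: sum_subtractf eq diff_self)
    finally have "2 * (poly_value n (c S) v * \<tau>) * d = 0"
      unfolding *[of "\<lambda>S'. (if j \<in> S' then 2 else 0) * (poly_value n (c S') v * \<tau>)"] using S by simp
    moreover have "\<tau> \<noteq> 0" using v_sq[of j] by (simp add: \<tau>_def power2_eq_square)
    ultimately show "poly_value n (c S) v = 0" using d by simp
  qed
  have c0: "c S = 0" if "S \<subseteq> {1..n}" "S \<noteq> {}" for S
    using odd0[of S] even0[of S] that by blast
  have "(\<Sum>S\<in>Pow {1..n}. p_poly (c S) * q_mon S) = p_poly (c {}) * q_mon {}"
    using c0 by (subst sum.remove[of _ "{}"]) (auto simp: p_poly_0 intro!: sum.neutral)
  moreover have "q_mon {} = 1"
    by (simp add: q_mon_def map_replicate_const)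
  ultimately show ?thesis using nf' cm by (intro bexI[of _ "c {}"]) auto
qed

text \<open>
  Commuting with \<open>R\<^sub>i\<close> at the labelling \<open>id\<close> compares the values at \<open>id\<close> and at its \<open>i\<close>-th swap.
\<close>

lemma central_polynomial_symmetric:
  assumes f: "central f" and fg: "f \<approx> p_poly g" and g: "g \<in> mpols n" and \<pi>: "\<pi> permutes {1..n}"
  shows "permute_vars \<pi> g = g"
proof -
  have adj: "poly_value n g (v \<circ> transpose i (Suc i)) = poly_value n g v" if v: "weights v" and i: "1 \<le> i" "i < n" for v i
  proof -
    interpret weights v by fact
    define F where "F x = poly_value n g (\<lambda>i. v (lab x i))" for x
    \<comment> \<open>A function over the swapped labelling whose image over \<open>id\<close> under \<open>theta i\<close> is twice the vacuum.\<close>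
    define h where "h = (\<lambda>(y, U). if y = swap_lab i id_lab then fock_theta i (\<lambda>U. if U = {} then 1 else 0) U else 0)"
    have ne: "id_lab \<noteq> swap_lab i id_lab"
    proof
      assume "id_lab = swap_lab i id_lab"
      then have "lab id_lab i = lab (swap_lab i id_lab) i" by simp
      then show False by simp
    qed
    have "rho f * R_op i = R_op i * rho f"
      using central_rho[OF v f gens_intros(1)[OF i]] by simp
    then have "mulx F * R_op i = R_op i * mulx F"
      by (simp add: rho_eqv[OF v fg] rho_p_poly[OF v] F_def[abs_def])
    then have "app (mulx F * R_op i) h (id_lab, {}) = app (R_op i * mulx F) h (id_lab, {})" by simp
    moreover have "app (R_op i) h (id_lab, {}) = 2"
      by (subst R_op_lead) (auto simp: h_def ne fock_theta_fock_theta)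
    moreover have "app (R_op i) (app (mulx F) h) (id_lab, {}) = F (swap_lab i id_lab) * 2"
      by (subst R_op_lead) (auto simp: h_def ne fock_theta_scale fock_theta_fock_theta)
    ultimately have "F id_lab = F (swap_lab i id_lab)" by simp
    then show ?thesis by (simp add: F_def comp_def)
  qed
  define Q where "Q \<pi> \<longleftrightarrow> bij \<pi> \<and> (\<forall>v. weights v \<longrightarrow> poly_value n g (v \<circ> \<pi>) = poly_value n g v)" for \<pi>
  have "Q \<pi>"
    using \<pi>
  proof (rule adjacent_transpositions_induct)
    show "Q id" by (simp add: Q_def)
    show "Q (\<pi> \<circ> \<sigma>)" if "Q \<pi>" "Q \<sigma>" for \<pi> \<sigma>
      using that weights.weights_permute by (auto simp: Q_def bij_comp simp flip: comp_assoc)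
    show "Q (transpose i (Suc i))" if "1 \<le> i" "i < n" for i
      using that adj by (simp add: Q_def)
  qed
  then have "poly_value n (permute_vars \<pi> g - g) v = 0" if "weights v" for v
    using that by (simp add: Q_def poly_value_diff poly_value_permute_vars[OF \<pi>])
  moreover have "permute_vars \<pi> g - g \<in> mpols n"
    using permute_vars_mpols[OF \<pi> g] g mpols_add[of "permute_vars \<pi> g" "- g"]
    by (simp add: mpols_def)
  ultimately have "permute_vars \<pi> g - g = 0" by (intro poly_value_eq_0)
  then show ?thesis by simp
qed

text \<open>
  By faithfulness it is enough that a symmetric function of the weights of the labels at
  \<open>1, \<dots>, n\<close> is unchanged by the swaps.
\<close>

lemma symmetric_central:
  assumes sym: "\<And>\<pi>. \<pi> permutes {1..n} \<Longrightarrow> permute_vars \<pi> g = g" and f: "f \<in> C"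
  shows "p_poly g * f \<approx> f * p_poly g"
proof (rule eqvI)
  show "p_poly g * f \<in> C" "f * p_poly g \<in> C" using f by (auto intro: C_intros C_p_poly)
  show "p_poly g * f - f * p_poly g \<in> I"
  proof (rule rho_faithful)
    show "p_poly g * f - f * p_poly g \<in> C" using f by (auto intro!: C_intros C_p_poly)
    fix v assume v: "weights v"
    interpret weights v by fact
    define F where "F x = poly_value n g (\<lambda>i. v (lab x i))" for x
    have F: "rho (p_poly g) = mulx F" by (simp add: rho_p_poly[OF v] F_def[abs_def])
    have "F (swap_lab i x) = F x" if "1 \<le> i" "i < n" for i x
    proof -
      have \<pi>: "transpose i (Suc i) permutes {1..n}"
        using that by (intro permutes_swap_id) auto
      show ?thesis
        using poly_value_permute_vars[OF \<pi>, of g "\<lambda>i. v (lab x i)"] sym[OF \<pi>] by (simp add: F_def comp_def)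
    qed
    then have "mulx F * gen_op x = gen_op x * mulx F" if "x \<in> gens n" for x
      using that by (auto simp: gens_def p_op_def q_op_mulx mulx_mulx mult.commute R_op_def
          left_diff_distrib right_diff_distrib phi_mulx pole_mulx)
    then have "mulx F * rho f = rho f * mulx F"
      by (rule commute_gens[OF f])
    then show "rho (p_poly g * f - f * p_poly g) = 0"
      by (simp add: alg_map_diff alg_map_mult F)
  qed
qed


section \<open>Passing to the quotient\<close>

lemma free_alg_minus: "f \<in> C \<Longrightarrow> g \<in> C \<Longrightarrow> f \<ominus>\<^bsub>free_alg n\<^esub> g = f - g"
proof -
  assume fg: "f \<in> C" "g \<in> C"
  interpret ring "free_alg n" by (rule ring_free_alg)
  have "\<ominus>\<^bsub>free_alg n\<^esub> g = - g"
    by (rule minus_equality) (use fg in \<open>simp_all add: free_alg_ops free_alg_subset_uminus\<close>)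
  then show ?thesis by (simp add: a_minus_def free_alg_ops)
qed

lemma cls_eq_iff: "f \<in> C \<Longrightarrow> g \<in> C \<Longrightarrow> cls n f = cls n g \<longleftrightarrow> f \<approx> g"
  using ring.quotient_eq_iff_same_a_r_cos[OF ring_free_alg ideal_rel_ideal, of f n g]
  by (simp add: cls_def eqv_def free_alg_minus)

lemma cls_mult: "f \<in> C \<Longrightarrow> g \<in> C \<Longrightarrow> cls n f \<otimes>\<^bsub>spin_hecke n\<^esub> cls n g = cls n (f * g)"
  using ideal.rcoset_mult_add[OF ideal_rel_ideal, of f n g]
  by (simp add: spin_hecke_def FactRing_def cls_def free_alg_ops)

lemma cls_add: "f \<in> C \<Longrightarrow> g \<in> C \<Longrightarrow> cls n f \<oplus>\<^bsub>spin_hecke n\<^esub> cls n g = cls n (f + g)"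
  using ring_hom_add[OF ideal.rcos_ring_hom[OF ideal_rel_ideal], of f n g]
  by (simp add: spin_hecke_def cls_def free_alg_ops)

lemma cls_1: "\<one>\<^bsub>spin_hecke n\<^esub> = cls n 1"
  by (simp add: spin_hecke_def FactRing_def cls_def free_alg_ops)

lemma carrier_spin_hecke: "carrier (spin_hecke n) = cls n ` C"
  by (auto simp: spin_hecke_def FactRing_def A_RCOSETS_def' cls_def)

lemma eval_p_eq: "eval_p n g = cls n (p_poly g)"
  by (simp only: eval_p_def p_poly_def p_mon_def)

lemma p_poly_mult: "p_poly (f * g) \<approx> p_poly f * p_poly g"
proof (rule eqvI)
  show "p_poly (f * g) - p_poly f * p_poly g \<in> I"
  proof (rule rho_faithful)
    show "weights.rho v (p_poly (f * g) - p_poly f * p_poly g) = 0" if "weights v" for v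
      by (simp add: alg_map_diff alg_map_mult rho_p_poly[OF that] mulx_mulx poly_value_mult)
  qed (intro C_intros C_p_poly)
qed (intro C_intros C_p_poly)+

lemma p_mon_0: "p_mon 0 = 1"
  by (simp add: p_mon_def map_replicate_const)

lemma p_poly_single_0: "p_poly (Poly_Mapping.single 0 c) = scalar c"
  by (simp add: p_poly_single p_mon_0)

lemma p_poly_1: "p_poly 1 = 1"
  using p_poly_single_0[of 1] by (simp add: scalar_1)

lemma p_poly_inject:
  assumes "f \<in> mpols n" "g \<in> mpols n" "p_poly f \<approx> p_poly g"
  shows "f = g"
proof -
  have "poly_value n (f - g) v = 0" if v: "weights v" for v
  proof -
    have "mulx (\<lambda>x. poly_value n f (\<lambda>i. v (lab x i))) = mulx (\<lambda>x. poly_value n g (\<lambda>i. v (lab x i)))"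
      using rho_eqv[OF v assms(3)] by (simp add: rho_p_poly[OF v])
    then have "app (mulx (\<lambda>x. poly_value n f (\<lambda>i. v (lab x i)))) (\<lambda>_. 1) (id_lab, {})
      = app (mulx (\<lambda>x. poly_value n g (\<lambda>i. v (lab x i)))) (\<lambda>_. 1) (id_lab, {})" by simp
    then show ?thesis by (simp add: poly_value_diff)
  qed
  moreover have "f - g \<in> mpols n"
    using mpols_add[OF assms(1), of "- g"] assms(2) by (simp add: mpols_def)
  ultimately have "f - g = 0" by (intro poly_value_eq_0)
  then show ?thesis by simp
qed

lemma even_p_poly:
  assumes "w \<in> Poly_Mapping.keys (p_poly g)"
  shows "even_word w"
proof -
  define E where "E f \<longleftrightarrow> (\<forall>w\<in>Poly_Mapping.keys f. even_word w)" for f :: falg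
  have E0: "E 0" by (simp add: E_def)
  have E1: "E 1" by (simp add: E_def even_word_def zero_word_def)
  have Eadd: "E (a + b)" if "E a" "E b" for a b
    using that Poly_Mapping.keys_add[of a b] unfolding E_def by blast
  have Emult: "E (a * b)" if "E a" "E b" for a b
  proof -
    have "even_word (u + v)" if "even_word u" "even_word v" for u v
      using that by (simp add: even_word_def plus_word_def)
    then show ?thesis
      using that Poly_Mapping.keys_mult[of a b] unfolding E_def by blast
  qed
  have Ep: "E (p i)" and Es: "E (scalar c)" for i c
    by (simp_all add: E_def gen_def scalar_def even_word_def zero_word_def)
  have Epow: "E (p i ^ k)" for i k
    by (induction k) (simp_all add: E1 Emult Ep)
  have "E (prod_list (map (\<lambda>i. p i ^ h i) xs))" for h xs
    by (induction xs) (simp_all add: E1 Emult Epow)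
  then have Epw: "E (p_mon m)" for m
    by (simp only: p_mon_def)
  have "E (p_poly g)"
    by (induction g rule: poly_mapping_additive_induct)
      (simp_all add: p_poly_0 p_poly_add p_poly_single E0 Eadd Emult Es Epw)
  then show ?thesis using assms by (simp add: E_def)
qed

lemma even_center_eq:
  "even_center n = (\<lambda>g. eval_p n g) ` carrier (sym_pols n)"
proof (intro equalityI subsetI)
  fix z assume z: "z \<in> even_center n"
  then obtain f where f: "f \<in> C" "\<forall>w\<in>Poly_Mapping.keys f. even_word w" and zf: "z = cls n f"
    by (auto simp: even_center_def even_part_def)
  have "central f"
    unfolding central_def
  proof (intro conjI ballI f)
    fix x assume x: "x \<in> gens n"
    then have "cls n f \<otimes>\<^bsub>spin_hecke n\<^esub> cls n (gen x) = cls n (gen x) \<otimes>\<^bsub>spin_hecke n\<^esub> cls n f"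
      using z C_gen[OF x] by (simp add: even_center_def zf carrier_spin_hecke)
    then show "f * gen x \<approx> gen x * f"
      using f C_gen[OF x] by (simp add: cls_mult cls_eq_iff free_alg_subset_mult)
  qed
  then obtain g where g: "g \<in> mpols n" "f \<approx> p_poly g"
    using even_central_polynomial f(2) by blast
  have "g \<in> carrier (sym_pols n)"
    using g central_polynomial_symmetric[OF \<open>central f\<close> g(2,1)] by (simp add: sym_pols_def)
  moreover have "z = eval_p n g"
    using g(2) by (simp add: zf eval_p_eq cls_eq_iff f C_p_poly)
  ultimately show "z \<in> (\<lambda>g. eval_p n g) ` carrier (sym_pols n)" by blast
next
  fix z assume "z \<in> (\<lambda>g. eval_p n g) ` carrier (sym_pols n)"
  then obtain g where g: "\<And>\<pi>. \<pi> permutes {1..n} \<Longrightarrow> permute_vars \<pi> g = g" and z: "z = cls n (p_poly g)"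
    by (auto simp: sym_pols_def eval_p_eq)
  have "z \<in> even_part n"
    unfolding even_part_def z using C_p_poly even_p_poly by blast
  moreover have "z \<otimes>\<^bsub>spin_hecke n\<^esub> a = a \<otimes>\<^bsub>spin_hecke n\<^esub> z" if a: "a \<in> carrier (spin_hecke n)" for a
  proof -
    obtain f where f: "f \<in> C" "a = cls n f" using a by (auto simp: carrier_spin_hecke)
    then show ?thesis
      using symmetric_central[OF g f(1)]
      by (simp add: z cls_mult C_p_poly cls_eq_iff free_alg_subset_mult)
  qed
  ultimately show "z \<in> even_center n" by (simp add: even_center_def)
qed

end

theorem theorem5p6:
  fixes n :: nat
  assumes "n \<ge> 1"
  shows "eval_p n \<in> ring_iso (sym_pols n) (spin_hecke n \<lparr>carrier := even_center n\<rparr>)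
    \<and> (\<forall>c. eval_p n (Poly_Mapping.single 0 c) = cls n (scalar c))"
proof (intro conjI allI)
  interpret spin n .
  show "eval_p n (Poly_Mapping.single 0 c) = cls n (scalar c)" for c
    by (simp add: eval_p_eq p_poly_single_0)
  show "eval_p n \<in> ring_iso (sym_pols n) (spin_hecke n \<lparr>carrier := even_center n\<rparr>)"
  proof (rule ring_iso_memI)
    show "eval_p n f \<in> carrier (spin_hecke n \<lparr>carrier := even_center n\<rparr>)"
      if "f \<in> carrier (sym_pols n)" for f
      using that by (simp add: even_center_eq)
    show "eval_p n (f \<otimes>\<^bsub>sym_pols n\<^esub> g) = eval_p n f \<otimes>\<^bsub>spin_hecke n \<lparr>carrier := even_center n\<rparr>\<^esub> eval_p n g"
      for f g
      using p_poly_mult[of f g] by (simp add: sym_pols_def eval_p_eq cls_mult C_p_poly cls_eq_iff free_alg_subset_mult)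
    show "eval_p n (f \<oplus>\<^bsub>sym_pols n\<^esub> g) = eval_p n f \<oplus>\<^bsub>spin_hecke n \<lparr>carrier := even_center n\<rparr>\<^esub> eval_p n g"
      for f g
      by (simp add: sym_pols_def eval_p_eq cls_add C_p_poly p_poly_add)
    show "eval_p n \<one>\<^bsub>sym_pols n\<^esub> = \<one>\<^bsub>spin_hecke n \<lparr>carrier := even_center n\<rparr>\<^esub>"
      by (simp add: sym_pols_def eval_p_eq p_poly_1 cls_1)
    have "inj_on (eval_p n) (carrier (sym_pols n))"
      by (rule inj_onI) (auto simp: sym_pols_def eval_p_eq cls_eq_iff C_p_poly intro: p_poly_inject)
    then show "bij_betw (eval_p n) (carrier (sym_pols n)) (carrier (spin_hecke n \<lparr>carrier := even_center n\<rparr>))"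
      by (simp add: bij_betw_def even_center_eq)
  qed
qed

end
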